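(* Under the standing assumptions in the context, let $(X_i)_{i\in\mathbb N}$ be an i.i.d. sample with law $\mu$ and let $\mathcal J_{\Omega,N}$ be the open-loop potential functionals defined in the context. Then, as $N\to\infty$, $\mathcal J_{\Omega,N}$ $\Gamma$-converges to $\mathcal J_\Omega$ in $\mathscr P_\Omega(\mathcal X\times\mathcal Y)$ equipped with the narrow topology of random probability measures, where $$\mathcal J_\Omega(\boldsymbol\gamma)=\begin{cases}\mathcal J(\gamma),&\text{if }\boldsymbol\gamma=\gamma\text{ a.s. for some (non-random) }\gamma\in\mathscr P_\mu(\mathcal X\times\mathcal Y),\\+\infty,&\text{otherwise.}\end{cases}$$
   Context: Standing assumptions: $\mathcal X,\mathcal Y$ are Polish spaces; $\mu\in\mathscr P(\mathcal X)$ (Borel probability measures) is atomless; $c:\mathcal X\times\mathcal Y\to[0,+\infty]$, $L:\mathcal Y\to[0,+\infty]$, $H:\mathcal Y\times\mathcal Y\to[0,+\infty]$ are lower semi-continuous; $H$ is symmetric; $\{L\le\kappa\}$ is compact for every $\kappa>0$. $(\Omega,\mathcal F,\mathbb P)$ is a probability space carrying an i.i.d. sequence $(X_i)_{i\in\mathbb N}$ of $\mathcal X$-valued random variables with law $\mu$. Notation: $\mathcal L(\nu)=\int L\,d\nu$, $\mathcal H(\nu,\bar\nu)=\int H\,d\nu\otimes\bar\nu$; $\mathscr P_\mu(\mathcal X\times\mathcal Y)$ is the set of $\gamma\in\mathscr P(\mathcal X\times\mathcal Y)$ with first marginal $\mu$; for such $\gamma$ with second marginal $\nu$, $\mathcal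 J(\gamma)=\int c\,d\gamma+\mathcal L(\nu)+\mathcal H(\nu,\nu)$. Random measures: for a Polish space $\mathcal Z$, $\mathscr P_\Omega(\mathcal Z)$ is the set of measurable maps $\boldsymbol\gamma:\Omega\to\mathscr P(\mathcal Z)$ ($\mathscr P(\mathcal Z)$ with the Borel $\sigma$-algebra of the narrow topology). The narrow topology of $\mathscr P_\Omega(\mathcal Z)$ is the weakest one making $\boldsymbol\gamma\mapsto\mathbb E[\int_{\mathcal Z} f(\omega,z)\,d(\boldsymbol\gamma(\omega))(z)]$ continuous for all $f:\Omega\times\mathcal Z\to\mathbb R$ such that $f(\omega,\cdot)$ is bounded and continuous a.s., $f(\cdot,z)$ is $\mathcal F$-measurable for all $z$, and $\omega\mapsto\|f(\omega,\cdot)\|_{L^\infty}$ is $\mathbb P$-integrable. A family $(\nu^x)_{x\in\mathcal X}\subset\mathscr P(\mathcal Y)$ is measurable if $x\mapsto\nu^x(B)$ is Borel for every Borel $B\subset\mathcal Y$. $\mathscr P_{\Omega,N}(\mathcal X\times\mathcal Y)$ is the set of random measures $\boldsymbol\gamma_N=\frac1N\sum_{i=1}^N\delta_{X_i}\otimes\nu_i^{X_i}$ with $(\nu_i^x)_{x\in\mathcal X}$ measurable for each $i=1,\dots,N$. The open-loop potential is $$\mathcal J_{\Omega,N}(\boldsymbol\gamma_N)=\mathbb E\Big[\int c\,d\boldsymbol\gamma_N+\frac1N\sum_{i=1}^N\mathcal L(\nu_i^{X_i})+\frac1{N^2}\sum_{i\ne j}\mathcal H(\nu_i^{X_i},\nu_j^{X_j})\Big]$$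 if $\boldsymbol\gamma_N\in\mathscr P_{\Omega,N}(\mathcal X\times\mathcal Y)$, and $+\infty$ otherwise. $\Gamma$-convergence of $\mathscr F_N$ to $\mathscr F$: (liminf) for every sequence $z_N\to z$, $\mathscr F(z)\le\liminf_N\mathscr F_N(z_N)$; (limsup) for every $z$ there is a sequence $z_N\to z$ with $\limsup_N\mathscr F_N(z_N)\le\mathscr F(z)$. *)

theory Defs
  imports "HOL-Probability.Probability"
begin

definition lower_semicontinuous :: "('a::topological_space \<Rightarrow> ennreal) \<Rightarrow> bool" where
  "lower_semicontinuous f \<longleftrightarrow> (\<forall>a. open {x. a < f x})"

definition atomless :: "'a measure \<Rightarrow> bool" where
  "atomless M \<longleftrightarrow>
     (\<forall>A\<in>sets M. emeasure M A > 0 \<longrightarrow>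
        (\<exists>B\<in>sets M. B \<subseteq> A \<and> 0 < emeasure M B \<and> emeasure M B < emeasure M A))"

definition iid_sample :: "'w measure \<Rightarrow> 'x::topological_space measure \<Rightarrow> (nat \<Rightarrow> 'w \<Rightarrow> 'x) \<Rightarrow> bool" where
  "iid_sample P \<mu> X \<longleftrightarrow>
     prob_space.indep_vars P (\<lambda>_. borel) X UNIV \<and> (\<forall>i. distr P borel (X i) = \<mu>)"


text \<open>The weakest topology on \<open>S\<close> making all maps in \<open>F\<close> continuous; inserting \<open>S\<close> among
  the generators makes the carrier equal to \<open>S\<close> also when \<open>F\<close> is empty.\<close>

definition initial_topology :: "'a set \<Rightarrow> ('a \<Rightarrow> real) set \<Rightarrow> 'a topology" where
  "initial_topology S F =
     topology_generated_by (insert S {{s \<in> S. \<phi> s \<in> U} | \<phi> U. \<phi> \<in> F \<and> open U})"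

definition borel_of :: "'a topology \<Rightarrow> 'a measure" where
  "borel_of T = sigma (topspace T) {U. openin T U}"


definition borel_probs :: "'z::topological_space measure set" where
  "borel_probs = {\<nu>. sets \<nu> = sets borel \<and> prob_space \<nu>}"

definition narrow_topology :: "'z::topological_space measure topology" where
  "narrow_topology = initial_topology borel_probs
     {\<lambda>\<nu>. \<integral>z. g z \<partial>\<nu> | g :: 'z \<Rightarrow> real. continuous_on UNIV g \<and> bounded (range g)}"

definition random_measures :: "'w measure \<Rightarrow> ('w \<Rightarrow> 'z::topological_space measure) set" where
  "random_measures P = measurable P (borel_of narrow_topology)"

text \<open>Since \<open>f \<omega>\<close> is bounded and continuous only for almost every \<open>\<omega>\<close>, the functions
  \<open>\<omega> \<mapsto> sup \<bar>f \<omega>\<bar>\<close> and \<open>\<omega> \<mapsto> \<integral> f \<omega> d\<gamma>(\<omega>)\<close> agree with a \<open>P\<close>-measurable function only almost surely.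
  They are therefore integrated with respect to the completion of \<open>P\<close>; with \<open>P\<close> itself, the
  Bochner integral of such a function could collapse to its default value \<open>0\<close>.\<close>

definition random_test_functions :: "'w measure \<Rightarrow> ('w \<Rightarrow> 'z::topological_space \<Rightarrow> real) set" where
  "random_test_functions P = {f.
     (AE \<omega> in P. bounded (range (f \<omega>)) \<and> continuous_on UNIV (f \<omega>)) \<and>
     (\<forall>z. (\<lambda>\<omega>. f \<omega> z) \<in> borel_measurable P) \<and>
     integrable (completion P) (\<lambda>\<omega>. SUP z. \<bar>f \<omega> z\<bar>)}"

definition random_narrow_topology :: "'w measure \<Rightarrow> ('w \<Rightarrow> 'z::topological_space measure) topology" where
  "random_narrow_topology P = initial_topology (random_measures P)
     {\<lambda>\<gamma>. \<integral>\<omega>. (\<integral>z. f \<omega> z \<partial>\<gamma> \<omega>) \<partial>completion P | f. f \<in> random_test_functions P}"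


definition L_energy :: "('y \<Rightarrow> ennreal) \<Rightarrow> 'y measure \<Rightarrow> ennreal" where
  "L_energy L \<nu> = (\<integral>\<^sup>+y. L y \<partial>\<nu>)"

definition H_energy :: "('y \<times> 'y \<Rightarrow> ennreal) \<Rightarrow> 'y measure \<Rightarrow> 'y measure \<Rightarrow> ennreal" where
  "H_energy H \<nu> \<nu>' = (\<integral>\<^sup>+p. H p \<partial>(\<nu> \<Otimes>\<^sub>M \<nu>'))"

definition couplings_from ::
  "'x::topological_space measure \<Rightarrow> ('x \<times> 'y::topological_space) measure set" where
  "couplings_from \<mu> = {\<gamma> \<in> borel_probs. distr \<gamma> borel fst = \<mu>}"

definition J_fun ::
  "('x \<times> 'y \<Rightarrow> ennreal) \<Rightarrow> ('y \<Rightarrow> ennreal) \<Rightarrow> ('y \<times> 'y \<Rightarrow> ennreal) \<Rightarrow>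
   ('x::topological_space \<times> 'y::topological_space) measure \<Rightarrow> ennreal" where
  "J_fun c L H \<gamma> = (let \<nu> = distr \<gamma> borel snd in
     (\<integral>\<^sup>+p. c p \<partial>\<gamma>) + L_energy L \<nu> + H_energy H \<nu> \<nu>)"

text \<open>The limit functional. The measure picked by \<open>THE\<close> is unique because \<open>P\<close> is a probability.\<close>

definition J_Omega ::
  "'w measure \<Rightarrow> 'x measure \<Rightarrow>
   ('x \<times> 'y \<Rightarrow> ennreal) \<Rightarrow> ('y \<Rightarrow> ennreal) \<Rightarrow> ('y \<times> 'y \<Rightarrow> ennreal) \<Rightarrow>
   ('w \<Rightarrow> ('x::topological_space \<times> 'y::topological_space) measure) \<Rightarrow> ennreal" where
  "J_Omega P \<mu> c L H \<gamma> =
     (if \<exists>\<gamma>\<^sub>0\<in>couplings_from \<mu>. AE \<omega> in P. \<gamma> \<omega> = \<gamma>\<^sub>0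
      then J_fun c L H (THE \<gamma>\<^sub>0. \<gamma>\<^sub>0 \<in> couplings_from \<mu> \<and> (AE \<omega> in P. \<gamma> \<omega> = \<gamma>\<^sub>0))
      else \<infinity>)"


definition measurable_family :: "('x::topological_space \<Rightarrow> 'y::topological_space measure) \<Rightarrow> bool" where
  "measurable_family \<nu> \<longleftrightarrow>
     (\<forall>x. \<nu> x \<in> borel_probs) \<and>
     (\<forall>B\<in>sets borel. (\<lambda>x. emeasure (\<nu> x) B) \<in> borel_measurable borel)"

text \<open>The sample points are numbered from 0, so that the first \<open>N\<close> of them are \<open>X i\<close> with
  \<open>i < N\<close>. As \<open>\<gamma> \<omega>\<close> is a Borel measure, the last condition says that
  \<open>\<gamma> \<omega>\<close> equals \<open>1/N \<Sum>\<^sub>i \<delta>\<^bsub>X\<^sub>i(\<omega>)\<^esub> \<otimes> \<nu>\<^sub>i\<^bsup>X\<^sub>i(\<omega>)\<^esup>\<close> for every \<open>\<omega>\<close>.\<close>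

definition represents ::
  "'w measure \<Rightarrow> (nat \<Rightarrow> 'w \<Rightarrow> 'x::topological_space) \<Rightarrow> nat \<Rightarrow>
   (nat \<Rightarrow> 'x \<Rightarrow> 'y::topological_space measure) \<Rightarrow> ('w \<Rightarrow> ('x \<times> 'y) measure) \<Rightarrow> bool" where
  "represents P X N \<nu> \<gamma> \<longleftrightarrow>
     (\<forall>i<N. measurable_family (\<nu> i)) \<and>
     (\<forall>\<omega>\<in>space P. \<forall>A\<in>sets borel.
        emeasure (\<gamma> \<omega>) A =
          (\<Sum>i<N. emeasure (return borel (X i \<omega>) \<Otimes>\<^sub>M \<nu> i (X i \<omega>)) A) / of_nat N)"

definition open_loop_measures ::
  "'w measure \<Rightarrow> (nat \<Rightarrow> 'w \<Rightarrow> 'x::topological_space) \<Rightarrow> nat \<Rightarrow>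
   ('w \<Rightarrow> ('x \<times> 'y::topological_space) measure) set" where
  "open_loop_measures P X N = {\<gamma> \<in> random_measures P. \<exists>\<nu>. represents P X N \<nu> \<gamma>}"

text \<open>For atomless \<open>\<mu>\<close> the sample points are almost surely distinct, so \<open>\<gamma>\<close> determines the measures
  \<open>\<nu> i (X i \<omega>)\<close> almost surely and the value below does not depend on the chosen representation.\<close>

definition J_Omega_N ::
  "'w measure \<Rightarrow> (nat \<Rightarrow> 'w \<Rightarrow> 'x) \<Rightarrow>
   ('x \<times> 'y \<Rightarrow> ennreal) \<Rightarrow> ('y \<Rightarrow> ennreal) \<Rightarrow> ('y \<times> 'y \<Rightarrow> ennreal) \<Rightarrow> nat \<Rightarrow>
   ('w \<Rightarrow> ('x::topological_space \<times> 'y::topological_space) measure) \<Rightarrow> ennreal" where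
  "J_Omega_N P X c L H N \<gamma> =
     (if \<gamma> \<in> open_loop_measures P X N
      then let \<nu> = (SOME \<nu>. represents P X N \<nu> \<gamma>) in
        (\<integral>\<^sup>+\<omega>. (\<integral>\<^sup>+p. c p \<partial>\<gamma> \<omega>)
           + (\<Sum>i<N. L_energy L (\<nu> i (X i \<omega>))) / of_nat N
           + (\<Sum>i<N. \<Sum>j\<in>{..<N} - {i}. H_energy H (\<nu> i (X i \<omega>)) (\<nu> j (X j \<omega>))) / (of_nat N)\<^sup>2
         \<partial>P)
      else \<infinity>)"


definition Gamma_converges ::
  "'a topology \<Rightarrow> (nat \<Rightarrow> 'a \<Rightarrow> ennreal) \<Rightarrow> ('a \<Rightarrow> ennreal) \<Rightarrow> bool" where
  "Gamma_converges T F\<^sub>N F \<longleftrightarrow>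
     (\<forall>z\<in>topspace T. \<forall>z\<^sub>N. range z\<^sub>N \<subseteq> topspace T \<and> limitin T z\<^sub>N z sequentially \<longrightarrow>
        F z \<le> liminf (\<lambda>N. F\<^sub>N N (z\<^sub>N N))) \<and>
     (\<forall>z\<in>topspace T. \<exists>z\<^sub>N. range z\<^sub>N \<subseteq> topspace T \<and> limitin T z\<^sub>N z sequentially \<and>
        limsup (\<lambda>N. F\<^sub>N N (z\<^sub>N N)) \<le> F z)"

end

theory Submission
  imports Defs
begin

text \<open>
The terms of an open-loop measure \<open>\<gamma>\<^sub>N = 1/N \<Sum>\<^sub>i \<delta>\<^bsub>X\<^sub>i\<^esub> \<otimes> \<nu>\<^sub>i\<^bsup>X\<^sub>i\<^esup>\<close> are independent. This has two
consequences, which carry the lower bound: integrals against \<open>\<gamma>\<^sub>N\<close> concentrate around their means, so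
limits of open-loop measures are deterministic; and the expected energy of \<open>\<gamma>\<^sub>N\<close> depends only on
averaged, deterministic measures, so its lower semicontinuity is a question about narrow convergence
of probability measures.

For the lower bound, let \<open>\<gamma>\<^sub>N \<rightarrow> \<gamma>\<close> along a subsequence of open-loop measures. For continuous \<open>g\<close> with
values in \<open>[0,1]\<close>, the variable \<open>\<integral>g d\<gamma>\<^sub>N\<close> minus its mean tends to \<open>0\<close> almost surely
(\<open>open_loop_concentration\<close>). Testing the convergence with \<open>1\<^sub>A(\<omega>) g(z)\<close> gives
\<open>E[1\<^sub>A \<integral>g d\<gamma>] = P(A) E[\<integral>g d\<gamma>]\<close> for every event \<open>A\<close>, hence \<open>\<gamma>\<close> is almost surely equal to one measure
\<open>\<gamma>\<^sub>0\<close>, and the mean measures \<open>E[\<gamma>\<^sub>N]\<close> converge narrowly to \<open>\<gamma>\<^sub>0\<close>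
(\<open>open_loop_limit_deterministic\<close>). The first marginal of every \<open>E[\<gamma>\<^sub>N]\<close> is \<open>\<mu>\<close>, so that of \<open>\<gamma>\<^sub>0\<close> is
\<open>\<mu>\<close> too. With \<open>n\<^sub>i = \<integral>\<nu>\<^sub>i\<^bsup>x\<^esup> d\<mu>(x)\<close>, independence of \<open>X\<^sub>i\<close> and \<open>X\<^sub>j\<close> for \<open>i \<noteq> j\<close> turns the expected energy into
\<open>\<integral>c dE[\<gamma>\<^sub>N] + \<integral>L dn + 1/N\<^sup>2 \<Sum>\<^bsub>i\<noteq>j\<^esub> H(n\<^sub>i, n\<^sub>j)\<close>, where \<open>n = 1/N \<Sum>\<^sub>i n\<^sub>i\<close> is the second marginal of \<open>E[\<gamma>\<^sub>N]\<close>
(\<open>nn_integral_open_loop_energy\<close>). The double sum lacks the diagonal of \<open>H(n, n)\<close>, which may be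
infinite; for the truncation \<open>min H K\<close> it costs at most \<open>K/N\<close>
(\<open>nn_integral_pair_average_truncated_le\<close>). Every term is therefore lower semicontinuous in the
limit \<open>N \<rightarrow> \<infinity>\<close>, and \<open>K \<rightarrow> \<infinity>\<close> by monotone convergence (\<open>J_fun_le_liminf\<close>).

For the upper bound, if \<open>\<gamma> = \<gamma>\<^sub>0\<close> almost surely, disintegrate \<open>\<gamma>\<^sub>0(dx, dy) = \<mu>(dx) \<nu>\<^sup>x(dy)\<close> and use the kernel \<open>\<nu>\<close>
for every particle. The strong law of large numbers gives almost sure narrow convergence to \<open>\<gamma>\<^sub>0\<close>, and
the expected energy differs from that of \<open>\<gamma>\<^sub>0\<close> only by a factor \<open>(N-1)/N\<close> in the interaction.

Narrow convergence enters through the portmanteau inequalities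
\<open>M U \<le> liminf\<^sub>n M\<^sub>n U\<close> for open \<open>U\<close>. They can be checked on a countable family of sets, hence almost
surely, and they pass to lower semicontinuous functions and to product measures. The disintegration
is built on sequences of binary digits, where a kernel can be simulated digit by digit, and carried
over to a Polish space by a measurable left inverse of an encoding.
\<close>

section \<open>Narrow convergence through open sets\<close>

text \<open>The portmanteau form of narrow convergence \<open>M\<^sub>n \<rightarrow> M\<close> of probability measures. In contrast to
convergence of integrals of test functions, it can be verified on countably many sets.\<close>

definition liminf_on_opens :: "(nat \<Rightarrow> 'a::topological_space measure) \<Rightarrow> 'a measure \<Rightarrow> bool" where
  "liminf_on_opens M\<^sub>n M \<longleftrightarrow> (\<forall>U. open U \<longrightarrow> emeasure M U \<le> liminf (\<lambda>n. emeasure (M\<^sub>n n) U))"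

lemma open_eq_incseq_finite_unions:
  fixes U :: "'a::topological_space set"
  assumes "topological_basis B" "countable B" "open U"
  obtains V where "incseq V" "(\<Union>n. V n) = U" "\<And>n::nat. V n \<in> Union ` {F. finite F \<and> F \<subseteq> B}"
proof (cases "{b\<in>B. b \<subseteq> U} = {}")
  case True
  then have "U = {}"
    using assms by (metis (mono_tags, lifting) Collect_empty_eq equals0I topological_basisE)
  then show ?thesis
    by (intro that[of "\<lambda>_. {}"]) (auto simp: incseq_def image_iff)
next
  case False
  define b where "b = from_nat_into {b\<in>B. b \<subseteq> U}"
  have rb: "range b = {b\<in>B. b \<subseteq> U}"
    unfolding b_def using False assms by (intro range_from_nat_into) auto
  have U: "\<Union>{b\<in>B. b \<subseteq> U} = U"
    using assms by (auto elim: topological_basisE[OF assms(1)])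
  show ?thesis
  proof (rule that[of "\<lambda>n. \<Union> (b ` {..<n})"])
    show "incseq (\<lambda>n. \<Union> (b ` {..<n}))"
      by (intro monoI UN_mono) auto
    show "(\<Union>n. \<Union> (b ` {..<n})) = U"
    proof -
      have "(\<Union>n. \<Union> (b ` {..<n})) = \<Union> (range b)" by blast
      then show ?thesis by (simp only: rb U)
    qed
    fix n
    have "b ` {..<n} \<subseteq> B" using rb by auto
    then show "\<Union> (b ` {..<n}) \<in> Union ` {F. finite F \<and> F \<subseteq> B}" by (auto intro!: imageI)
  qed
qed

text \<open>An open set is an increasing union of finite unions of basic sets, and \<open>M\<close> is continuous along it.
When the basis is countable, only countably many inequalities remain, which is what an almost sure
statement can provide.\<close>

lemma liminf_on_opens_from_basis:
  fixes M :: "'a::topological_space measure"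
  assumes B: "topological_basis B" "countable B"
    and sets: "sets M = sets borel" "\<And>n. sets (M\<^sub>n n) = sets borel"
    and le: "\<And>F. finite F \<Longrightarrow> F \<subseteq> B \<Longrightarrow> emeasure M (\<Union>F) \<le> liminf (\<lambda>n. emeasure (M\<^sub>n n) (\<Union>F))"
  shows "liminf_on_opens M\<^sub>n M"
  unfolding liminf_on_opens_def
proof safe
  fix U :: "'a set" assume U: "open U"
  obtain V where V: "incseq V" "(\<Union>n. V n) = U"
      "\<And>n::nat. V n \<in> Union ` {F. finite F \<and> F \<subseteq> B}"
    using open_eq_incseq_finite_unions[OF B U] by metis
  have o: "open (V k)" for k
    using V(3)[of k] topological_basis_open[OF B(1)] by (auto intro!: open_Union) blast
  have "emeasure M U = (SUP k. emeasure M (V k))"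
    unfolding V(2)[symmetric] using o by (intro SUP_emeasure_incseq[symmetric] V(1)) (auto simp: sets)
  also have "\<dots> \<le> liminf (\<lambda>n. emeasure (M\<^sub>n n) U)"
  proof (rule SUP_least)
    fix k
    have "emeasure M (V k) \<le> liminf (\<lambda>n. emeasure (M\<^sub>n n) (V k))"
      using V(3)[of k] le by auto
    also have "\<dots> \<le> liminf (\<lambda>n. emeasure (M\<^sub>n n) U)"
      using V(2) U by (intro Liminf_mono always_eventually allI emeasure_mono) (auto simp: sets)
    finally show "emeasure M (V k) \<le> liminf (\<lambda>n. emeasure (M\<^sub>n n) U)" .
  qed
  finally show "emeasure M U \<le> liminf (\<lambda>n. emeasure (M\<^sub>n n) U)" .
qed

lemma lower_semicontinuous_borel_measurable:
  assumes "lower_semicontinuous f"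
  shows "f \<in> borel_measurable borel"
  using assms unfolding lower_semicontinuous_def
  by (intro borel_measurableI_greater) auto

text \<open>Both sides are the mass of the region below the graph of \<open>f\<close>, by Fubini's theorem.\<close>

lemma nn_integral_layer_cake:
  assumes "sigma_finite_measure M" and f[measurable]: "f \<in> borel_measurable M"
  shows "(\<integral>\<^sup>+x. f x \<partial>M) =
    (\<integral>\<^sup>+t. indicator {0..} t * emeasure M {x\<in>space M. ennreal t < f x} \<partial>lborel)"
proof -
  interpret sigma_finite_measure M by fact
  interpret pair_sigma_finite M lborel ..
  have len: "(\<integral>\<^sup>+t. indicator {0..} t * indicator {t. ennreal t < r} t \<partial>lborel) = r" for r
  proof -
    have "(\<integral>\<^sup>+t. indicator {0..} t * indicator {t. ennreal t < r} t \<partial>lborel)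
        = emeasure lborel {t. 0 \<le> t \<and> ennreal t < r}"
    proof -
      have "(\<integral>\<^sup>+t. indicator {0..} t * indicator {t. ennreal t < r} t \<partial>lborel)
          = (\<integral>\<^sup>+t. indicator {t. 0 \<le> t \<and> ennreal t < r} t \<partial>lborel)"
        by (intro nn_integral_cong) (auto split: split_indicator)
      then show ?thesis by simp
    qed
    also have "\<dots> = r"
    proof (cases r)
      case (real q)
      then have "{t. 0 \<le> t \<and> ennreal t < r} = {0..<q}" by (auto simp: ennreal_less_iff)
      then show ?thesis using real by simp
    next
      case top
      then have "{t. 0 \<le> t \<and> ennreal t < r} = {0..}" by (auto simp: ennreal_less_top)
      moreover have "emeasure lborel {0::real..} = \<infinity>"
      proof -
        have "of_nat n \<le> emeasure lborel {0::real..}" for n :: nat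
          using emeasure_mono[of "{0..real n}" "{0..}" lborel] by (simp add: ennreal_of_nat_eq_real_of_nat)
        then have "(SUP n. of_nat n :: ennreal) \<le> emeasure lborel {0::real..}" by (intro SUP_least)
        then show ?thesis by (simp add: ennreal_SUP_of_nat_eq_top top_unique)
      qed
      ultimately show ?thesis using top by simp
    qed
    finally show ?thesis .
  qed
  have "(\<integral>\<^sup>+x. f x \<partial>M) = (\<integral>\<^sup>+x. \<integral>\<^sup>+t. indicator {0..} t * indicator {t. ennreal t < f x} t \<partial>lborel \<partial>M)"
    by (simp add: len)
  also have "\<dots> = (\<integral>\<^sup>+t. \<integral>\<^sup>+x. indicator {0..} t * indicator {t. ennreal t < f x} t \<partial>M \<partial>lborel)"
    by (intro Fubini'[symmetric]) simp
  also have "\<dots> = (\<integral>\<^sup>+t. indicator {0..} t * emeasure M {x\<in>space M. ennreal t < f x} \<partial>lborel)"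
  proof (intro nn_integral_cong)
    fix t :: real
    have "(\<integral>\<^sup>+x. indicator {0..} t * indicator {t. ennreal t < f x} t \<partial>M)
      = (\<integral>\<^sup>+x. indicator {0..} t * indicator {x\<in>space M. ennreal t < f x} x \<partial>M)"
      by (intro nn_integral_cong) (auto split: split_indicator)
    then show "(\<integral>\<^sup>+x. indicator {0..} t * indicator {t. ennreal t < f x} t \<partial>M)
      = indicator {0..} t * emeasure M {x\<in>space M. ennreal t < f x}"
      by (simp add: nn_integral_cmult)
  qed
  finally show ?thesis .
qed

text \<open>The sets \<open>{t < f}\<close> are open, so the inequality holds for each layer of \<open>f\<close>; Fatou's lemma puts
the layers together.\<close>

lemma nn_integral_le_liminf_lsc:
  fixes M :: "'a::topological_space measure"
  assumes M: "prob_space M" "sets M = sets borel"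
    and Mn: "\<And>n. prob_space (M\<^sub>n n)" "\<And>n. sets (M\<^sub>n n) = sets borel"
    and le: "liminf_on_opens M\<^sub>n M" and f: "lower_semicontinuous f"
  shows "(\<integral>\<^sup>+x. f x \<partial>M) \<le> liminf (\<lambda>n. \<integral>\<^sup>+x. f x \<partial>M\<^sub>n n)"
proof -
  note fm = lower_semicontinuous_borel_measurable[OF f]
  have lc: "(\<integral>\<^sup>+x. f x \<partial>N) = (\<integral>\<^sup>+t. indicator {0..} t * emeasure N {x. ennreal t < f x} \<partial>lborel)"
    if "prob_space N" "sets N = sets borel" for N
  proof -
    interpret prob_space N by fact
    have "space N = UNIV" using sets_eq_imp_space_eq[OF that(2)] by simp
    then show ?thesis
      using nn_integral_layer_cake[of N f] fm that(2) sigma_finite_measure_axioms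
      by (simp add: measurable_cong_sets[OF that(2) refl])
  qed
  have meas: "(\<lambda>t::real. emeasure N {x. ennreal t < f x}) \<in> borel_measurable borel"
    if "prob_space N" "sets N = sets borel" for N
  proof -
    interpret prob_space N by fact
    have sp: "space N = UNIV" using sets_eq_imp_space_eq[OF that(2)] by simp
    note [measurable] = fm and [measurable_cong] = that(2)
    have "(\<lambda>t::real. emeasure N (Pair t -` {p \<in> space (borel \<Otimes>\<^sub>M N). ennreal (fst p) < f (snd p)}))
        \<in> borel_measurable borel"
      by (intro measurable_emeasure_Pair) measurable
    then show ?thesis by (simp add: space_pair_measure sp vimage_def)
  qed
  have "(\<integral>\<^sup>+x. f x \<partial>M) = (\<integral>\<^sup>+t. indicator {0..} t * emeasure M {x. ennreal t < f x} \<partial>lborel)"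
    by (rule lc[OF M])
  also have "\<dots> \<le> (\<integral>\<^sup>+t. liminf (\<lambda>n. indicator {0..} t * emeasure (M\<^sub>n n) {x. ennreal t < f x}) \<partial>lborel)"
    using le f unfolding liminf_on_opens_def lower_semicontinuous_def
    by (intro nn_integral_mono) (auto split: split_indicator)
  also have "\<dots> \<le> liminf (\<lambda>n. \<integral>\<^sup>+t. indicator {0..} t * emeasure (M\<^sub>n n) {x. ennreal t < f x} \<partial>lborel)"
    using meas[OF Mn] by (intro nn_integral_liminf) measurable
  also have "\<dots> = liminf (\<lambda>n. \<integral>\<^sup>+x. f x \<partial>M\<^sub>n n)"
    by (simp add: lc[OF Mn])
  finally show ?thesis .
qed

lemma lower_semicontinuous_continuous:
  fixes g :: "'a::topological_space \<Rightarrow> real"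
  assumes "continuous_on UNIV g"
  shows "lower_semicontinuous (\<lambda>x. ennreal (g x))"
  unfolding lower_semicontinuous_def
proof
  fix a
  have "{x. a < ennreal (g x)} = (\<lambda>x. ennreal (g x)) -` {a<..}" by auto
  moreover have "continuous_on UNIV (\<lambda>x. ennreal (g x))"
    by (intro continuous_on_ennreal assms)
  ultimately show "open {x. a < ennreal (g x)}"
    using continuous_on_open_vimage[of UNIV "\<lambda>x. ennreal (g x)"] by auto
qed

lemma integrable_bounded_continuous:
  fixes g :: "'a::topological_space \<Rightarrow> real"
  assumes "prob_space M" "sets M = sets borel" "continuous_on UNIV g" "\<And>x. \<bar>g x\<bar> \<le> C"
  shows "integrable M g"
proof -
  interpret prob_space M by fact
  have "g \<in> borel_measurable M"
    using borel_measurable_continuous_onI[OF assms(3)] by (simp add: measurable_cong_sets[OF assms(2) refl])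
  then show ?thesis using assms(4) by (intro integrable_const_bound[of _ C]) auto
qed

text \<open>If \<open>\<bar>g\<bar> \<le> C\<close>, then \<open>C + g\<close> and \<open>C - g\<close> are both nonnegative and lower semicontinuous.\<close>

lemma tendsto_integral_bounded_continuous:
  fixes M :: "'a::topological_space measure"
  assumes M: "prob_space M" "sets M = sets borel"
    and Mn: "\<And>n. prob_space (M\<^sub>n n)" "\<And>n. sets (M\<^sub>n n) = sets borel"
    and le: "liminf_on_opens M\<^sub>n M" and g: "continuous_on UNIV g" "bounded (range g)"
  shows "(\<lambda>n. \<integral>x. g x \<partial>M\<^sub>n n) \<longlonglongrightarrow> (\<integral>x. g x \<partial>M :: real)"
proof -
  obtain C where C: "\<And>x. \<bar>g x\<bar> \<le> C" using g(2) by (auto simp: bounded_iff)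
  have main: "\<forall>\<^sub>F n in sequentially. a < (\<integral>x. h x \<partial>M\<^sub>n n)"
    if h: "continuous_on UNIV h" "\<And>x. \<bar>h x\<bar> \<le> C" and a: "a < (\<integral>x. h x \<partial>M)" for h :: "'a \<Rightarrow> real" and a
  proof -
    have eq: "(\<integral>\<^sup>+x. ennreal (C + h x) \<partial>N) = ennreal (C + (\<integral>x. h x \<partial>N))"
      and pos: "0 \<le> C + (\<integral>x. h x \<partial>N)"
      if "prob_space N" "sets N = sets borel" for N
    proof -
      interpret prob_space N by fact
      note i = integrable_bounded_continuous[OF that h]
      have nn: "0 \<le> C + h x" for x using h(2)[of x] by linarith
      have e: "C + (\<integral>x. h x \<partial>N) = (\<integral>x. C + h x \<partial>N)" using i by (simp add: prob_space)
      show "(\<integral>\<^sup>+x. ennreal (C + h x) \<partial>N) = ennreal (C + (\<integral>x. h x \<partial>N))"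
        unfolding e using nn i by (intro nn_integral_eq_integral) auto
      show "0 \<le> C + (\<integral>x. h x \<partial>N)" unfolding e using nn by (intro integral_nonneg_AE) auto
    qed
    have "(\<integral>\<^sup>+x. ennreal (C + h x) \<partial>M) \<le> liminf (\<lambda>n. \<integral>\<^sup>+x. ennreal (C + h x) \<partial>M\<^sub>n n)"
      by (intro nn_integral_le_liminf_lsc M Mn le lower_semicontinuous_continuous continuous_intros h)
    then have *: "ennreal (C + (\<integral>x. h x \<partial>M)) \<le> liminf (\<lambda>n. ennreal (C + (\<integral>x. h x \<partial>M\<^sub>n n)))"
      using eq[OF M] eq[OF Mn] by simp
    show ?thesis
    proof (cases "C + a < 0")
      case True
      then have "a < (\<integral>x. h x \<partial>M\<^sub>n n)" for n using pos[OF Mn, of n] by linarith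
      then show ?thesis by simp
    next
      case False
      then have "ennreal (C + a) < ennreal (C + (\<integral>x. h x \<partial>M))"
        using a by (simp add: ennreal_less_iff)
      then have "ennreal (C + a) < liminf (\<lambda>n. ennreal (C + (\<integral>x. h x \<partial>M\<^sub>n n)))"
        using * by (rule less_le_trans)
      then have "\<forall>\<^sub>F n in sequentially. ennreal (C + a) < ennreal (C + (\<integral>x. h x \<partial>M\<^sub>n n))"
        by (rule less_LiminfD)
      then show ?thesis
        using False by (simp add: ennreal_less_iff)
    qed
  qed
  show ?thesis
  proof (rule order_tendstoI)
    fix a assume "a < (\<integral>x. g x \<partial>M)"
    then show "\<forall>\<^sub>F n in sequentially. a < (\<integral>x. g x \<partial>M\<^sub>n n)" using main[OF g(1) C] by simp
  next
    fix a assume "(\<integral>x. g x \<partial>M) < a"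
    then show "\<forall>\<^sub>F n in sequentially. (\<integral>x. g x \<partial>M\<^sub>n n) < a"
      using main[of "\<lambda>x. - g x" "-a"] C g(1) by (simp add: continuous_on_minus)
  qed
qed

lemma open_indicator_sup_continuous:
  fixes U :: "'a::metric_space set"
  assumes "open U"
  obtains g :: "nat \<Rightarrow> 'a \<Rightarrow> real" where "\<And>k. continuous_on UNIV (g k)" "\<And>k x. 0 \<le> g k x" "\<And>k x. g k x \<le> 1"
    "\<And>x. incseq (\<lambda>k. g k x)" "\<And>x. (\<lambda>k. g k x) \<longlonglongrightarrow> indicator U x"
proof (cases "U = UNIV")
  \<comment> \<open>The distance to the empty set is \<open>0\<close> by convention, so the whole space is treated apart.\<close>
  case True
  then show ?thesis by (intro that[of "\<lambda>_ _. 1"]) (auto simp: incseq_def)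
next
  case False
  define g where "g k x = min 1 (real k * infdist x (-U))" for k x
  show ?thesis
  proof (rule that[of g])
    show "continuous_on UNIV (g k)" for k
      unfolding g_def by (intro continuous_intros)
    show "0 \<le> g k x" "g k x \<le> 1" for k x by (auto simp: g_def infdist_nonneg)
    show "incseq (\<lambda>k. g k x)" for x
      unfolding g_def by (intro monoI min.mono mult_right_mono) (auto simp: infdist_nonneg)
    show "(\<lambda>k. g k x) \<longlonglongrightarrow> indicator U x" for x
    proof (cases "x \<in> U")
      case False
      then show ?thesis by (simp add: g_def)
    next
      case True
      have "infdist x (-U) \<noteq> 0"
        using in_closed_iff_infdist_zero[of "-U" x] assms False True by auto
      then have pos: "0 < infdist x (-U)" using infdist_nonneg[of x "-U"] by linarith
      obtain K where K: "1 \<le> real K * infdist x (-U)"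
        using reals_Archimedean3[OF pos] by (meson less_imp_le)
      have "\<forall>\<^sub>F k in sequentially. g k x = 1"
        using eventually_ge_at_top[of K]
      proof eventually_elim
        case (elim k)
        then have "real K * infdist x (-U) \<le> real k * infdist x (-U)"
          using pos by (intro mult_right_mono) auto
        then show ?case using K by (simp add: g_def)
      qed
      then show ?thesis using True by (simp add: tendsto_eventually)
    qed
  qed
qed

lemma emeasure_open_eq_SUP_integral:
  assumes "prob_space M" "sets M = sets borel" "open U"
    and g: "\<And>k. continuous_on UNIV (g k)" "\<And>k x. 0 \<le> g k x" "\<And>k x. g k x \<le> (1::real)"
      "\<And>x. incseq (\<lambda>k. g k x)" "\<And>x. (\<lambda>k. g k x) \<longlonglongrightarrow> indicator U x"
  shows "emeasure M U = (SUP k::nat. ennreal (\<integral>x. g k x \<partial>M))"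
proof -
  interpret prob_space M by fact
  have m: "g k \<in> borel_measurable M" for k
    using borel_measurable_continuous_onI[OF g(1)] by (simp add: measurable_cong_sets[OF assms(2) refl])
  have "(SUP k. ennreal (g k x)) = indicator U x" for x
  proof (rule LIMSEQ_unique[OF LIMSEQ_SUP])
    show "incseq (\<lambda>k. ennreal (g k x))" using g(4)[of x] by (auto simp: incseq_def intro: ennreal_leI)
    show "(\<lambda>k. ennreal (g k x)) \<longlonglongrightarrow> indicator U x"
      using tendsto_ennrealI[OF g(5)[of x]] by (simp add: ennreal_indicator)
  qed
  then have "emeasure M U = (\<integral>\<^sup>+x. (SUP k. ennreal (g k x)) \<partial>M)"
    using assms by simp
  also have "\<dots> = (SUP k. \<integral>\<^sup>+x. ennreal (g k x) \<partial>M)"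
    using m g(4) by (intro nn_integral_monotone_convergence_SUP)
      (auto simp: incseq_def le_fun_def intro!: ennreal_leI)
  also have "\<dots> = (SUP k. ennreal (\<integral>x. g k x \<partial>M))"
    using m g(2,3) by (intro SUP_cong refl nn_integral_eq_integral integrable_const_bound[of _ 1]) auto
  finally show ?thesis .
qed

text \<open>The mass of an open set is a supremum of integrals of continuous functions with values in \<open>[0,1]\<close>,
and each of these integrals converges.\<close>

lemma liminf_on_opens_from_continuous:
  fixes M :: "'a::metric_space measure"
  assumes M: "prob_space M" "sets M = sets borel"
    and Mn: "\<And>n. prob_space (M\<^sub>n n)" "\<And>n. sets (M\<^sub>n n) = sets borel"
    and lim: "\<And>g::'a \<Rightarrow> real. continuous_on UNIV g \<Longrightarrow> (\<And>x. 0 \<le> g x) \<Longrightarrow> (\<And>x. g x \<le> 1) \<Longrightarrow>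
       (\<lambda>n. \<integral>x. g x \<partial>M\<^sub>n n) \<longlonglongrightarrow> (\<integral>x. g x \<partial>M)"
  shows "liminf_on_opens M\<^sub>n M"
  unfolding liminf_on_opens_def
proof safe
  fix U :: "'a set" assume U: "open U"
  obtain g :: "nat \<Rightarrow> 'a \<Rightarrow> real" where g: "\<And>k. continuous_on UNIV (g k)" "\<And>k x. 0 \<le> g k x" "\<And>k x. g k x \<le> 1"
    "\<And>x. incseq (\<lambda>k. g k x)" "\<And>x. (\<lambda>k. g k x) \<longlonglongrightarrow> indicator U x"
    using open_indicator_sup_continuous[OF U] by blast
  have "ennreal (\<integral>x. g k x \<partial>M) \<le> liminf (\<lambda>n. emeasure (M\<^sub>n n) U)" for k
  proof -
    have "(\<lambda>n. ennreal (\<integral>x. g k x \<partial>M\<^sub>n n)) \<longlonglongrightarrow> ennreal (\<integral>x. g k x \<partial>M)"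
      by (intro tendsto_ennrealI lim g)
    then have "ennreal (\<integral>x. g k x \<partial>M) = liminf (\<lambda>n. ennreal (\<integral>x. g k x \<partial>M\<^sub>n n))"
      by (simp add: lim_imp_Liminf)
    also have "\<dots> \<le> liminf (\<lambda>n. emeasure (M\<^sub>n n) U)"
      by (intro Liminf_mono always_eventually allI)
        (subst emeasure_open_eq_SUP_integral[OF Mn U g], auto intro: SUP_upper)
    finally show ?thesis .
  qed
  then show "emeasure M U \<le> liminf (\<lambda>n. emeasure (M\<^sub>n n) U)"
    by (subst emeasure_open_eq_SUP_integral[OF M U g]) (auto intro: SUP_least)
qed

text \<open>The inequality says that the constant sequence \<open>M'\<close> converges narrowly to \<open>M\<close>, so that both measures
give the same integrals to bounded continuous functions.\<close>

lemma prob_measure_eqI_open_le: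
  fixes M M' :: "'a::metric_space measure"
  assumes M: "prob_space M" "sets M = sets borel" and M': "prob_space M'" "sets M' = sets borel"
    and le: "\<And>U. open U \<Longrightarrow> emeasure M U \<le> emeasure M' U"
  shows "M = M'"
proof (rule measure_eqI_generator_eq[where E="{U. open U}" and \<Omega>=UNIV and A="\<lambda>_. UNIV"])
  interpret M: prob_space M by fact
  have lo: "liminf_on_opens (\<lambda>_. M') M"
    using le by (simp add: liminf_on_opens_def Liminf_const)
  have eq: "(\<integral>x. g x \<partial>M') = (\<integral>x. g x \<partial>M)" if "continuous_on UNIV g" "bounded (range g)" for g :: "'a \<Rightarrow> real"
    using tendsto_integral_bounded_continuous[OF M M' lo that] by (simp add: LIMSEQ_const_iff)
  fix U :: "'a set" assume "U \<in> {U. open U}"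
  then have U: "open U" by simp
  obtain g :: "nat \<Rightarrow> 'a \<Rightarrow> real" where g: "\<And>k. continuous_on UNIV (g k)" "\<And>k x. 0 \<le> g k x" "\<And>k x. g k x \<le> 1"
    "\<And>x. incseq (\<lambda>k. g k x)" "\<And>x. (\<lambda>k. g k x) \<longlonglongrightarrow> indicator U x"
    using open_indicator_sup_continuous[OF U] by blast
  have "bounded (range (g k))" for k using g(2,3) by (auto intro!: boundedI[of _ 1])
  then show "emeasure M U = emeasure M' U"
    unfolding emeasure_open_eq_SUP_integral[OF M U g] emeasure_open_eq_SUP_integral[OF M' U g]
    using eq g(1) by simp
next
  have "emeasure M UNIV \<le> 1" using prob_space.emeasure_le_1[OF M(1)] .
  then show "emeasure M UNIV \<noteq> \<infinity>" by (auto simp: top_unique)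
qed (auto simp: Int_stable_def sets_borel M M')

text \<open>Finite unions \<open>W\<close> of open rectangles form a sufficient family. The mass of \<open>W\<close> under \<open>M\<^sub>n \<otimes> M\<^sub>n\<close> is the
\<open>M\<^sub>n\<close>-integral of the masses \<open>M\<^sub>n (W\<^sub>y)\<close> of the sections, a function that varies with \<open>n\<close>. It is bounded below by
\<open>\<Psi> K y\<close>, the infimum of these masses over \<open>n \<ge> K\<close>. The sections of \<open>W\<close> can only grow near \<open>y\<close>, so \<open>\<Psi> K\<close> is
lower semicontinuous and its integrals pass to the limit; finally \<open>K\<close> tends to infinity.\<close>

lemma liminf_on_opens_pair:
  fixes M :: "'a::second_countable_topology measure"
  assumes M: "prob_space M" "sets M = sets borel"
    and Mn: "\<And>n. prob_space (M\<^sub>n n)" "\<And>n. sets (M\<^sub>n n) = sets borel"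
    and le: "liminf_on_opens M\<^sub>n M"
  shows "liminf_on_opens (\<lambda>n. M\<^sub>n n \<Otimes>\<^sub>M M\<^sub>n n) (M \<Otimes>\<^sub>M M)"
proof -
  obtain B :: "'a set set" where B: "countable B" "topological_basis B"
    using ex_countable_basis by blast
  define R where "R = (\<lambda>(a, b). a \<times> b) ` (B \<times> B)"
  have R: "topological_basis R" "countable R"
    unfolding R_def using B by (auto intro: topological_basis_prod)
  have sb: "sets (N \<Otimes>\<^sub>M N) = sets borel" if "sets N = sets borel" for N :: "'a measure"
    using sets_pair_measure_cong[OF that that] unfolding borel_prod .
  show ?thesis
  proof (rule liminf_on_opens_from_basis[OF R])
    fix F assume F: "finite F" "F \<subseteq> R"
    define W where "W = \<Union>F"
    have oF: "\<exists>a b. r = a \<times> b \<and> open a \<and> open b" if "r \<in> F" for r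
    proof -
      have "r \<in> R" using that F by auto
      then obtain a b where "r = a \<times> b" "a \<in> B" "b \<in> B" by (auto simp: R_def)
      then show ?thesis using topological_basis_open[OF B(2)] by blast
    qed
    have W: "open W" unfolding W_def using F R(1) by (intro open_Union) (auto intro: topological_basis_open)
    have oWy: "open (Pair y -` W)" for y using W by (intro open_vimage continuous_intros)
    have em: "emeasure (N \<Otimes>\<^sub>M N) W = (\<integral>\<^sup>+y. emeasure N (Pair y -` W) \<partial>N)"
      if N: "prob_space N" "sets N = sets borel" for N
    proof -
      interpret prob_space N by fact
      show ?thesis by (intro emeasure_pair_measure_alt) (auto simp: sb[OF N(2)] W)
    qed
    have mm: "(\<lambda>y. emeasure N (Pair y -` W)) \<in> borel_measurable borel"
      if N: "prob_space N" "sets N = sets borel" for N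
    proof -
      interpret prob_space N by fact
      have "(\<lambda>y. emeasure N (Pair y -` W)) \<in> borel_measurable N"
        by (intro measurable_emeasure_Pair) (auto simp: sb[OF N(2)] W)
      then show ?thesis by (simp add: measurable_cong_sets[OF N(2) refl])
    qed
    define \<Psi> where "\<Psi> K y = (INF n\<in>{K..}. emeasure (M\<^sub>n n) (Pair y -` W))" for K y
    have lsc: "lower_semicontinuous (\<Psi> K)" for K
      unfolding lower_semicontinuous_def
    proof safe
      fix a show "open {y. a < \<Psi> K y}"
      proof (subst open_subopen, safe)
        fix y assume y: "a < \<Psi> K y"
        \<comment> \<open>Near \<open>y\<close>, every rectangle of \<open>F\<close> that meets the fibre over \<open>y\<close> keeps its section.\<close>
        have "\<forall>r\<in>F. \<exists>a. open a \<and> y \<in> a \<and> (y \<in> fst ` r \<longrightarrow> (\<forall>z\<in>a. Pair y -` r \<subseteq> Pair z -` r))"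
        proof
          fix r assume "r \<in> F"
          then obtain a b where r: "r = a \<times> b" "open a" "open b" using oF by blast
          show "\<exists>a. open a \<and> y \<in> a \<and> (y \<in> fst ` r \<longrightarrow> (\<forall>z\<in>a. Pair y -` r \<subseteq> Pair z -` r))"
          proof (cases "y \<in> fst ` r")
            case True
            then show ?thesis using r by (intro exI[of _ a]) (auto split: if_splits)
          next
            case False
            then show ?thesis by (intro exI[of _ UNIV]) auto
          qed
        qed
        then obtain A where A: "\<And>r. r \<in> F \<Longrightarrow> open (A r) \<and> y \<in> A r \<and>
            (y \<in> fst ` r \<longrightarrow> (\<forall>z\<in>A r. Pair y -` r \<subseteq> Pair z -` r))"
          by metis
        have sub: "Pair y -` W \<subseteq> Pair z -` W" if "z \<in> (\<Inter>r\<in>F. A r)" for z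
        proof
          fix w assume "w \<in> Pair y -` W"
          then obtain r where r: "r \<in> F" "(y, w) \<in> r" by (auto simp: W_def)
          then have "y \<in> fst ` r" by force
          then have "(z, w) \<in> r" using A[OF r(1)] that r by blast
          then show "w \<in> Pair z -` W" using r by (auto simp: W_def)
        qed
        have "\<Psi> K y \<le> \<Psi> K z" if "z \<in> (\<Inter>r\<in>F. A r)" for z
          unfolding \<Psi>_def
        proof (rule INF_mono)
          fix m assume "m \<in> {K..}"
          then show "\<exists>n\<in>{K..}. emeasure (M\<^sub>n n) (Pair y -` W) \<le> emeasure (M\<^sub>n m) (Pair z -` W)"
            using sub[OF that] oWy[of z] by (intro bexI[of _ m] emeasure_mono) (auto simp: Mn)
        qed
        then have "(\<Inter>r\<in>F. A r) \<subseteq> {y. a < \<Psi> K y}" using y less_le_trans by blast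
        moreover have "open (\<Inter>r\<in>F. A r)" using A F(1) by (intro open_INT) auto
        moreover have "y \<in> (\<Inter>r\<in>F. A r)" using A by auto
        ultimately show "\<exists>T. open T \<and> y \<in> T \<and> T \<subseteq> {y. a < \<Psi> K y}" by blast
      qed
    qed
    have \<Psi>m: "\<Psi> K \<in> borel_measurable borel" for K
      by (rule lower_semicontinuous_borel_measurable[OF lsc])
    have "emeasure (M \<Otimes>\<^sub>M M) W = (\<integral>\<^sup>+y. emeasure M (Pair y -` W) \<partial>M)" by (rule em[OF M])
    also have "\<dots> \<le> (\<integral>\<^sup>+y. (SUP K. \<Psi> K y) \<partial>M)"
    proof (intro nn_integral_mono)
      fix y
      have "emeasure M (Pair y -` W) \<le> liminf (\<lambda>n. emeasure (M\<^sub>n n) (Pair y -` W))"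
        using le oWy unfolding liminf_on_opens_def by blast
      then show "emeasure M (Pair y -` W) \<le> (SUP K. \<Psi> K y)"
        by (simp add: liminf_SUP_INF \<Psi>_def)
    qed
    also have "\<dots> = (SUP K. \<integral>\<^sup>+y. \<Psi> K y \<partial>M)"
    proof (rule nn_integral_monotone_convergence_SUP)
      show "incseq \<Psi>" unfolding \<Psi>_def by (intro monoI le_funI INF_superset_mono) auto
      show "\<Psi> K \<in> borel_measurable M" for K using \<Psi>m by (simp add: measurable_cong_sets[OF M(2) refl])
    qed
    also have "\<dots> \<le> liminf (\<lambda>n. emeasure (M\<^sub>n n \<Otimes>\<^sub>M M\<^sub>n n) W)"
    proof (rule SUP_least)
      fix K
      have "(\<integral>\<^sup>+y. \<Psi> K y \<partial>M) \<le> liminf (\<lambda>n. \<integral>\<^sup>+y. \<Psi> K y \<partial>M\<^sub>n n)"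
        by (intro nn_integral_le_liminf_lsc M Mn le lsc)
      also have "\<dots> \<le> liminf (\<lambda>n. emeasure (M\<^sub>n n \<Otimes>\<^sub>M M\<^sub>n n) W)"
      proof (intro Liminf_mono, rule eventually_sequentiallyI[of K])
        fix n assume "K \<le> n"
        then show "(\<integral>\<^sup>+y. \<Psi> K y \<partial>M\<^sub>n n) \<le> emeasure (M\<^sub>n n \<Otimes>\<^sub>M M\<^sub>n n) W"
          unfolding em[OF Mn] \<Psi>_def by (intro nn_integral_mono INF_lower) auto
      qed
      finally show "(\<integral>\<^sup>+y. \<Psi> K y \<partial>M) \<le> liminf (\<lambda>n. emeasure (M\<^sub>n n \<Otimes>\<^sub>M M\<^sub>n n) W)" .
    qed
    finally show "emeasure (M \<Otimes>\<^sub>M M) (\<Union>F) \<le> liminf (\<lambda>n. emeasure (M\<^sub>n n \<Otimes>\<^sub>M M\<^sub>n n) (\<Union>F))"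
      by (simp add: W_def)
  qed (simp_all add: sb M Mn)
qed

section \<open>Random measures and their narrow topology\<close>

lemma topspace_initial_topology [simp]: "topspace (initial_topology S F) = S"
  unfolding initial_topology_def topology_generated_by_topspace by auto

lemma limitin_initial_topology:
  assumes s: "\<And>n. s n \<in> S"
  shows "limitin (initial_topology S F) s z sequentially \<longleftrightarrow>
    z \<in> S \<and> (\<forall>\<phi>\<in>F. (\<lambda>n. \<phi> (s n)) \<longlonglongrightarrow> \<phi> z)"
proof safe
  assume lim: "limitin (initial_topology S F) s z sequentially"
  then show z: "z \<in> S" by (auto simp: limitin_def)
  fix \<phi> assume "\<phi> \<in> F"
  show "(\<lambda>n. \<phi> (s n)) \<longlonglongrightarrow> \<phi> z"
  proof (rule topological_tendstoI)
    fix U :: "real set" assume U: "open U" "\<phi> z \<in> U"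
    have "openin (initial_topology S F) {s\<in>S. \<phi> s \<in> U}"
      unfolding initial_topology_def using \<open>\<phi> \<in> F\<close> U(1) by (intro topology_generated_by_Basis) blast
    then have "\<forall>\<^sub>F n in sequentially. s n \<in> {s\<in>S. \<phi> s \<in> U}"
      using lim z U(2) unfolding limitin_def by blast
    then show "\<forall>\<^sub>F n in sequentially. \<phi> (s n) \<in> U" by eventually_elim simp
  qed
next
  assume z: "z \<in> S" and lim: "\<forall>\<phi>\<in>F. (\<lambda>n. \<phi> (s n)) \<longlonglongrightarrow> \<phi> z"
  have "generate_topology_on (insert S {{s \<in> S. \<phi> s \<in> U} | \<phi> U. \<phi> \<in> F \<and> open U}) W \<Longrightarrow> z \<in> W \<Longrightarrow>
    \<forall>\<^sub>F n in sequentially. s n \<in> W" for W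
  proof (induction rule: generate_topology_on.induct)
    case (Basis W)
    then consider "W = S" | \<phi> U where "W = {s\<in>S. \<phi> s \<in> U}" "\<phi> \<in> F" "open U" by auto
    then show ?case
    proof cases
      case 1 then show ?thesis using s by simp
    next
      case 2
      then have "\<forall>\<^sub>F n in sequentially. \<phi> (s n) \<in> U"
        using lim Basis(2) by (auto dest: topological_tendstoD)
      then show ?thesis using 2 s by simp
    qed
  next
    case (Int a b)
    then show ?case by (simp add: eventually_conj_iff)
  next
    case (UN K)
    then obtain k where "k \<in> K" "z \<in> k" by auto
    with UN have "\<forall>\<^sub>F n in sequentially. s n \<in> k" by auto
    then show ?case by eventually_elim (use \<open>k \<in> K\<close> in auto)
  qed simp
  then show "limitin (initial_topology S F) s z sequentially"
    unfolding limitin_def topspace_initial_topology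
    using z by (simp add: initial_topology_def openin_topology_generated_by_iff)
qed

lemma space_borel_of: "space (borel_of T) = topspace T"
  unfolding borel_of_def by (simp add: space_measure_of_conv)

lemma sets_borel_of_openin: "openin T U \<Longrightarrow> U \<in> sets (borel_of T)"
  unfolding borel_of_def using openin_subset by (subst sets_measure_of) (auto intro: sigma_sets.Basic)

lemma borel_measurable_initial_topology:
  assumes "\<phi> \<in> F"
  shows "\<phi> \<in> borel_measurable (borel_of (initial_topology S F))"
proof (rule borel_measurableI)
  fix U :: "real set" assume "open U"
  then have "openin (initial_topology S F) {s\<in>S. \<phi> s \<in> U}"
    unfolding initial_topology_def using assms by (intro topology_generated_by_Basis) blast
  moreover have "\<phi> -` U \<inter> S = {s\<in>S. \<phi> s \<in> U}" by auto
  ultimately show "\<phi> -` U \<inter> space (borel_of (initial_topology S F)) \<in> sets (borel_of (initial_topology S F))"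
    by (simp add: space_borel_of sets_borel_of_openin)
qed

lemma borel_probs_eq: "borel_probs = space (prob_algebra borel)"
  by (auto simp: borel_probs_def space_prob_algebra)

text \<open>The narrow topology has a countable base, namely the finite intersections of the sets
\<open>{\<nu>. q < \<nu> V}\<close> with \<open>q\<close> rational and \<open>V\<close> a finite union of basic open sets. If no such intersection
fitted between some \<open>\<nu>\<close> and the open set \<open>W\<close>, there would be measures \<open>\<nu>' n\<close> outside \<open>W\<close> that lie in
the first \<open>n\<close> of the countably many sets of this kind containing \<open>\<nu>\<close>. The sequence \<open>\<nu>'\<close> would
converge narrowly to \<open>\<nu>\<close>, and so enter \<open>W\<close>.\<close>

lemma openin_narrow_topology_measurable:
  fixes W :: "'z::{metric_space, second_countable_topology} measure set"
  assumes W: "openin narrow_topology W"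
  shows "W \<in> sets (prob_algebra borel)"
proof -
  obtain B :: "'z set set" where B: "countable B" "topological_basis B"
    using ex_countable_basis by blast
  define \<V> where "\<V> = Union ` {F. finite F \<and> F \<subseteq> B}"
  define S where "S = (\<lambda>(V, q). {\<nu> \<in> borel_probs. of_rat q < measure \<nu> V}) ` (\<V> \<times> UNIV)"
  define \<B> where "\<B> = (\<lambda>F. {\<nu>\<in>borel_probs. \<forall>s\<in>F. \<nu> \<in> s}) ` {F. finite F \<and> F \<subseteq> S}"
  have "countable \<V>" unfolding \<V>_def by (intro countable_image countable_Collect_finite_subset B)
  then have S: "countable S" unfolding S_def by auto
  then have \<B>: "countable \<B>" unfolding \<B>_def by (intro countable_image countable_Collect_finite_subset)
  have Vm: "V \<in> sets borel" if "V \<in> \<V>" for V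
    using that topological_basis_open[OF B(2)] by (auto simp: \<V>_def intro!: borel_open open_Union)
  have Sm: "s \<in> sets (prob_algebra borel)" if "s \<in> S" for s
  proof -
    obtain V q where s: "s = {\<nu> \<in> space (prob_algebra borel). of_rat q < measure \<nu> V}" "V \<in> \<V>"
      using \<open>s \<in> S\<close> by (auto simp: S_def borel_probs_eq)
    have [measurable]: "V \<in> sets borel" using Vm s by auto
    show ?thesis unfolding s by measurable
  qed
  have \<B>m: "b \<in> sets (prob_algebra borel)" if b: "b \<in> \<B>" for b
  proof -
    obtain F where F: "finite F" "F \<subseteq> S" "b = {\<nu> \<in> space (prob_algebra borel). \<forall>s\<in>F. \<nu> \<in> s}"
      using b by (auto simp: \<B>_def borel_probs_eq)
    show ?thesis unfolding F(3) using F(1,2) Sm by (intro sets.sets_Collect_finite_All) (auto simp: sets.Int_space_eq1[symmetric] Int_def[symmetric] simp del: sets.Int_space_eq1)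
  qed
  have nbh: "\<exists>b\<in>\<B>. \<nu> \<in> b \<and> b \<subseteq> W" if \<nu>: "\<nu> \<in> W" for \<nu>
  proof (rule ccontr)
    assume contr: "\<not> ?thesis"
    have \<nu>p: "\<nu> \<in> borel_probs"
      using openin_subset[OF W] \<nu> by (auto simp: narrow_topology_def)
    then interpret \<nu>: prob_space \<nu> by (simp add: borel_probs_def)
    \<comment> \<open>Inserting \<open>borel_probs\<close> makes the family nonempty, so that it can be enumerated.\<close>
    define S' where "S' = insert borel_probs {s\<in>S. \<nu> \<in> s}"
    define e where "e = from_nat_into S'"
    have re: "range e = S'" unfolding e_def S'_def using S by (intro range_from_nat_into) auto
    have "\<exists>\<nu>'\<in>borel_probs. (\<forall>i\<le>n. \<nu>' \<in> e i) \<and> \<nu>' \<notin> W" for n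
    proof -
      define b where "b = {\<nu>'\<in>borel_probs. \<forall>s\<in>(e ` {..n}) - {borel_probs}. \<nu>' \<in> s}"
      have sub: "e ` {..n} - {borel_probs} \<subseteq> {s\<in>S. \<nu> \<in> s}" using re by (auto simp: S'_def)
      then have "b \<in> \<B>" unfolding \<B>_def b_def by (intro imageI) auto
      moreover have "\<nu> \<in> b" using sub \<nu>p by (auto simp: b_def)
      ultimately obtain \<nu>' where "\<nu>' \<in> b" "\<nu>' \<notin> W" using contr by blast
      then show ?thesis by (intro bexI[of _ \<nu>']) (auto simp: b_def)
    qed
    then obtain \<nu>' where \<nu>': "\<And>n. \<nu>' n \<in> borel_probs" "\<And>n i. i \<le> n \<Longrightarrow> \<nu>' n \<in> e i" "\<And>n. \<nu>' n \<notin> W"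
      by metis
    have pr: "prob_space \<nu>" "sets \<nu> = sets borel" "\<And>n. prob_space (\<nu>' n)" "\<And>n. sets (\<nu>' n) = sets borel"
      using \<nu>p \<nu>'(1) by (auto simp: borel_probs_def)
    have em: "emeasure (\<nu>' n) V = ennreal (measure (\<nu>' n) V)" for n V
    proof -
      interpret prob_space "\<nu>' n" by (rule pr)
      show ?thesis by (rule emeasure_eq_measure)
    qed
    have le: "liminf_on_opens \<nu>' \<nu>"
    proof (rule liminf_on_opens_from_basis[OF B(2,1) pr(2,4)])
      fix F assume F: "finite F" "F \<subseteq> B"
      define V where "V = \<Union>F"
      have V: "V \<in> \<V>" using F by (auto simp: V_def \<V>_def)
      show "emeasure \<nu> (\<Union>F) \<le> liminf (\<lambda>n. emeasure (\<nu>' n) (\<Union>F))"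
        unfolding le_Liminf_iff V_def[symmetric]
      proof safe
        fix y assume y: "y < emeasure \<nu> V"
        then have "y < top" by (metis top_greatest order_less_le_trans)
        then obtain y' where y': "y = ennreal y'" "0 \<le> y'" by (cases y) auto
        have "y' < measure \<nu> V" using y y' by (simp add: \<nu>.emeasure_eq_measure ennreal_less_iff)
        then obtain q where q: "y' < of_rat q" "of_rat q < measure \<nu> V" using of_rat_dense by blast
        have "{\<nu> \<in> borel_probs. of_rat q < measure \<nu> V} \<in> S'"
          using V q \<nu>p by (auto simp: S'_def S_def)
        then obtain i where i: "e i = {\<nu> \<in> borel_probs. of_rat q < measure \<nu> V}"
          using re by (metis imageE)
        show "\<forall>\<^sub>F n in sequentially. y < emeasure (\<nu>' n) V"
          using eventually_ge_at_top[of i]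
        proof eventually_elim
          case (elim n)
          then have "y' < measure (\<nu>' n) V" using \<nu>'(2)[OF elim] q i by auto
          then show ?case using y' by (simp add: em ennreal_less_iff)
        qed
      qed
    qed
    have "limitin narrow_topology \<nu>' \<nu> sequentially"
      unfolding narrow_topology_def limitin_initial_topology[of \<nu>', OF \<nu>'(1)]
      using \<nu>p tendsto_integral_bounded_continuous[OF pr le] by blast
    then have "\<forall>\<^sub>F n in sequentially. \<nu>' n \<in> W"
      using W \<nu> by (auto simp: limitin_def)
    then show False using \<nu>'(3) by simp
  qed
  have "W = \<Union>{b\<in>\<B>. b \<subseteq> W}" using nbh by blast
  also have "\<dots> \<in> sets (prob_algebra borel)" using \<B> \<B>m by (intro sets.countable_Union) auto
  finally show ?thesis .
qed

text \<open>Measurability for the Borel sets of the narrow topology is measurability of all evaluations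
\<open>\<omega> \<mapsto> \<gamma> \<omega> B\<close>. One inclusion needs the countable base of the narrow topology, the other that the mass
of an open set is a supremum of integrals of continuous functions.\<close>

lemma random_measures_eq:
  fixes P :: "'w measure"
  shows "random_measures P = (P \<rightarrow>\<^sub>M prob_algebra (borel :: 'z::{metric_space, second_countable_topology} measure))"
proof safe
  fix \<gamma> :: "'w \<Rightarrow> 'z measure" assume "\<gamma> \<in> P \<rightarrow>\<^sub>M prob_algebra borel"
  then show "\<gamma> \<in> random_measures P"
    unfolding random_measures_def borel_of_def
    using measurable_space[of \<gamma> P "prob_algebra borel"] openin_subset[of narrow_topology]
    by (intro measurable_measure_of)
      (auto simp: narrow_topology_def[symmetric] borel_probs_eq measurable_sets[OF _ openin_narrow_topology_measurable]
         simp: narrow_topology_def)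
next
  fix \<gamma> :: "'w \<Rightarrow> 'z measure" assume \<gamma>: "\<gamma> \<in> random_measures P"
  have \<gamma>p: "prob_space (\<gamma> \<omega>)" "sets (\<gamma> \<omega>) = sets borel" if "\<omega> \<in> space P" for \<omega>
    using measurable_space[OF \<gamma>[unfolded random_measures_def] that]
    by (auto simp: space_borel_of narrow_topology_def borel_probs_def)
  show "\<gamma> \<in> P \<rightarrow>\<^sub>M prob_algebra borel"
  proof (rule measurable_prob_algebra_generated[OF sets_borel])
    show "Int_stable {S :: 'z set. open S}" by (auto simp: Int_stable_def)
    fix U :: "'z set" assume "U \<in> {S. open S}"
    then have U: "open U" by simp
    obtain g :: "nat \<Rightarrow> 'z \<Rightarrow> real" where g: "\<And>k. continuous_on UNIV (g k)" "\<And>k x. 0 \<le> g k x" "\<And>k x. g k x \<le> 1"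
      "\<And>x. incseq (\<lambda>k. g k x)" "\<And>x. (\<lambda>k. g k x) \<longlonglongrightarrow> indicator U x"
      using open_indicator_sup_continuous[OF U] by blast
    have "(\<lambda>\<nu>. \<integral>z. g k z \<partial>\<nu>) \<in> borel_measurable (borel_of (narrow_topology :: 'z measure topology))" for k
    proof -
      have "bounded (range (g k))" using g(2,3) by (auto intro!: boundedI[of _ 1])
      then show ?thesis
        unfolding narrow_topology_def using g(1) by (intro borel_measurable_initial_topology) auto
    qed
    then have "(\<lambda>\<omega>. \<integral>z. g k z \<partial>\<gamma> \<omega>) \<in> borel_measurable P" for k
      using measurable_compose[OF \<gamma>[unfolded random_measures_def]] by blast
    then have "(\<lambda>\<omega>. SUP k. ennreal (\<integral>z. g k z \<partial>\<gamma> \<omega>)) \<in> borel_measurable P" by measurable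
    moreover have "emeasure (\<gamma> \<omega>) U = (SUP k. ennreal (\<integral>z. g k z \<partial>\<gamma> \<omega>))" if "\<omega> \<in> space P" for \<omega>
      by (rule emeasure_open_eq_SUP_integral[OF \<gamma>p[OF that] U g])
    ultimately show "(\<lambda>\<omega>. emeasure (\<gamma> \<omega>) U) \<in> borel_measurable P"
      by (simp cong: measurable_cong)
  qed (auto simp: \<gamma>p)
qed

lemma random_measure_space:
  fixes \<gamma> :: "'w \<Rightarrow> 'z::{metric_space, second_countable_topology} measure"
  assumes "\<gamma> \<in> random_measures P" "\<omega> \<in> space P"
  shows "prob_space (\<gamma> \<omega>)" "sets (\<gamma> \<omega>) = sets borel"
  using measurable_space[OF assms(1)[unfolded random_measures_eq] assms(2)] by (auto simp: space_prob_algebra)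

lemma random_measure_kernel:
  fixes \<gamma> :: "'w \<Rightarrow> 'z::{metric_space, second_countable_topology} measure"
  shows "\<gamma> \<in> random_measures P \<Longrightarrow> \<gamma> \<in> P \<rightarrow>\<^sub>M subprob_algebra borel"
  by (simp add: random_measures_eq measurable_prob_algebraD)

lemma integral_random_measure_measurable:
  fixes g :: "'z::{metric_space, second_countable_topology} \<Rightarrow> real"
  assumes "z \<in> random_measures P" "g \<in> borel_measurable borel"
  shows "(\<lambda>\<omega>. \<integral>p. g p \<partial>z \<omega>) \<in> borel_measurable P"
  by (rule measurable_compose[OF random_measure_kernel[OF assms(1)] integral_measurable_subprob_algebra[OF assms(2)]])

lemma (in prob_space) mean_measure:
  fixes \<gamma> :: "'a \<Rightarrow> 'z::{metric_space, second_countable_topology} measure"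
  assumes "\<gamma> \<in> random_measures M"
  shows "prob_space (M \<bind> \<gamma>)" "sets (M \<bind> \<gamma>) = sets borel"
  using random_measure_space[OF assms] not_empty
  by (auto intro!: prob_space_bind[OF _ random_measure_kernel[OF assms]] sets_bind)

lemma measurable_family_iff:
  "measurable_family \<nu> \<longleftrightarrow> \<nu> \<in> borel \<rightarrow>\<^sub>M prob_algebra borel"
proof
  assume "measurable_family \<nu>"
  then show "\<nu> \<in> borel \<rightarrow>\<^sub>M prob_algebra borel"
    unfolding measurable_family_def borel_probs_def
    by (intro measurable_prob_algebraI measurable_subprob_algebra) (auto intro: prob_space_imp_subprob_space)
next
  assume \<nu>: "\<nu> \<in> borel \<rightarrow>\<^sub>M prob_algebra borel"
  note [measurable] = measurable_prob_algebraD[OF \<nu>]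
  show "measurable_family \<nu>"
    unfolding measurable_family_def borel_probs_eq using measurable_space[OF \<nu>] by auto
qed

lemma dense_sequenceE:
  obtains d :: "nat \<Rightarrow> 'a::{metric_space, second_countable_topology}"
  where "\<And>x e. 0 < e \<Longrightarrow> \<exists>k. dist x (d k) < e"
proof -
  obtain D :: "'a set" where D: "countable D" "\<And>X. open X \<Longrightarrow> X \<noteq> {} \<Longrightarrow> \<exists>d\<in>D. d \<in> X"
    using countable_dense_setE by blast
  have "D \<noteq> {}" using D(2)[of UNIV] by auto
  then have r: "range (from_nat_into D) = D" using D(1) by (rule range_from_nat_into)
  have "\<exists>k. dist x (from_nat_into D k) < e" if "0 < e" for x e
  proof -
    have "\<exists>y\<in>D. y \<in> ball x e" by (rule D(2)) (use that in auto)
    then obtain y where "y \<in> D" "y \<in> ball x e" by blast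
    then show ?thesis using r by (metis imageE mem_ball)
  qed
  then show ?thesis using that by blast
qed

text \<open>Replace \<open>z\<close> by the first point of a dense sequence at distance below \<open>1/(n+1)\<close>. The resulting function
selects measurably among countably many functions of \<open>\<omega>\<close>, and it converges to \<open>f\<close> by continuity.\<close>

lemma caratheodory_measurable:
  fixes f :: "'w \<Rightarrow> 'z::{metric_space, second_countable_topology} \<Rightarrow> real"
  assumes meas: "\<And>z. (\<lambda>\<omega>. f \<omega> z) \<in> borel_measurable M"
    and cont: "\<And>\<omega>. \<omega> \<in> space M \<Longrightarrow> continuous_on UNIV (f \<omega>)"
  shows "(\<lambda>(\<omega>, z). f \<omega> z) \<in> borel_measurable (M \<Otimes>\<^sub>M borel)"
proof -
  obtain d :: "nat \<Rightarrow> 'z" where d: "\<And>x e. 0 < e \<Longrightarrow> \<exists>k. dist x (d k) < e"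
    using dense_sequenceE by blast
  define k where "k n z = (LEAST k. dist z (d k) < 1 / real (Suc n))" for n z
  have near: "dist z (d (k n z)) < 1 / real (Suc n)" for n z
    unfolding k_def by (rule LeastI_ex) (use d in simp)
  show ?thesis
  proof (rule borel_measurable_LIMSEQ_real)
    fix n
    have "k n \<in> borel \<rightarrow>\<^sub>M count_space UNIV" unfolding k_def by measurable
    then have km: "(\<lambda>q. k n (snd q)) \<in> M \<Otimes>\<^sub>M borel \<rightarrow>\<^sub>M count_space UNIV" by measurable
    have "(\<lambda>q. f (fst q) (d i)) \<in> borel_measurable (M \<Otimes>\<^sub>M borel)" for i
      using measurable_compose[OF measurable_fst meas] .
    from measurable_compose_countable[OF this km]
    show "(\<lambda>q. f (fst q) (d (k n (snd q)))) \<in> borel_measurable (M \<Otimes>\<^sub>M borel)" .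
  next
    fix q assume "q \<in> space (M \<Otimes>\<^sub>M (borel :: 'z measure))"
    then have "fst q \<in> space M" by (auto simp: space_pair_measure)
    then have "isCont (f (fst q)) (snd q)"
      using cont by (simp add: continuous_on_eq_continuous_at)
    moreover have "(\<lambda>n. d (k n (snd q))) \<longlonglongrightarrow> snd q"
    proof (rule metric_tendsto_imp_tendsto)
      show "(\<lambda>n. 1 / real (Suc n)) \<longlonglongrightarrow> 0"
        using LIMSEQ_inverse_real_of_nat by (simp add: inverse_eq_divide)
      show "\<forall>\<^sub>F n in sequentially. dist (d (k n (snd q))) (snd q) \<le> dist (1 / real (Suc n)) 0"
        using near by (intro always_eventually allI) (simp add: dist_commute less_imp_le)
    qed
    ultimately have "(\<lambda>n. f (fst q) (d (k n (snd q)))) \<longlonglongrightarrow> f (fst q) (snd q)"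
      by (rule isCont_tendsto_compose)
    then show "(\<lambda>n. f (fst q) (d (k n (snd q)))) \<longlonglongrightarrow> (case q of (\<omega>, z) \<Rightarrow> f \<omega> z)"
      by (simp add: split_beta')
  qed
qed

context prob_space
begin

text \<open>Setting \<open>f\<close> to \<open>0\<close> on a null set outside which \<open>f \<omega>\<close> is continuous yields a jointly measurable
function. The integral changes on that null set only, where the completion absorbs the change.\<close>

lemma integral_test_function_measurable:
  fixes \<gamma> :: "'a \<Rightarrow> 'z::{metric_space, second_countable_topology} measure"
  assumes f: "f \<in> random_test_functions M" and \<gamma>: "\<gamma> \<in> random_measures M"
  shows "(\<lambda>\<omega>. \<integral>z. f \<omega> z \<partial>\<gamma> \<omega>) \<in> borel_measurable (completion M)"
proof -
  have "AE \<omega> in M. bounded (range (f \<omega>)) \<and> continuous_on UNIV (f \<omega>)"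
    and fm[measurable]: "\<And>z. (\<lambda>\<omega>. f \<omega> z) \<in> borel_measurable M"
    using f by (auto simp: random_test_functions_def)
  then obtain N where N: "\<And>\<omega>. \<omega> \<in> space M - N \<Longrightarrow> continuous_on UNIV (f \<omega>)" "N \<in> null_sets M"
    by (elim AE_E3) auto
  then have Nm[measurable]: "N \<in> sets M" by auto
  define f' where "f' \<omega> z = indicator (space M - N) \<omega> * f \<omega> z" for \<omega> z
  have f'm: "(\<lambda>(\<omega>, z). f' \<omega> z) \<in> borel_measurable (M \<Otimes>\<^sub>M borel)"
  proof (rule caratheodory_measurable)
    show "(\<lambda>\<omega>. f' \<omega> z) \<in> borel_measurable M" for z unfolding f'_def by measurable
    show "continuous_on UNIV (f' \<omega>)" if "\<omega> \<in> space M" for \<omega>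
      using N(1)[of \<omega>] that unfolding f'_def by (cases "\<omega> \<in> N") auto
  qed
  have \<gamma>s: "\<gamma> \<in> M \<rightarrow>\<^sub>M subprob_algebra borel"
    by (rule random_measure_kernel[OF \<gamma>])
  have "(\<lambda>\<omega>. distr (\<gamma> \<omega>) (M \<Otimes>\<^sub>M borel) (Pair \<omega>)) \<in> M \<rightarrow>\<^sub>M subprob_algebra (M \<Otimes>\<^sub>M borel)"
    by (rule measurable_distr2[OF _ \<gamma>s]) simp
  from measurable_compose[OF this integral_measurable_subprob_algebra[OF f'm]]
  have "(\<lambda>\<omega>. \<integral>q. (case q of (\<omega>, z) \<Rightarrow> f' \<omega> z) \<partial>distr (\<gamma> \<omega>) (M \<Otimes>\<^sub>M borel) (Pair \<omega>)) \<in> borel_measurable M" .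
  moreover have "(\<integral>q. (case q of (\<omega>, z) \<Rightarrow> f' \<omega> z) \<partial>distr (\<gamma> \<omega>) (M \<Otimes>\<^sub>M borel) (Pair \<omega>)) = (\<integral>z. f' \<omega> z \<partial>\<gamma> \<omega>)"
    if \<omega>: "\<omega> \<in> space M" for \<omega>
    using \<omega> f'm subprob_measurableD(2)[OF \<gamma>s \<omega>]
    by (subst integral_distr) (auto simp: measurable_cong_sets[of "\<gamma> \<omega>" borel])
  ultimately have g: "(\<lambda>\<omega>. \<integral>z. f' \<omega> z \<partial>\<gamma> \<omega>) \<in> borel_measurable M"
    by (simp cong: measurable_cong)
  show ?thesis
  proof (rule borel_measurableI)
    fix S :: "real set" assume S: "open S"
    show "(\<lambda>\<omega>. \<integral>z. f \<omega> z \<partial>\<gamma> \<omega>) -` S \<inter> space (completion M) \<in> sets (completion M)"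
    proof (rule completion.in_sets_AE)
      have "(\<lambda>\<omega>. \<integral>z. f' \<omega> z \<partial>\<gamma> \<omega>) -` S \<inter> space M \<in> sets M"
        using measurable_sets[OF g borel_open[OF S]] .
      then show "(\<lambda>\<omega>. \<integral>z. f' \<omega> z \<partial>\<gamma> \<omega>) -` S \<inter> space M \<in> sets (completion M)" by auto
      have "AE \<omega> in M. \<omega> \<notin> N" by (rule AE_not_in[OF N(2)])
      moreover have "AE \<omega> in M. \<omega> \<in> space M" by simp
      ultimately show "AE \<omega> in completion M. \<omega> \<in> (\<lambda>\<omega>. \<integral>z. f' \<omega> z \<partial>\<gamma> \<omega>) -` S \<inter> space M \<longleftrightarrow>
          \<omega> \<in> (\<lambda>\<omega>. \<integral>z. f \<omega> z \<partial>\<gamma> \<omega>) -` S \<inter> space (completion M)"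
        unfolding AE_completion_iff
      proof eventually_elim
        case (elim \<omega>)
        then have "f' \<omega> = f \<omega>" by (simp add: f'_def fun_eq_iff)
        then show ?case by simp
      qed
    qed simp
  qed
qed

text \<open>Almost sure narrow convergence is enough, by dominated convergence with the integrable bound
\<open>sup\<^sub>z \<bar>f \<omega> z\<bar>\<close>.\<close>

lemma limitin_random_narrow_topologyI:
  fixes z :: "'a \<Rightarrow> 'z::{metric_space, second_countable_topology} measure"
  assumes zn: "\<And>n. zn n \<in> random_measures M" and z: "z \<in> random_measures M"
    and lim: "AE \<omega> in M. liminf_on_opens (\<lambda>n. zn n \<omega>) (z \<omega>)"
  shows "limitin (random_narrow_topology M) zn z sequentially"
  unfolding random_narrow_topology_def limitin_initial_topology[of zn, OF zn]
proof (intro conjI z ballI)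
  fix \<phi> :: "('a \<Rightarrow> 'z measure) \<Rightarrow> real"
  assume "\<phi> \<in> {\<lambda>\<gamma>. \<integral>\<omega>. (\<integral>z. f \<omega> z \<partial>\<gamma> \<omega>) \<partial>completion M | f. f \<in> random_test_functions M}"
  then obtain f where \<phi>: "\<phi> = (\<lambda>\<gamma>. \<integral>\<omega>. (\<integral>z. f \<omega> z \<partial>\<gamma> \<omega>) \<partial>completion M)" and f: "f \<in> random_test_functions M"
    by blast
  have fb: "AE \<omega> in M. bounded (range (f \<omega>)) \<and> continuous_on UNIV (f \<omega>)"
    and fi: "integrable (completion M) (\<lambda>\<omega>. SUP z. \<bar>f \<omega> z\<bar>)"
    using f by (auto simp: random_test_functions_def)
  have sp: "AE \<omega> in M. \<omega> \<in> space M" by simp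
  show "(\<lambda>n. \<phi> (zn n)) \<longlonglongrightarrow> \<phi> z"
    unfolding \<phi>
  proof (rule integral_dominated_convergence[OF _ _ fi])
    show "(\<lambda>\<omega>. \<integral>z. f \<omega> z \<partial>zn n \<omega>) \<in> borel_measurable (completion M)" for n
      by (rule integral_test_function_measurable[OF f zn])
    show "(\<lambda>\<omega>. \<integral>p. f \<omega> p \<partial>z \<omega>) \<in> borel_measurable (completion M)"
      by (rule integral_test_function_measurable[OF f z])
    show "AE \<omega> in completion M. (\<lambda>n. \<integral>p. f \<omega> p \<partial>zn n \<omega>) \<longlonglongrightarrow> (\<integral>p. f \<omega> p \<partial>z \<omega>)"
      unfolding AE_completion_iff using lim fb sp
    proof eventually_elim
      case (elim \<omega>)
      then show ?case
        using random_measure_space[OF zn] random_measure_space[OF z] by (intro tendsto_integral_bounded_continuous) auto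
    qed
    fix n
    show "AE \<omega> in completion M. norm (\<integral>p. f \<omega> p \<partial>zn n \<omega>) \<le> (SUP z. \<bar>f \<omega> z\<bar>)"
      unfolding AE_completion_iff using fb sp
    proof eventually_elim
      case (elim \<omega>)
      interpret Z: prob_space "zn n \<omega>" by (rule random_measure_space[OF zn elim(2)])
      obtain C where C: "\<And>x. \<bar>f \<omega> x\<bar> \<le> C" using elim(1) by (auto simp: bounded_iff)
      have le: "\<bar>f \<omega> x\<bar> \<le> (SUP z. \<bar>f \<omega> z\<bar>)" for x
        using C by (intro cSUP_upper) (auto intro!: bdd_aboveI[of _ C])
      have i: "integrable (zn n \<omega>) (f \<omega>)"
        using elim C by (intro integrable_bounded_continuous[OF random_measure_space[OF zn elim(2)], of _ C]) auto
      have "norm (\<integral>p. f \<omega> p \<partial>zn n \<omega>) \<le> (\<integral>p. \<bar>f \<omega> p\<bar> \<partial>zn n \<omega>)"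
        using integral_norm_bound[of "zn n \<omega>" "f \<omega>"] by simp
      also have "\<dots> \<le> (\<integral>p. (SUP z. \<bar>f \<omega> z\<bar>) \<partial>zn n \<omega>)"
        using i le by (intro integral_mono) auto
      finally show ?case by (simp add: Z.prob_space)
    qed
  qed
qed

text \<open>These test functions separate the events on which a random measure takes different values.\<close>

lemma random_test_functions_indicator:
  assumes [measurable]: "A \<in> sets M" and g: "continuous_on UNIV g" "bounded (range g)"
  shows "(\<lambda>\<omega> z. indicator A \<omega> * g z) \<in> random_test_functions M"
proof -
  have "(SUP z. \<bar>indicator A \<omega> * g z\<bar>) = indicator A \<omega> * (SUP z. \<bar>g z\<bar>)" for \<omega>
    by (cases "\<omega> \<in> A") auto
  moreover have "integrable M (\<lambda>\<omega>. indicator A \<omega> * (SUP z. \<bar>g z\<bar>))"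
    using emeasure_le_1[of A] order.strict_trans1[of "emeasure M A" 1 top]
    by (intro integrable_mult_left integrable_real_indicator) auto
  moreover have "bounded (range (\<lambda>z. indicator A \<omega> * g z))" for \<omega>
    using g(2) by (cases "\<omega> \<in> A") auto
  moreover have "continuous_on UNIV (\<lambda>z. indicator A \<omega> * g z)" for \<omega>
    by (intro continuous_intros g)
  ultimately show ?thesis
    by (auto simp: random_test_functions_def integrable_completion)
qed

lemma random_narrow_limit_tests:
  fixes z :: "'a \<Rightarrow> 'z::{metric_space, second_countable_topology} measure" and g :: "'z \<Rightarrow> real"
  assumes z: "\<And>n. zn n \<in> random_measures M" and lim: "limitin (random_narrow_topology M) zn z sequentially"
    and A: "A \<in> sets M" and g: "continuous_on UNIV g" "bounded (range g)"
  shows "(\<lambda>n. \<integral>\<omega>. indicator A \<omega> * (\<integral>p. g p \<partial>zn n \<omega>) \<partial>M) \<longlonglongrightarrow> (\<integral>\<omega>. indicator A \<omega> * (\<integral>p. g p \<partial>z \<omega>) \<partial>M)"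
proof -
  note l = lim[unfolded random_narrow_topology_def limitin_initial_topology[of zn, OF z]]
  have gm: "g \<in> borel_measurable borel" by (rule borel_measurable_continuous_onI[OF g(1)])
  have eq: "(\<integral>\<omega>. (\<integral>p. indicator A \<omega> * g p \<partial>y \<omega>) \<partial>completion M) = (\<integral>\<omega>. indicator A \<omega> * (\<integral>p. g p \<partial>y \<omega>) \<partial>M)"
    if y: "y \<in> random_measures M" for y :: "'a \<Rightarrow> 'z measure"
  proof -
    have "(\<lambda>\<omega>. indicator A \<omega> * (\<integral>p. g p \<partial>y \<omega>)) \<in> borel_measurable M"
      using A integral_random_measure_measurable[OF y gm] by measurable
    then show ?thesis by (simp add: integral_completion)
  qed
  have "(\<lambda>n. \<integral>\<omega>. (\<integral>p. indicator A \<omega> * g p \<partial>zn n \<omega>) \<partial>completion M)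
      \<longlonglongrightarrow> (\<integral>\<omega>. (\<integral>p. indicator A \<omega> * g p \<partial>z \<omega>) \<partial>completion M)"
  proof -
    have "(\<lambda>\<gamma>. \<integral>\<omega>. (\<integral>p. indicator A \<omega> * g p \<partial>\<gamma> \<omega>) \<partial>completion M) \<in>
        {\<lambda>\<gamma>. \<integral>\<omega>. (\<integral>p. f \<omega> p \<partial>\<gamma> \<omega>) \<partial>completion M | f. f \<in> random_test_functions M}"
      using random_test_functions_indicator[OF A g]
      by (intro CollectI exI[of _ "\<lambda>\<omega> p. indicator A \<omega> * g p"] conjI refl)
    from bspec[OF conjunct2[OF l] this] show ?thesis by simp
  qed
  then show ?thesis unfolding eq[OF z] eq[OF conjunct1[OF l]] .
qed

end

section \<open>A strong law of large numbers for bounded triangular arrays\<close>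

text \<open>By Hoeffding's inequality, the mean of row \<open>n\<close> deviates by \<open>e\<close> or more with probability at most
\<open>2 exp (- n e\<^sup>2 / (2 D\<^sup>2))\<close>. This is summable in \<open>n\<close>, so the Borel-Cantelli lemma applies, and
the functions may change from row to row.\<close>

lemma (in prob_space) triangular_strong_law:
  fixes X :: "nat \<Rightarrow> 'a \<Rightarrow> 'x" and h :: "nat \<Rightarrow> nat \<Rightarrow> 'x \<Rightarrow> real"
  assumes X: "indep_vars (\<lambda>_. N) X UNIV"
    and h: "\<And>n i. h n i \<in> borel_measurable N" "\<And>n i x. \<bar>h n i x\<bar> \<le> C"
  shows "AE \<omega> in M. (\<lambda>n. (\<Sum>i<n. h n i (X i \<omega>)) / real n - (\<Sum>i<n. expectation (\<lambda>\<omega>. h n i (X i \<omega>))) / real n) \<longlonglongrightarrow> 0"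
proof -
  \<comment> \<open>Hoeffding's inequality needs intervals of positive length.\<close>
  define D where "D = max C 1"
  have D: "0 < D" "\<bar>h n i x\<bar> \<le> D" for n i x using h(2)[of n i x] by (auto simp: D_def)
  define m where "m n = (\<Sum>i<n. expectation (\<lambda>\<omega>. h n i (X i \<omega>)))" for n
  define S where "S n \<omega> = (\<Sum>i<n. h n i (X i \<omega>))" for n \<omega>
  have Xm[measurable]: "X i \<in> measurable M N" for i
    using X by (auto simp: indep_vars_def)
  note h(1)[measurable]
  have Sm[measurable]: "S n \<in> borel_measurable M" for n unfolding S_def by measurable
  have tail: "AE \<omega> in M. \<forall>\<^sub>F n in sequentially. \<bar>S n \<omega> / real n - m n / real n\<bar> < e" if e: "0 < e" for e
  proof -
    define A where "A n = {\<omega>\<in>space M. e * real n \<le> \<bar>S n \<omega> - m n\<bar>}" for n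
    have Am: "A n \<in> sets M" for n unfolding A_def by measurable
    define r where "r = exp (- (e\<^sup>2 / (2 * D\<^sup>2)))"
    have r: "0 \<le> r" "r < 1" using e D by (auto simp: r_def)
    have bd: "measure M (A n) \<le> 2 * r ^ n" for n
    proof (cases "n = 0")
      case True
      have "measure M (A n) \<le> 1" by (rule prob_le_1)
      then show ?thesis using True by (simp only: power_0 mult_1_right)
    next
      case False
      interpret Hoeffding_ineq M "{..<n}" "\<lambda>i \<omega>. h n i (X i \<omega>)" "\<lambda>_. -D" "\<lambda>_. D" "m n"
      proof unfold_locales
        show "indep_vars (\<lambda>_. borel) (\<lambda>i \<omega>. h n i (X i \<omega>)) {..<n}"
          by (intro indep_vars_compose2[OF indep_vars_subset[OF X]]) (auto simp: h)
        show "AE x in M. h n i (X i x) \<in> {- D..D}" for i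
          using D(2)[of n i] by (intro AE_I2) (auto simp: abs_le_iff minus_le_iff)
        show "m n \<equiv> \<Sum>i<n. expectation (\<lambda>\<omega>. h n i (X i \<omega>))"
          by (simp add: m_def)
      qed auto
      have "measure M (A n) \<le> 2 * exp (- 2 * (e * real n)\<^sup>2 / (\<Sum>i<n. (D - - D)\<^sup>2))"
        unfolding A_def S_def using e D False by (intro Hoeffding_ineq_abs_ge) auto
      also have "- 2 * (e * real n)\<^sup>2 / (\<Sum>i<n. (D - - D)\<^sup>2) = real n * (- (e\<^sup>2 / (2 * D\<^sup>2)))"
        using False D by (simp add: power2_eq_square field_simps)
      finally show ?thesis by (simp add: r_def exp_of_nat_mult[symmetric] mult.commute)
    qed
    have "summable (\<lambda>n. measure M (A n))"
      by (rule summable_comparison_test'[of "\<lambda>n. 2 * r ^ n"])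
        (use r bd in \<open>auto intro!: summable_mult summable_geometric\<close>)
    then have "AE \<omega> in M. \<forall>\<^sub>F n in sequentially. \<omega> \<in> space M - A n"
      using Am by (intro borel_cantelli_AE1) (auto simp: emeasure_eq_measure)
    then show ?thesis
    proof eventually_elim
      case (elim \<omega>)
      then show ?case using eventually_gt_at_top[of 0]
        by eventually_elim (auto simp: A_def not_le diff_divide_distrib[symmetric] abs_divide pos_divide_less_eq)
    qed
  qed
  have "AE \<omega> in M. \<forall>k::nat. \<forall>\<^sub>F n in sequentially. \<bar>S n \<omega> / real n - m n / real n\<bar> < 1 / real (Suc k)"
    using tail by (subst AE_all_countable) auto
  then show ?thesis
  proof eventually_elim
    case (elim \<omega>)
    have "(\<lambda>n. S n \<omega> / real n - m n / real n) \<longlonglongrightarrow> 0"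
    proof (rule tendstoI)
      fix e :: real assume "0 < e"
      then obtain k where k: "1 / real (Suc k) < e" using nat_approx_posE by blast
      show "\<forall>\<^sub>F n in sequentially. dist (S n \<omega> / real n - m n / real n) 0 < e"
        using elim[rule_format, of k] by eventually_elim (use k in \<open>simp add: dist_real_def\<close>)
    qed
    then show ?case by (simp add: S_def m_def)
  qed
qed

section \<open>Disintegration of measures on products with a Polish space\<close>

abbreviation bit_sequences :: "(nat \<Rightarrow> bool) measure" where
  "bit_sequences \<equiv> Pi\<^sub>M UNIV (\<lambda>_. count_space UNIV)"

text \<open>The digits of \<open>\<phi> y\<close> record for which \<open>k\<close> and \<open>m\<close> the point \<open>y\<close> has distance below \<open>1/(k+1)\<close> from the
point \<open>d m\<close> of a dense sequence; \<open>g\<close> recovers \<open>y\<close> as the limit over \<open>k\<close> of the first recorded points.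
A left inverse defined on all sequences allows measures to be carried back to the Polish space
whatever the range of \<open>\<phi>\<close> is.\<close>

lemma polish_bit_sequences_retract:
  obtains \<phi> :: "'y::polish_space \<Rightarrow> nat \<Rightarrow> bool" and g
  where "\<phi> \<in> borel \<rightarrow>\<^sub>M bit_sequences" "g \<in> bit_sequences \<rightarrow>\<^sub>M borel" "\<And>y. g (\<phi> y) = y"
proof -
  obtain d :: "nat \<Rightarrow> 'y" where d: "\<And>x e. 0 < e \<Longrightarrow> \<exists>k. dist x (d k) < e"
    using dense_sequenceE by blast
  define \<phi> where "\<phi> y n = (case prod_decode n of (k, m) \<Rightarrow> dist y (d m) < 1 / real (Suc k))" for y n
  define f where "f k s = d (LEAST m. s (prod_encode (k, m)))" for k and s :: "nat \<Rightarrow> bool"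
  \<comment> \<open>A constant sequence replaces one that does not converge.\<close>
  define f' where "f' k s = (if Cauchy (\<lambda>k. f k s) then f k s else d 0)" for k s
  define g where "g s = lim (\<lambda>k. f' k s)" for s
  have \<phi>m: "\<phi> \<in> borel \<rightarrow>\<^sub>M bit_sequences"
    unfolding \<phi>_def by (intro measurable_PiM_single') (auto split: prod.split)
  have fm[measurable]: "f k \<in> bit_sequences \<rightarrow>\<^sub>M borel" for k
  proof -
    have "(\<lambda>s. LEAST m. s (prod_encode (k, m))) \<in> bit_sequences \<rightarrow>\<^sub>M count_space UNIV"
      by (intro measurable_Least) simp
    then show ?thesis unfolding f_def by (rule measurable_compose) simp
  qed
  have f'm: "f' k \<in> bit_sequences \<rightarrow>\<^sub>M borel" for k
    unfolding f'_def by measurable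
  have gm: "g \<in> bit_sequences \<rightarrow>\<^sub>M borel"
  proof (rule borel_measurable_LIMSEQ_metric[OF f'm])
    fix s
    have "convergent (\<lambda>k. f' k s)"
    proof (cases "Cauchy (\<lambda>k. f k s)")
      case True
      then show ?thesis by (simp add: f'_def Cauchy_convergent)
    next
      case False
      then show ?thesis by (simp add: f'_def convergent_const)
    qed
    then show "(\<lambda>k. f' k s) \<longlonglongrightarrow> g s"
      unfolding g_def by (rule convergent_LIMSEQ_iff[THEN iffD1])
  qed
  have "g (\<phi> y) = y" for y
  proof -
    have near: "dist y (f k (\<phi> y)) < 1 / real (Suc k)" for k
    proof -
      obtain m where "dist y (d m) < 1 / real (Suc k)"
        using d[of "1 / real (Suc k)" y] by auto
      then have "\<phi> y (prod_encode (k, m))" by (simp add: \<phi>_def)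
      then have "\<phi> y (prod_encode (k, LEAST m. \<phi> y (prod_encode (k, m))))" by (rule LeastI)
      then show ?thesis by (simp add: f_def \<phi>_def)
    qed
    have lim: "(\<lambda>k. f k (\<phi> y)) \<longlonglongrightarrow> y"
    proof (rule metric_tendsto_imp_tendsto)
      show "(\<lambda>k. 1 / real (Suc k)) \<longlonglongrightarrow> 0"
        using LIMSEQ_inverse_real_of_nat by (simp add: inverse_eq_divide)
      show "\<forall>\<^sub>F k in sequentially. dist (f k (\<phi> y)) y \<le> dist (1 / real (Suc k)) 0"
        using near by (intro always_eventually allI) (simp add: dist_commute less_imp_le)
    qed
    then have "f' k (\<phi> y) = f k (\<phi> y)" for k
      unfolding f'_def using LIMSEQ_imp_Cauchy by auto
    then show ?thesis unfolding g_def using lim by (simp add: limI)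
  qed
  then show ?thesis using that \<phi>m gm by blast
qed

definition cylinder :: "bool list \<Rightarrow> (nat \<Rightarrow> bool) set" where
  "cylinder s = {b. \<forall>i<length s. b i = s ! i}"

lemma cylinder_measurable [measurable]: "cylinder s \<in> sets bit_sequences"
proof -
  have "cylinder s = {b\<in>space bit_sequences. \<forall>i\<in>{..<length s}. b i = s ! i}"
    by (auto simp: cylinder_def space_PiM)
  also have "\<dots> \<in> sets bit_sequences" by measurable
  finally show ?thesis .
qed

lemma cylinder_Nil [simp]: "cylinder [] = UNIV"
  by (simp add: cylinder_def)

lemma cylinder_snoc: "cylinder (s @ [b]) = {u \<in> cylinder s. u (length s) = b}"
  by (auto simp: cylinder_def nth_append less_Suc_eq)

text \<open>A box in finitely many coordinates is a finite disjoint union of cylinders of equal length.\<close>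

lemma measure_eqI_cylinder:
  assumes "sets P = sets bit_sequences" "sets Q = sets bit_sequences" "finite_measure P"
    and eq: "\<And>s. emeasure P (cylinder s) = emeasure Q (cylinder s)"
  shows "P = Q"
proof (rule measure_eqI_PiM_infinite[OF assms(1,2) _ assms(3)])
  fix A :: "nat \<Rightarrow> bool set" and J :: "nat set" assume J: "finite J"
  define n where "n = (if J = {} then 0 else Suc (Max J))"
  have n: "i < n" if "i \<in> J" for i using that Max_ge[OF J] by (auto simp: n_def le_imp_less_Suc)
  define T where "T = {s. set s \<subseteq> UNIV \<and> length s = n \<and> (\<forall>i\<in>J. s ! i \<in> A i)}"
  have "finite T"
    unfolding T_def by (rule finite_subset[OF _ finite_lists_length_eq[of UNIV n]]) auto
  have "prod_emb UNIV (\<lambda>_. count_space UNIV) J (Pi\<^sub>E J A) = (\<Union>s\<in>T. cylinder s)"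
  proof safe
    fix b assume b: "b \<in> prod_emb UNIV (\<lambda>_. count_space UNIV) J (Pi\<^sub>E J A)"
    have "map b [0..<n] \<in> T" using b n by (auto simp: T_def prod_emb_def PiE_iff)
    moreover have "b \<in> cylinder (map b [0..<n])" by (auto simp: cylinder_def)
    ultimately show "b \<in> (\<Union>s\<in>T. cylinder s)" by blast
  next
    fix b s assume "s \<in> T" "b \<in> cylinder s"
    then show "b \<in> prod_emb UNIV (\<lambda>_. count_space UNIV) J (Pi\<^sub>E J A)"
      using n by (auto simp: T_def prod_emb_def PiE_iff cylinder_def)
  qed
  moreover have "disjoint_family_on cylinder T"
    unfolding disjoint_family_on_def
  proof safe
    fix s t b assume st: "s \<in> T" "t \<in> T" "s \<noteq> t" and b: "b \<in> cylinder s" "b \<in> cylinder t"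
    have "s = t" using st b by (intro nth_equalityI) (auto simp: T_def cylinder_def)
    then show "b \<in> {}" using st by simp
  qed
  moreover have "cylinder ` T \<subseteq> sets bit_sequences" using cylinder_measurable by auto
  ultimately have "emeasure R (prod_emb UNIV (\<lambda>_. count_space UNIV) J (Pi\<^sub>E J A)) = (\<Sum>s\<in>T. emeasure R (cylinder s))"
    if "sets R = sets bit_sequences" for R
    using sum_emeasure[of cylinder T R] \<open>finite T\<close> that by simp
  then show "emeasure P (prod_emb UNIV (\<lambda>_. count_space UNIV) J (Pi\<^sub>E J A)) =
      emeasure Q (prod_emb UNIV (\<lambda>_. count_space UNIV) J (Pi\<^sub>E J A))"
    using assms(1,2) eq by simp
qed

text \<open>The next digit after the prefix \<open>s\<close> is drawn by comparing a uniform variable with \<open>p s x\<close>, the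
prescribed conditional probability of \<open>True\<close>.\<close>

fun random_digits :: "(bool list \<Rightarrow> 'x \<Rightarrow> ennreal) \<Rightarrow> 'x \<Rightarrow> (nat \<Rightarrow> real) \<Rightarrow> nat \<Rightarrow> bool list" where
  "random_digits p x u 0 = []"
| "random_digits p x u (Suc n) =
    random_digits p x u n @ [ennreal (u n) < p (random_digits p x u n) x]"

lemma length_random_digits [simp]: "length (random_digits p x u n) = n"
  by (induction n) auto

lemma take_random_digits: "m \<le> n \<Longrightarrow> take m (random_digits p x u n) = random_digits p x u m"
proof (induction n)
  case (Suc n)
  then show ?case by (cases "m = Suc n") auto
qed simp

lemma random_digits_measurable:
  assumes p: "\<And>s. p s \<in> borel_measurable A"
    and U: "sets U = sets borel"
  shows "(\<lambda>(x, u). random_digits p x u n) \<in> A \<Otimes>\<^sub>M (Pi\<^sub>M UNIV (\<lambda>_. U)) \<rightarrow>\<^sub>M count_space UNIV"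
proof (induction n)
  case (Suc n)
  note [measurable] = p and [measurable_cong] = U
  have "(\<lambda>q. s @ [ennreal (snd q n) < p s (fst q)]) \<in> A \<Otimes>\<^sub>M (Pi\<^sub>M UNIV (\<lambda>_. U)) \<rightarrow>\<^sub>M count_space UNIV" for s
    by measurable
  from measurable_compose_countable[OF this, of "\<lambda>q. random_digits p (fst q) (snd q) n"]
  show ?case using Suc by (simp add: split_beta')
qed simp

definition digit_kernel :: "(bool list \<Rightarrow> 'x \<Rightarrow> ennreal) \<Rightarrow> 'x \<Rightarrow> (nat \<Rightarrow> bool) measure" where
  "digit_kernel p x = distr (Pi\<^sub>M UNIV (\<lambda>_. uniform_measure lborel {0..1})) bit_sequences
     (\<lambda>u n. random_digits p x u (Suc n) ! n)"

definition digit_prob :: "(bool list \<Rightarrow> 'x \<Rightarrow> ennreal) \<Rightarrow> bool list \<Rightarrow> bool \<Rightarrow> 'x \<Rightarrow> ennreal" where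
  "digit_prob p s b x = (if b then p s x else 1 - p s x)"

lemma random_digits_nth_measurable:
  assumes p: "\<And>s. p s \<in> borel_measurable A"
  shows "(\<lambda>(x, u) n. random_digits p x u (Suc n) ! n)
    \<in> A \<Otimes>\<^sub>M (Pi\<^sub>M UNIV (\<lambda>_. uniform_measure lborel {0..1})) \<rightarrow>\<^sub>M bit_sequences"
proof -
  have "(\<lambda>q. random_digits p (fst q) (snd q) (Suc n) ! n)
      \<in> A \<Otimes>\<^sub>M (Pi\<^sub>M UNIV (\<lambda>_. uniform_measure lborel {0..1})) \<rightarrow>\<^sub>M count_space UNIV" for n
    using measurable_compose[OF random_digits_measurable[where p=p and n="Suc n" and U="uniform_measure lborel {0..1}", OF p]
        measurable_count_space[of "\<lambda>l. l ! n"]] by (simp add: split_beta' del: random_digits.simps)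
  then show ?thesis
    by (intro measurable_PiM_single') (auto simp: split_beta' simp del: random_digits.simps)
qed

lemma digit_kernel_measurable:
  assumes p: "\<And>s. p s \<in> borel_measurable A"
  shows "digit_kernel p \<in> A \<rightarrow>\<^sub>M prob_algebra bit_sequences"
proof -
  have u: "prob_space (uniform_measure lborel {0..1::real})" by (intro prob_space_uniform_measure) auto
  interpret prob_space "Pi\<^sub>M UNIV (\<lambda>_::nat. uniform_measure lborel {0..1::real})"
    by (intro prob_space_PiM u)
  show ?thesis
    unfolding digit_kernel_def
  proof (rule measurable_distr_prob_space2)
    show "(\<lambda>x. Pi\<^sub>M (UNIV::nat set) (\<lambda>_. uniform_measure lborel {0..1::real})) \<in>
        A \<rightarrow>\<^sub>M prob_algebra (Pi\<^sub>M UNIV (\<lambda>_. uniform_measure lborel {0..1}))"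
      by (intro measurable_const) (simp add: space_prob_algebra prob_space_axioms)
  qed (rule random_digits_nth_measurable[OF p])
qed

text \<open>The prefix \<open>s\<close> is drawn iff each \<open>u i\<close> lies in a set \<open>E i\<close> that depends on \<open>s\<close> only. The recursive
procedure thus becomes a product event for the independent variables \<open>u i\<close>.\<close>

lemma emeasure_digit_kernel_cylinder:
  fixes p :: "bool list \<Rightarrow> 'x \<Rightarrow> ennreal"
  assumes p: "\<And>s. p s x \<le> 1"
  shows "emeasure (digit_kernel p x) (cylinder s) = (\<Prod>i<length s. digit_prob p (take i s) (s ! i) x)"
proof -
  define U where "U = uniform_measure lborel {0..1::real}"
  interpret U: prob_space U unfolding U_def by (intro prob_space_uniform_measure) auto
  interpret PU: product_prob_space "\<lambda>_::nat. U" UNIV ..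
  define E where "E i = {r. (ennreal r < p (take i s) x) = s ! i}" for i
  have E[measurable]: "E i \<in> sets U" for i unfolding E_def U_def by simp
  have UE: "emeasure U (E i) = digit_prob p (take i s) (s ! i) x" for i
  proof -
    obtain q where q: "p (take i s) x = ennreal q" "0 \<le> q" "q \<le> 1"
      using p[of "take i s"] by (cases "p (take i s) x") (auto simp: top_unique)
    have em: "emeasure U R = emeasure lborel ({0..1} \<inter> R)" if "R \<in> sets borel" for R
      unfolding U_def by (subst emeasure_uniform_measure) (simp_all add: that divide_ennreal_def)
    have i1: "{0..1} \<inter> {r. ennreal r < ennreal q} = {0..<q}"
      using q by (auto simp: ennreal_less_iff)
    have i2: "{0..1} \<inter> {r. \<not> ennreal r < ennreal q} = {q..1}"
      using q by (auto simp: ennreal_less_iff)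
    have 1: "emeasure U {r. ennreal r < ennreal q} = ennreal q"
      using q(2) by (subst em) (measurable, simp only: i1, simp)
    have 2: "emeasure U {r. \<not> ennreal r < ennreal q} = ennreal (1 - q)"
      using q(3) by (subst em) (measurable, simp only: i2, simp)
    show ?thesis
      using 1 2 q by (cases "s ! i") (auto simp: E_def digit_prob_def ennreal_minus ennreal_1[symmetric] simp del: ennreal_1)
  qed
  have meas: "(\<lambda>u n. random_digits p x u (Suc n) ! n) \<in> Pi\<^sub>M UNIV (\<lambda>_. U) \<rightarrow>\<^sub>M bit_sequences"
  proof -
    have "(\<lambda>u. (x, u)) \<in> Pi\<^sub>M UNIV (\<lambda>_. U) \<rightarrow>\<^sub>M count_space UNIV \<Otimes>\<^sub>M Pi\<^sub>M UNIV (\<lambda>_. U)" by simp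
    from measurable_compose[OF this[unfolded U_def] random_digits_nth_measurable[of p "count_space UNIV"]]
    show ?thesis by (simp add: U_def del: random_digits.simps)
  qed
  have digit: "random_digits p x u (length s) = s \<longleftrightarrow> (\<forall>i<length s. u i \<in> E i)" for u
  proof -
    have "random_digits p x u n = take n s \<longleftrightarrow> (\<forall>i<n. u i \<in> E i)" if "n \<le> length s" for n
      using that
    proof (induction n)
      case (Suc n)
      then have "take (Suc n) s = take n s @ [s ! n]" by (simp add: take_Suc_conv_app_nth)
      then show ?case using Suc by (auto simp: E_def less_Suc_eq)
    qed simp
    from this[of "length s"] show ?thesis by simp
  qed
  have cyl: "(\<lambda>n. random_digits p x u (Suc n) ! n) \<in> cylinder s \<longleftrightarrow> random_digits p x u (length s) = s" for u
  proof -
    have "random_digits p x u (Suc n) ! n = random_digits p x u (length s) ! n" if "n < length s" for n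
      using take_random_digits[of "Suc n" "length s" p x u] that by (metis Suc_leI lessI nth_take)
    then show ?thesis by (auto simp: cylinder_def list_eq_iff_nth_eq simp del: random_digits.simps)
  qed
  have "emeasure (digit_kernel p x) (cylinder s) =
      emeasure (Pi\<^sub>M UNIV (\<lambda>_. U)) {u\<in>space (Pi\<^sub>M UNIV (\<lambda>_. U)). \<forall>i<length s. u i \<in> E i}"
    unfolding digit_kernel_def U_def[symmetric]
    by (subst emeasure_distr[OF meas cylinder_measurable])
      (auto intro!: arg_cong[where f="emeasure _"] simp: cyl digit simp del: random_digits.simps)
  also have "{u\<in>space (Pi\<^sub>M UNIV (\<lambda>_. U)). \<forall>i<length s. u i \<in> E i}
      = prod_emb UNIV (\<lambda>_. U) {..<length s} (Pi\<^sub>E {..<length s} E)"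
    by (auto simp: prod_emb_def PiE_iff space_PiM)
  also have "emeasure (Pi\<^sub>M UNIV (\<lambda>_. U)) \<dots> = (\<Prod>i<length s. emeasure U (E i))"
    by (intro PU.emeasure_PiM_emb) auto
  finally show ?thesis by (simp add: UE)
qed

text \<open>Let \<open>C s\<close> be the first marginal of \<open>M\<close> restricted to sequences with prefix \<open>s\<close>. The derivative \<open>r s b\<close> of
\<open>C (s @ [b])\<close> with respect to \<open>C s\<close> is the conditional probability that the digit \<open>b\<close> comes next, and
\<open>r s True + r s False = 1\<close> almost everywhere for \<open>C s\<close>. By induction, \<open>C s\<close> has as density with respect
to the first marginal of \<open>M\<close> the product of the conditional probabilities along \<open>s\<close>, which is also the
mass that \<open>digit_kernel\<close> gives to the cylinder of \<open>s\<close>. Because the kernel is simulated digit by digit,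
it is countably additive for every \<open>x\<close>, not only for almost every one.\<close>

lemma disintegration_bit_sequences:
  fixes M :: "('x \<times> (nat \<Rightarrow> bool)) measure"
  assumes M: "prob_space M" "sets M = sets (A \<Otimes>\<^sub>M bit_sequences)"
  obtains \<kappa> where "\<kappa> \<in> A \<rightarrow>\<^sub>M prob_algebra bit_sequences"
    "\<And>E B. E \<in> sets A \<Longrightarrow> B \<in> sets bit_sequences \<Longrightarrow>
      emeasure M (E \<times> B) = (\<integral>\<^sup>+x. indicator E x * emeasure (\<kappa> x) B \<partial>distr M A fst)"
proof -
  interpret M: prob_space M by fact
  note [measurable_cong] = M(2)
  have spM: "space M = space A \<times> UNIV"
    using sets_eq_imp_space_eq[OF M(2)] by (simp add: space_pair_measure space_PiM)
  define \<mu> where "\<mu> = distr M A fst"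
  define C where "C s = distr (density M (\<lambda>q. indicator (cylinder s) (snd q))) A fst" for s
  have setsC[measurable_cong, simp]: "sets (C s) = sets A" for s by (simp add: C_def)
  have C: "emeasure (C s) E = emeasure M (E \<times> cylinder s)" if [measurable]: "E \<in> sets A" for s E
  proof -
    have "emeasure (C s) E = (\<integral>\<^sup>+q. indicator (cylinder s) (snd q) * indicator (fst -` E \<inter> space M) q \<partial>M)"
      unfolding C_def by (subst emeasure_distr) (auto simp: emeasure_density)
    also have "\<dots> = (\<integral>\<^sup>+q. indicator (E \<times> cylinder s) q \<partial>M)"
      using sets.sets_into_space[OF that] spM
      by (intro nn_integral_cong) (auto split: split_indicator)
    also have "\<dots> = emeasure M (E \<times> cylinder s)" by (intro nn_integral_indicator) measurable
    finally show ?thesis .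
  qed
  have spC: "space (C s) = space A" for s by (simp add: C_def)
  have finC: "finite_measure (C s)" for s
    by (rule finite_measureI) (simp add: spC C M.emeasure_eq_measure)
  have split: "emeasure (C s) E = emeasure (C (s @ [True])) E + emeasure (C (s @ [False])) E"
    if [measurable]: "E \<in> sets A" for s E
  proof -
    have "E \<times> cylinder s = E \<times> cylinder (s @ [True]) \<union> E \<times> cylinder (s @ [False])"
      by (auto simp: cylinder_snoc)
    moreover have "E \<times> cylinder (s @ [True]) \<inter> E \<times> cylinder (s @ [False]) = {}"
      by (auto simp: cylinder_snoc)
    ultimately show ?thesis
      by (simp add: C[OF that] plus_emeasure)
  qed
  define r where "r s b = RN_deriv (C s) (C (s @ [b]))" for s b
  have rm[measurable]: "r s b \<in> borel_measurable A" for s b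
    unfolding r_def using borel_measurable_RN_deriv[of "C s" "C (s @ [b])"] by simp
  have dens: "density (C s) (r s b) = C (s @ [b])" for s b
  proof -
    interpret finite_measure "C s" by (rule finC)
    show ?thesis
      unfolding r_def
    proof (rule density_RN_deriv)
      show "absolutely_continuous (C s) (C (s @ [b]))"
        unfolding absolutely_continuous_def
      proof
        fix E assume E: "E \<in> null_sets (C s)"
        then have "E \<in> sets A" by auto
        then show "E \<in> null_sets (C (s @ [b]))"
          using split[of E s] E by (cases b) (simp_all add: null_sets_def)
      qed
    qed simp
  qed
  have sum1: "AE x in C s. r s True x + r s False x = 1" for s
  proof -
    interpret finite_measure "C s" by (rule finC)
    have "density (C s) (\<lambda>x. r s True x + r s False x) = density (C s) (\<lambda>_. 1)"
    proof (rule measure_eqI)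
      fix E assume "E \<in> sets (density (C s) (\<lambda>x. r s True x + r s False x))"
      then have [measurable]: "E \<in> sets A" by simp
      have "emeasure (density (C s) (\<lambda>x. r s True x + r s False x)) E
          = emeasure (density (C s) (r s True)) E + emeasure (density (C s) (r s False)) E"
        by (simp add: emeasure_density nn_integral_add distrib_right)
      also have "\<dots> = emeasure (C s) E" unfolding dens using split[of E s] by simp
      finally show "emeasure (density (C s) (\<lambda>x. r s True x + r s False x)) E
          = emeasure (density (C s) (\<lambda>_. 1)) E" by (simp add: density_1)
    qed simp
    then show ?thesis by (subst (asm) density_unique_iff) auto
  qed
  \<comment> \<open>The derivative may exceed \<open>1\<close>, but only on a null set of \<open>C s\<close>.\<close>
  define p where "p s x = min 1 (r s True x)" for s x
  have pm[measurable]: "p s \<in> borel_measurable A" for s unfolding p_def by measurable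
  have p1: "p s x \<le> 1" for s x by (simp add: p_def)
  have dpm[measurable]: "digit_prob p s b \<in> borel_measurable A" for s b
    unfolding digit_prob_def by measurable
  have dens': "density (C s) (digit_prob p s b) = C (s @ [b])" for s b
  proof -
    have "AE x in C s. digit_prob p s b x = r s b x"
      using sum1[of s]
    proof eventually_elim
      case (elim x)
      have "r s True x \<le> r s True x + r s False x" by (rule add_increasing2) auto
      then have "r s True x \<le> 1" using elim by simp
      moreover have "1 - r s True x = r s False x"
      proof -
        have "r s True x \<noteq> top" using \<open>r s True x \<le> 1\<close> by (auto simp: top_unique)
        then show ?thesis unfolding elim[symmetric] by (rule ennreal_add_diff_cancel_left)
      qed
      ultimately show ?case by (cases b) (auto simp: digit_prob_def p_def min_absorb2)
    qed
    then have "density (C s) (digit_prob p s b) = density (C s) (r s b)"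
      by (intro density_cong) auto
    then show ?thesis by (simp add: dens)
  qed
  have C_eq: "C s = density \<mu> (\<lambda>x. \<Prod>i<length s. digit_prob p (take i s) (s ! i) x)" for s
  proof (induction s rule: rev_induct)
    case Nil
    have "C [] = \<mu>" unfolding C_def \<mu>_def by (simp add: density_1)
    then show ?case by (simp add: density_1)
  next
    case (snoc b s)
    have [measurable_cong]: "sets \<mu> = sets A" by (simp add: \<mu>_def)
    have "C (s @ [b]) = density (C s) (digit_prob p s b)" by (simp add: dens')
    also have "\<dots> = density \<mu> (\<lambda>x. (\<Prod>i<length s. digit_prob p (take i s) (s ! i) x) * digit_prob p s b x)"
      unfolding snoc.IH by (intro density_density_eq) measurable
    also have "(\<lambda>x. (\<Prod>i<length s. digit_prob p (take i s) (s ! i) x) * digit_prob p s b x)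
        = (\<lambda>x. \<Prod>i<length (s @ [b]). digit_prob p (take i (s @ [b])) ((s @ [b]) ! i) x)"
      by (simp add: nth_append)
    finally show ?case .
  qed
  define \<kappa> where "\<kappa> = digit_kernel p"
  have \<kappa>: "\<kappa> \<in> A \<rightarrow>\<^sub>M prob_algebra bit_sequences"
    unfolding \<kappa>_def by (intro digit_kernel_measurable) simp
  note \<kappa>s[measurable] = measurable_prob_algebraD[OF \<kappa>]
  show ?thesis
  proof (rule that[OF \<kappa>])
    fix E B assume [measurable]: "E \<in> sets A" "B \<in> sets bit_sequences"
    define M1 where "M1 = distr (density M (\<lambda>q. indicator E (fst q))) bit_sequences snd"
    define M2 where "M2 = density \<mu> (indicator E) \<bind> \<kappa>"
    have [measurable_cong]: "sets \<mu> = sets A" by (simp add: \<mu>_def)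
    have ne: "space A \<noteq> {}" using M.not_empty spM by auto
    have M2: "emeasure M2 F = (\<integral>\<^sup>+x. indicator E x * emeasure (\<kappa> x) F \<partial>\<mu>)"
      if [measurable]: "F \<in> sets bit_sequences" for F
    proof -
      have "emeasure M2 F = (\<integral>\<^sup>+x. emeasure (\<kappa> x) F \<partial>density \<mu> (indicator E))"
        unfolding M2_def by (rule emeasure_bind[where N=bit_sequences]) (use ne in \<open>auto simp: \<mu>_def\<close>)
      then show ?thesis by (simp add: nn_integral_density)
    qed
    have M1: "emeasure M1 F = emeasure M (E \<times> F)" if [measurable]: "F \<in> sets bit_sequences" for F
    proof -
      have "emeasure M1 F = (\<integral>\<^sup>+q. indicator E (fst q) * indicator (snd -` F \<inter> space M) q \<partial>M)"
        unfolding M1_def by (subst emeasure_distr) (auto simp: emeasure_density)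
      also have "\<dots> = (\<integral>\<^sup>+q. indicator (E \<times> F) q \<partial>M)"
        by (intro nn_integral_cong) (auto split: split_indicator)
      also have "\<dots> = emeasure M (E \<times> F)" by (intro nn_integral_indicator) measurable
      finally show ?thesis .
    qed
    have "M1 = M2"
    proof (rule measure_eqI_cylinder)
      show "sets M1 = sets bit_sequences" by (simp add: M1_def)
      show "sets M2 = sets bit_sequences"
        unfolding M2_def using ne subprob_measurableD(2)[OF \<kappa>s] by (intro sets_bind) (auto simp: \<mu>_def)
      have "space M1 = UNIV" by (simp add: M1_def space_PiM)
      then show "finite_measure M1"
        by (intro finite_measureI) (simp add: M1[of UNIV, unfolded] M.emeasure_eq_measure
            sets.top[of bit_sequences, unfolded space_PiM, simplified])
      fix s
      have "emeasure M1 (cylinder s) = emeasure (C s) E" by (simp add: M1 C)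
      also have "\<dots> = (\<integral>\<^sup>+x. indicator E x * emeasure (\<kappa> x) (cylinder s) \<partial>\<mu>)"
        unfolding C_eq \<kappa>_def using p1
        by (subst emeasure_density) (auto simp: emeasure_digit_kernel_cylinder mult.commute)
      also have "\<dots> = emeasure M2 (cylinder s)" by (simp add: M2)
      finally show "emeasure M1 (cylinder s) = emeasure M2 (cylinder s)" .
    qed
    then show "emeasure M (E \<times> B) = (\<integral>\<^sup>+x. indicator E x * emeasure (\<kappa> x) B \<partial>distr M A fst)"
      using M1[of B] M2[of B] by (simp add: \<mu>_def)
  qed
qed

text \<open>The measure is encoded in bit sequences by \<open>\<phi>\<close>, disintegrated there, and the kernel is carried back
by the left inverse \<open>g\<close> of \<open>\<phi>\<close>.\<close>

theorem disintegration:
  fixes \<gamma> :: "('x::second_countable_topology \<times> 'y::polish_space) measure"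
  assumes \<gamma>: "\<gamma> \<in> borel_probs"
  obtains \<nu> where "measurable_family \<nu>" "\<gamma> = distr \<gamma> borel fst \<bind> (\<lambda>x. return borel x \<Otimes>\<^sub>M \<nu> x)"
proof -
  interpret \<gamma>: prob_space \<gamma> using \<gamma> by (simp add: borel_probs_def)
  have s\<gamma>: "sets \<gamma> = sets (borel \<Otimes>\<^sub>M borel)" unfolding borel_prod using \<gamma> by (simp add: borel_probs_def)
  note [measurable_cong] = s\<gamma>
  obtain \<phi> :: "'y \<Rightarrow> nat \<Rightarrow> bool" and g where [measurable]: "\<phi> \<in> borel \<rightarrow>\<^sub>M bit_sequences" "g \<in> bit_sequences \<rightarrow>\<^sub>M borel"
    and g: "\<And>y. g (\<phi> y) = y"
    using polish_bit_sequences_retract by blast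
  define M where "M = distr \<gamma> (borel \<Otimes>\<^sub>M bit_sequences) (\<lambda>q. (fst q, \<phi> (snd q)))"
  have M: "prob_space M" unfolding M_def by (intro \<gamma>.prob_space_distr) measurable
  have sM: "sets M = sets (borel \<Otimes>\<^sub>M bit_sequences)" by (simp add: M_def)
  obtain \<kappa> where \<kappa>: "\<kappa> \<in> borel \<rightarrow>\<^sub>M prob_algebra bit_sequences"
    and eq: "\<And>E B. E \<in> sets borel \<Longrightarrow> B \<in> sets bit_sequences \<Longrightarrow>
      emeasure M (E \<times> B) = (\<integral>\<^sup>+x. indicator E x * emeasure (\<kappa> x) B \<partial>distr M borel fst)"
    by (rule disintegration_bit_sequences[OF M sM], rule that)
  define \<nu> where "\<nu> x = distr (\<kappa> x) borel g" for x
  have \<nu>: "\<nu> \<in> borel \<rightarrow>\<^sub>M prob_algebra borel"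
    unfolding \<nu>_def by (intro measurable_compose[OF \<kappa> measurable_distr_prob_space]) simp
  note \<kappa>s = measurable_prob_algebraD[OF \<kappa>] and \<nu>s[measurable] = measurable_prob_algebraD[OF \<nu>]
  have pair: "(\<lambda>x. return borel x \<Otimes>\<^sub>M \<nu> x) \<in> borel \<rightarrow>\<^sub>M subprob_algebra (borel \<Otimes>\<^sub>M borel)"
    by (intro measurable_pair_measure) simp_all
  define \<mu> where "\<mu> = distr \<gamma> borel fst"
  have \<mu>: "prob_space \<mu>" unfolding \<mu>_def by (intro \<gamma>.prob_space_distr) measurable
  have M\<mu>: "distr M borel fst = \<mu>" unfolding M_def \<mu>_def by (subst distr_distr) (auto simp: comp_def)
  have "\<gamma> = \<mu> \<bind> (\<lambda>x. return borel x \<Otimes>\<^sub>M \<nu> x)"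
  proof (rule measure_eqI_generator_eq[OF Int_stable_pair_measure_generator[of borel borel]])
    show "{a \<times> b |a b. a \<in> sets borel \<and> b \<in> sets borel} \<subseteq> Pow (UNIV :: ('x \<times> 'y) set)" by simp
    show "sets \<gamma> = sigma_sets UNIV {a \<times> b |a b. a \<in> sets borel \<and> b \<in> sets borel}"
      by (simp add: s\<gamma> sets_pair_measure)
    have "sets (\<mu> \<bind> (\<lambda>x. return borel x \<Otimes>\<^sub>M \<nu> x)) = sets (borel \<Otimes>\<^sub>M borel)"
      using subprob_measurableD(2)[OF pair] by (intro sets_bind) (auto simp: \<mu>_def)
    then show "sets (\<mu> \<bind> (\<lambda>x. return borel x \<Otimes>\<^sub>M \<nu> x)) =
        sigma_sets UNIV {a \<times> b |a b. a \<in> sets borel \<and> b \<in> sets borel}"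
      by (simp add: sets_pair_measure)
    show "range (\<lambda>_::nat. UNIV) \<subseteq> {a \<times> b |a b. a \<in> sets borel \<and> b \<in> sets borel}"
      by (auto intro!: exI[of _ UNIV])
    fix Z :: "('x \<times> 'y) set" assume "Z \<in> {a \<times> b |a b. a \<in> sets borel \<and> b \<in> sets borel}"
    then obtain E B where Z: "Z = E \<times> B" and [measurable]: "E \<in> sets borel" "B \<in> sets borel" by blast
    have Zm: "E \<times> (g -` B \<inter> space bit_sequences) \<in> sets (borel \<Otimes>\<^sub>M bit_sequences)"
      by (intro pair_measureI measurable_sets[where A=bit_sequences and M=borel]) simp_all
    have "emeasure \<gamma> Z = emeasure M (E \<times> (g -` B \<inter> space bit_sequences))"
      unfolding M_def using Zm by (subst emeasure_distr)
        (auto simp: Z g space_PiM s\<gamma>[THEN sets_eq_imp_space_eq] space_pair_measure intro!: arg_cong[where f="emeasure \<gamma>"])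
    also have "\<dots> = (\<integral>\<^sup>+x. indicator E x * emeasure (\<kappa> x) (g -` B \<inter> space bit_sequences) \<partial>\<mu>)"
      by (subst eq) (auto simp: M\<mu>)
    also have "\<dots> = (\<integral>\<^sup>+x. emeasure (return borel x \<Otimes>\<^sub>M \<nu> x) Z \<partial>\<mu>)"
    proof (intro nn_integral_cong)
      fix x
      interpret \<nu>: subprob_space "\<nu> x" using subprob_space_kernel[OF \<nu>s] by simp
      have "sets (\<nu> x) = sets borel" using subprob_measurableD(2)[OF \<nu>s] by simp
      then have "emeasure (return borel x \<Otimes>\<^sub>M \<nu> x) Z = indicator E x * emeasure (\<nu> x) B"
        unfolding Z by (subst \<nu>.emeasure_pair_measure_Times) auto
      also have "emeasure (\<nu> x) B = emeasure (\<kappa> x) (g -` B \<inter> space bit_sequences)"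
        unfolding \<nu>_def using subprob_measurableD[OF \<kappa>s, of x]
        by (subst emeasure_distr) auto
      finally show "indicator E x * emeasure (\<kappa> x) (g -` B \<inter> space bit_sequences)
          = emeasure (return borel x \<Otimes>\<^sub>M \<nu> x) Z" by simp
    qed
    also have "\<dots> = emeasure (\<mu> \<bind> (\<lambda>x. return borel x \<Otimes>\<^sub>M \<nu> x)) Z"
      by (rule emeasure_bind[symmetric, where N="borel \<Otimes>\<^sub>M borel"]) (auto simp: \<mu>_def Z pair)
    finally show "emeasure \<gamma> Z = emeasure (\<mu> \<bind> (\<lambda>x. return borel x \<Otimes>\<^sub>M \<nu> x)) Z" .
  qed (auto simp: \<gamma>.emeasure_eq_measure)
  then show ?thesis
    using that \<nu> by (auto simp: measurable_family_iff \<mu>_def)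
qed

section \<open>The expected energy of open-loop measures\<close>

lemma average_const_ennreal:
  fixes a :: ennreal
  shows "0 < N \<Longrightarrow> (\<Sum>i<N. a) / of_nat N = a"
  by (simp add: mult.commute[of "of_nat N"] mult_divide_eq_ennreal of_nat_less_top)

lemma nn_integral_average:
  assumes sets: "\<And>i. i < N \<Longrightarrow> sets (K i) = sets M"
    and em: "\<And>A. A \<in> sets M \<Longrightarrow> emeasure M A = (\<Sum>i<N. emeasure (K i) A) / of_nat N"
    and h: "h \<in> borel_measurable M"
  shows "(\<integral>\<^sup>+x. h x \<partial>M) = (\<Sum>i<N. \<integral>\<^sup>+x. h x \<partial>K i) / of_nat N"
  using h
proof (induction rule: borel_measurable_induct)
  have m: "u \<in> borel_measurable (K i) \<longleftrightarrow> u \<in> borel_measurable M" if "i < N" for u :: "'a \<Rightarrow> ennreal" and i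
    by (simp add: measurable_cong_sets[OF sets[OF that] refl])
  have sp: "space (K i) = space M" if "i < N" for i
    by (rule sets_eq_imp_space_eq[OF sets[OF that]])
  {
    case (cong f g)
    have "(\<integral>\<^sup>+x. f x \<partial>K i) = (\<integral>\<^sup>+x. g x \<partial>K i)" if "i < N" for i
      using cong by (intro nn_integral_cong) (auto simp: sp[OF that])
    moreover have "(\<integral>\<^sup>+x. f x \<partial>M) = (\<integral>\<^sup>+x. g x \<partial>M)"
      using cong by (intro nn_integral_cong) auto
    ultimately show ?case using cong by simp
  next
    case (set A)
    then show ?case by (simp add: em sets)
  next
    case (mult u c)
    then show ?case by (simp add: nn_integral_cmult m sum_distrib_left[symmetric] ennreal_times_divide)
  next
    case (add u v)
    then show ?case by (simp add: nn_integral_add m sum.distrib add_divide_distrib_ennreal)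
  next
    case (seq U)
    have inc: "incseq (\<lambda>k. \<integral>\<^sup>+x. U k x \<partial>K i)" for i
      using seq by (auto simp: incseq_def le_fun_def intro!: nn_integral_mono)
    have "(\<integral>\<^sup>+x. (SUP k. U k x) \<partial>M) = (SUP k. \<integral>\<^sup>+x. U k x \<partial>M)"
      using seq by (intro nn_integral_monotone_convergence_SUP) auto
    also have "\<dots> = (SUP k. \<Sum>i<N. \<integral>\<^sup>+x. U k x \<partial>K i) / of_nat N"
      by (simp add: seq SUP_divide_ennreal)
    also have "(SUP k. \<Sum>i<N. \<integral>\<^sup>+x. U k x \<partial>K i) = (\<Sum>i<N. SUP k. \<integral>\<^sup>+x. U k x \<partial>K i)"
      by (intro ennreal_SUP_sum inc)
    also have "\<dots> = (\<Sum>i<N. \<integral>\<^sup>+x. (SUP k. U k x) \<partial>K i)"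
      using seq by (intro sum.cong refl nn_integral_monotone_convergence_SUP[symmetric]) (auto simp: m)
    finally show ?case by (simp add: SUP_apply[abs_def])
  }
qed

lemma nn_integral_return_pair:
  fixes N :: "'y::second_countable_topology measure" and x :: "'x::second_countable_topology"
  assumes N: "prob_space N" "sets N = sets borel" and h: "h \<in> borel_measurable borel"
  shows "(\<integral>\<^sup>+p. h p \<partial>(return borel x \<Otimes>\<^sub>M N)) = (\<integral>\<^sup>+y. h (x, y) \<partial>N)"
proof -
  interpret prob_space N by (rule N)
  note [measurable_cong] = N(2)
  have h'[measurable]: "h \<in> borel_measurable (borel \<Otimes>\<^sub>M borel)" unfolding borel_prod by (rule h)
  have "(\<integral>\<^sup>+p. h p \<partial>(return borel x \<Otimes>\<^sub>M N)) = (\<integral>\<^sup>+x. \<integral>\<^sup>+y. h (x, y) \<partial>N \<partial>return borel x)"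
    by (intro nn_integral_fst[symmetric])
      (simp add: measurable_cong_sets[OF sets_pair_measure_cong[OF sets_return N(2)] refl])
  also have "\<dots> = (\<integral>\<^sup>+y. h (x, y) \<partial>N)"
    by (intro nn_integral_return) (simp, measurable)
  finally show ?thesis .
qed

text \<open>For the average \<open>M\<close> of the measures \<open>n i\<close>, the product \<open>M \<otimes> M\<close> is the average of all \<open>N\<^sup>2\<close> products
\<open>n i \<otimes> n j\<close>. Each of the \<open>N\<close> diagonal ones contributes at most \<open>K\<close> to the truncated integral.\<close>

lemma nn_integral_pair_average_truncated_le:
  fixes H :: "'y::second_countable_topology \<times> 'y \<Rightarrow> ennreal"
  assumes n: "\<And>i. i < N \<Longrightarrow> prob_space (n i)" "\<And>i. i < N \<Longrightarrow> sets (n i) = sets borel"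
    and M: "prob_space M" "sets M = sets borel"
    and em: "\<And>B. B \<in> sets borel \<Longrightarrow> emeasure M B = (\<Sum>i<N. emeasure (n i) B) / of_nat N"
    and H[measurable]: "H \<in> borel_measurable borel" and N: "0 < N"
  shows "(\<integral>\<^sup>+p. min (H p) (of_nat K) \<partial>(M \<Otimes>\<^sub>M M)) \<le>
    (\<Sum>i<N. \<Sum>j\<in>{..<N} - {i}. H_energy H (n i) (n j)) / (of_nat N)\<^sup>2 + of_nat K / of_nat N"
proof -
  define F where "F p = min (H p) (of_nat K)" for p
  have Fm[measurable]: "F \<in> borel_measurable (borel \<Otimes>\<^sub>M borel)"
    unfolding F_def borel_prod by measurable
  have H'[measurable]: "H \<in> borel_measurable (borel \<Otimes>\<^sub>M borel)" unfolding borel_prod by (rule H)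
  have pm: "f \<in> borel_measurable (A \<Otimes>\<^sub>M B)" if "f \<in> borel_measurable (borel \<Otimes>\<^sub>M borel)"
    "sets A = sets borel" "sets B = sets borel" for f :: "'y \<times> 'y \<Rightarrow> ennreal" and A B
    using that by (simp add: measurable_cong_sets[OF sets_pair_measure_cong[OF that(2,3)] refl])
  interpret M: prob_space M by fact
  have avg: "(\<integral>\<^sup>+y. f y \<partial>M) = (\<Sum>i<N. \<integral>\<^sup>+y. f y \<partial>n i) / of_nat N" if "f \<in> borel_measurable borel" for f
    using that em n(2) M(2) by (intro nn_integral_average) (auto simp: measurable_cong_sets[OF M(2) refl])
  have inner: "(\<lambda>y. \<integral>\<^sup>+y'. F (y, y') \<partial>A) \<in> borel_measurable borel"
    if A: "prob_space A" "sets A = sets borel" for A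
  proof -
    interpret prob_space A by fact
    note [measurable_cong] = A(2)
    show ?thesis by measurable
  qed
  have pair: "(\<integral>\<^sup>+y. \<integral>\<^sup>+y'. F (y, y') \<partial>B \<partial>A) = (\<integral>\<^sup>+p. F p \<partial>(A \<Otimes>\<^sub>M B))"
    if "prob_space B" "sets A = sets borel" "sets B = sets borel" for A B
  proof -
    interpret prob_space B by fact
    show ?thesis by (rule nn_integral_fst) (rule pm[OF Fm that(2,3)])
  qed
  have bound: "(\<integral>\<^sup>+p. F p \<partial>(n i \<Otimes>\<^sub>M n j)) \<le> (if i = j then of_nat K else H_energy H (n i) (n j))"
    if ij: "i < N" "j < N" for i j
  proof (cases "i = j")
    case True
    interpret prob_space "n i \<Otimes>\<^sub>M n j" using n ij by (intro prob_space_pair) auto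
    have "(\<integral>\<^sup>+p. F p \<partial>(n i \<Otimes>\<^sub>M n j)) \<le> (\<integral>\<^sup>+p. of_nat K \<partial>(n i \<Otimes>\<^sub>M n j))"
      by (intro nn_integral_mono) (simp add: F_def)
    also have "\<dots> = of_nat K" by (simp add: emeasure_space_1)
    finally show ?thesis using True by simp
  next
    case False
    then show ?thesis unfolding H_energy_def F_def by (auto intro!: nn_integral_mono)
  qed
  have "(\<integral>\<^sup>+p. F p \<partial>(M \<Otimes>\<^sub>M M)) = (\<integral>\<^sup>+y. \<integral>\<^sup>+y'. F (y, y') \<partial>M \<partial>M)"
    by (rule pair[symmetric, OF M M(2)])
  also have "\<dots> = (\<integral>\<^sup>+y. (\<Sum>j<N. \<integral>\<^sup>+y'. F (y, y') \<partial>n j) / of_nat N \<partial>M)"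
    by (intro nn_integral_cong avg) measurable
  also have "\<dots> = (\<Sum>i<N. \<integral>\<^sup>+y. (\<Sum>j<N. \<integral>\<^sup>+y'. F (y, y') \<partial>n j) / of_nat N \<partial>n i) / of_nat N"
    by (intro avg borel_measurable_divide_ennreal borel_measurable_sum inner n) auto
  also have "\<dots> = (\<Sum>i<N. (\<Sum>j<N. \<integral>\<^sup>+p. F p \<partial>(n i \<Otimes>\<^sub>M n j)) / of_nat N) / of_nat N"
  proof (intro arg_cong[where f="\<lambda>x. x / of_nat N"] sum.cong refl)
    fix i assume i: "i \<in> {..<N}"
    have im: "(\<lambda>y. \<integral>\<^sup>+y'. F (y, y') \<partial>n j) \<in> borel_measurable (n i)" if "j < N" for j
      using inner[OF n[OF that]] i by (simp add: measurable_cong_sets[OF n(2) refl])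
    show "(\<integral>\<^sup>+y. (\<Sum>j<N. \<integral>\<^sup>+y'. F (y, y') \<partial>n j) / of_nat N \<partial>n i)
        = (\<Sum>j<N. \<integral>\<^sup>+p. F p \<partial>(n i \<Otimes>\<^sub>M n j)) / of_nat N"
    proof -
      have im': "(\<lambda>y. \<integral>\<^sup>+y'. F (y, y') \<partial>n j) \<in> borel_measurable (n i)" if "j \<in> {..<N}" for j
        using im that by simp
      have "(\<integral>\<^sup>+y. (\<Sum>j<N. \<integral>\<^sup>+y'. F (y, y') \<partial>n j) / of_nat N \<partial>n i)
          = (\<integral>\<^sup>+y. (\<Sum>j<N. \<integral>\<^sup>+y'. F (y, y') \<partial>n j) \<partial>n i) / of_nat N"
        by (rule nn_integral_divide) (rule borel_measurable_sum[OF im'])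
      also have "(\<integral>\<^sup>+y. (\<Sum>j<N. \<integral>\<^sup>+y'. F (y, y') \<partial>n j) \<partial>n i)
          = (\<Sum>j<N. \<integral>\<^sup>+y. \<integral>\<^sup>+y'. F (y, y') \<partial>n j \<partial>n i)"
        by (rule nn_integral_sum[OF im'])
      also have "\<dots> = (\<Sum>j<N. \<integral>\<^sup>+p. F p \<partial>(n i \<Otimes>\<^sub>M n j))"
        using i n by (intro sum.cong refl pair) auto
      finally show ?thesis .
    qed
  qed
  also have "\<dots> = (\<Sum>i<N. \<Sum>j<N. \<integral>\<^sup>+p. F p \<partial>(n i \<Otimes>\<^sub>M n j)) / (of_nat N)\<^sup>2"
    using N by (simp add: divide_ennreal_def sum_distrib_right[symmetric] power2_eq_square
      ennreal_inverse_mult mult.assoc of_nat_less_top)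
  also have "\<dots> \<le> (\<Sum>i<N. \<Sum>j<N. if i = j then of_nat K else H_energy H (n i) (n j)) / (of_nat N)\<^sup>2"
    by (intro divide_right_mono_ennreal sum_mono bound) auto
  also have "(\<Sum>i<N. \<Sum>j<N. if i = j then of_nat K else H_energy H (n i) (n j))
      = (\<Sum>i<N. of_nat K + (\<Sum>j\<in>{..<N} - {i}. H_energy H (n i) (n j)))"
  proof (intro sum.cong refl)
    fix i assume i: "i \<in> {..<N}"
    have "(\<Sum>j<N. if i = j then of_nat K else H_energy H (n i) (n j))
        = of_nat K + (\<Sum>j\<in>{..<N} - {i}. if i = j then of_nat K else H_energy H (n i) (n j))"
      using sum.remove[OF _ i, of "\<lambda>j. if i = j then of_nat K else H_energy H (n i) (n j)"] by simp
    also have "(\<Sum>j\<in>{..<N} - {i}. if i = j then of_nat K else H_energy H (n i) (n j))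
        = (\<Sum>j\<in>{..<N} - {i}. H_energy H (n i) (n j))"
      by (intro sum.cong) auto
    finally show "(\<Sum>j<N. if i = j then of_nat K else H_energy H (n i) (n j))
        = of_nat K + (\<Sum>j\<in>{..<N} - {i}. H_energy H (n i) (n j))" .
  qed
  also have "\<dots> = of_nat N * of_nat K + (\<Sum>i<N. \<Sum>j\<in>{..<N} - {i}. H_energy H (n i) (n j))"
    by (simp add: sum.distrib)
  also have "(of_nat N * of_nat K + (\<Sum>i<N. \<Sum>j\<in>{..<N} - {i}. H_energy H (n i) (n j))) / (of_nat N)\<^sup>2
      = (\<Sum>i<N. \<Sum>j\<in>{..<N} - {i}. H_energy H (n i) (n j)) / (of_nat N)\<^sup>2 + of_nat K / of_nat N"
    using N divide_mult_eq[of "of_nat N" "of_nat K" "of_nat N"]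
    by (simp add: add_divide_distrib_ennreal power2_eq_square add.commute mult.commute of_nat_less_top)
  finally show ?thesis by (simp add: F_def)
qed

text \<open>Both sides integrate \<open>H(y, y')\<close> over \<open>y\<close> drawn from \<open>\<nu> x\<close> and \<open>y'\<close> drawn from \<open>\<nu>' x'\<close>, with \<open>x\<close> and \<open>x'\<close>
independent of law \<open>\<mu>\<close>; they differ in the order of integration.\<close>

lemma H_energy_bind:
  fixes \<nu> \<nu>' :: "'x \<Rightarrow> 'y::second_countable_topology measure"
  assumes \<mu>: "prob_space \<mu>" and \<nu>: "\<nu> \<in> \<mu> \<rightarrow>\<^sub>M prob_algebra borel" and \<nu>': "\<nu>' \<in> \<mu> \<rightarrow>\<^sub>M prob_algebra borel"
    and H: "H \<in> borel_measurable borel"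
  shows "(\<integral>\<^sup>+p. H_energy H (\<nu> (fst p)) (\<nu>' (snd p)) \<partial>(\<mu> \<Otimes>\<^sub>M \<mu>)) = H_energy H (\<mu> \<bind> \<nu>) (\<mu> \<bind> \<nu>')"
    and "(\<lambda>p. H_energy H (\<nu> (fst p)) (\<nu>' (snd p))) \<in> borel_measurable (\<mu> \<Otimes>\<^sub>M \<mu>)"
proof -
  interpret \<mu>: prob_space \<mu> by fact
  have H'[measurable]: "H \<in> borel_measurable (borel \<Otimes>\<^sub>M borel)" unfolding borel_prod by (rule H)
  note \<nu>s[measurable] = measurable_prob_algebraD[OF \<nu>] and \<nu>s'[measurable] = measurable_prob_algebraD[OF \<nu>']
  have kp: "prob_space (\<nu> x)" "sets (\<nu> x) = sets borel" "prob_space (\<nu>' x)" "sets (\<nu>' x) = sets borel"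
    if "x \<in> space \<mu>" for x
    using measurable_space[OF \<nu> that] measurable_space[OF \<nu>' that] by (auto simp: space_prob_algebra)
  have bp: "prob_space (\<mu> \<bind> \<nu>')" "sets (\<mu> \<bind> \<nu>') = sets borel" "sets (\<mu> \<bind> \<nu>) = sets borel"
    using kp \<mu>.not_empty by (auto intro!: \<mu>.prob_space_bind[where S=borel] sets_bind simp: \<nu>s')
  show meas: "(\<lambda>p. H_energy H (\<nu> (fst p)) (\<nu>' (snd p))) \<in> borel_measurable (\<mu> \<Otimes>\<^sub>M \<mu>)"
  proof -
    have "(\<lambda>p. \<nu> (fst p) \<Otimes>\<^sub>M \<nu>' (snd p)) \<in> \<mu> \<Otimes>\<^sub>M \<mu> \<rightarrow>\<^sub>M subprob_algebra (borel \<Otimes>\<^sub>M borel)"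
      by (intro measurable_pair_measure) measurable
    then show ?thesis
      unfolding H_energy_def by (rule measurable_compose[OF _ nn_integral_measurable_subprob_algebra[OF H']])
  qed
  have in': "(\<lambda>q. \<integral>\<^sup>+y'. H (fst q, y') \<partial>\<nu>' (snd q)) \<in> borel_measurable (borel \<Otimes>\<^sub>M \<mu>)"
    by (rule nn_integral_measurable_subprob_algebra2[where N=borel]) measurable
  have split: "H_energy H A B = (\<integral>\<^sup>+y. \<integral>\<^sup>+y'. H (y, y') \<partial>B \<partial>A)"
    if "prob_space B" "sets A = sets borel" "sets B = sets borel" for A B :: "'y measure"
  proof -
    interpret prob_space B by fact
    show ?thesis unfolding H_energy_def
      by (intro nn_integral_fst[symmetric])
       (simp add: measurable_cong_sets[OF sets_pair_measure_cong[OF that(2,3)] refl])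
  qed
  have "H_energy H (\<mu> \<bind> \<nu>) (\<mu> \<bind> \<nu>') = (\<integral>\<^sup>+y. \<integral>\<^sup>+y'. H (y, y') \<partial>(\<mu> \<bind> \<nu>') \<partial>(\<mu> \<bind> \<nu>))"
    by (intro split bp)
  also have "\<dots> = (\<integral>\<^sup>+y. \<integral>\<^sup>+x'. \<integral>\<^sup>+y'. H (y, y') \<partial>\<nu>' x' \<partial>\<mu> \<partial>(\<mu> \<bind> \<nu>))"
    by (intro nn_integral_cong nn_integral_bind[OF _ \<nu>s']) measurable
  also have "\<dots> = (\<integral>\<^sup>+x. \<integral>\<^sup>+y. \<integral>\<^sup>+x'. \<integral>\<^sup>+y'. H (y, y') \<partial>\<nu>' x' \<partial>\<mu> \<partial>\<nu> x \<partial>\<mu>)"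
    using \<mu>.borel_measurable_nn_integral_fst[OF in']
    by (intro nn_integral_bind[OF _ \<nu>s]) simp
  also have "\<dots> = (\<integral>\<^sup>+x. \<integral>\<^sup>+x'. H_energy H (\<nu> x) (\<nu>' x') \<partial>\<mu> \<partial>\<mu>)"
  proof (intro nn_integral_cong)
    fix x assume x: "x \<in> space \<mu>"
    interpret \<nu>: prob_space "\<nu> x" by (rule kp[OF x])
    interpret pair_sigma_finite \<mu> "\<nu> x" ..
    have "(\<integral>\<^sup>+y. \<integral>\<^sup>+x'. \<integral>\<^sup>+y'. H (y, y') \<partial>\<nu>' x' \<partial>\<mu> \<partial>\<nu> x)
        = (\<integral>\<^sup>+x'. \<integral>\<^sup>+y. \<integral>\<^sup>+y'. H (y, y') \<partial>\<nu>' x' \<partial>\<nu> x \<partial>\<mu>)"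
    proof (rule Fubini')
      have "(\<lambda>q. (snd q, fst q)) \<in> \<mu> \<Otimes>\<^sub>M \<nu> x \<rightarrow>\<^sub>M borel \<Otimes>\<^sub>M \<mu>"
        using kp[OF x] by (intro measurable_Pair) (simp_all add: measurable_cong_sets[OF refl kp(2)[OF x, symmetric]])
      from measurable_compose[OF this in']
      show "(\<lambda>(x', y). \<integral>\<^sup>+y'. H (y, y') \<partial>\<nu>' x') \<in> borel_measurable (\<mu> \<Otimes>\<^sub>M \<nu> x)"
        by (simp add: split_beta')
    qed
    also have "\<dots> = (\<integral>\<^sup>+x'. H_energy H (\<nu> x) (\<nu>' x') \<partial>\<mu>)"
      using kp x by (intro nn_integral_cong split[symmetric]) auto
    finally show "(\<integral>\<^sup>+y. \<integral>\<^sup>+x'. \<integral>\<^sup>+y'. H (y, y') \<partial>\<nu>' x' \<partial>\<mu> \<partial>\<nu> x)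
        = (\<integral>\<^sup>+x'. H_energy H (\<nu> x) (\<nu>' x') \<partial>\<mu>)" .
  qed
  also have "\<dots> = (\<integral>\<^sup>+p. H_energy H (\<nu> (fst p)) (\<nu>' (snd p)) \<partial>(\<mu> \<Otimes>\<^sub>M \<mu>))"
    using \<mu>.nn_integral_fst[OF meas] by simp
  finally show "(\<integral>\<^sup>+p. H_energy H (\<nu> (fst p)) (\<nu>' (snd p)) \<partial>(\<mu> \<Otimes>\<^sub>M \<mu>)) = H_energy H (\<mu> \<bind> \<nu>) (\<mu> \<bind> \<nu>')" ..
qed

lemma atomless_singleton:
  assumes "atomless \<mu>" "{x} \<in> sets \<mu>"
  shows "emeasure \<mu> {x} = 0"
proof (rule ccontr)
  assume "emeasure \<mu> {x} \<noteq> 0"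
  then have "0 < emeasure \<mu> {x}" by (simp add: zero_less_iff_neq_zero)
  then obtain B where B: "B \<subseteq> {x}" "0 < emeasure \<mu> B" "emeasure \<mu> B < emeasure \<mu> {x}"
    using assms unfolding atomless_def by blast
  then have "B = {} \<or> B = {x}" by blast
  then show False using B by auto
qed

locale iid_sampling = prob_space P
  for P :: "'w measure" and \<mu> :: "'x::polish_space measure" and X :: "nat \<Rightarrow> 'w \<Rightarrow> 'x" +
  assumes iid: "iid_sample P \<mu> X"
begin

lemma indep_X: "indep_vars (\<lambda>_. borel) X UNIV"
  using iid by (simp add: iid_sample_def)

lemma X_measurable [measurable]: "X i \<in> borel_measurable P"
  using indep_X by (auto simp: indep_vars_def)

lemma distr_X: "distr P borel (X i) = \<mu>"
  using iid by (simp add: iid_sample_def)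

lemma sets_\<mu> [measurable_cong, simp]: "sets \<mu> = sets borel"
  using distr_X[of 0] by auto

lemma space_\<mu> [simp]: "space \<mu> = UNIV"
  using sets_eq_imp_space_eq[OF sets_\<mu>] by simp

lemma prob_space_\<mu>: "prob_space \<mu>"
  unfolding distr_X[of 0, symmetric] by (intro prob_space_distr) simp

lemma distr_X_pair:
  assumes "i \<noteq> j"
  shows "distr P (borel \<Otimes>\<^sub>M borel) (\<lambda>\<omega>. (X i \<omega>, X j \<omega>)) = \<mu> \<Otimes>\<^sub>M \<mu>"
proof -
  have "indep_var borel ((\<lambda>f. f i) \<circ> (\<lambda>\<omega>. restrict (\<lambda>k. X k \<omega>) {i})) borel ((\<lambda>f. f j) \<circ> (\<lambda>\<omega>. restrict (\<lambda>k. X k \<omega>) {j}))"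
    using assms by (intro indep_var_compose[OF indep_var_restrict[OF indep_X]]) auto
  then have "indep_var borel (X i) borel (X j)" by (simp add: comp_def)
  then show ?thesis by (simp add: indep_var_distribution_eq distr_X)
qed

text \<open>Two independent samples coincide with probability \<open>\<integral>\<mu>{x} d\<mu>(x)\<close>, which vanishes without atoms.\<close>

lemma AE_samples_distinct:
  assumes "atomless \<mu>"
  shows "AE \<omega> in P. \<forall>i j. i \<noteq> j \<longrightarrow> X i \<omega> \<noteq> X j \<omega>"
proof -
  interpret \<mu>: prob_space \<mu> by (rule prob_space_\<mu>)
  interpret \<mu>\<mu>: pair_sigma_finite \<mu> \<mu> ..
  have "AE \<omega> in P. X i \<omega> \<noteq> X j \<omega>" if ij: "i \<noteq> j" for i j
  proof -
    have "AE p in \<mu> \<Otimes>\<^sub>M \<mu>. fst p \<noteq> snd p"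
    proof (rule \<mu>\<mu>.AE_pair_measure[where P="\<lambda>p. fst p \<noteq> snd p"])
      have "AE x in \<mu>. AE y in \<mu>. x \<noteq> y"
      proof (rule AE_I2)
        fix x
        show "AE y in \<mu>. x \<noteq> y"
          by (rule AE_I'[of "{x}"]) (use atomless_singleton[OF assms, of x] in \<open>auto simp: null_sets_def\<close>)
      qed
      then show "AE x in \<mu>. AE y in \<mu>. fst (x, y) \<noteq> snd (x, y)" by simp
    qed measurable
    then have "AE p in distr P (borel \<Otimes>\<^sub>M borel) (\<lambda>\<omega>. (X i \<omega>, X j \<omega>)). fst p \<noteq> snd p"
      unfolding distr_X_pair[OF ij] .
    then show ?thesis by (subst (asm) AE_distr_iff) auto
  qed
  then show ?thesis by (simp add: AE_all_countable)
qed

lemma emeasure_bind_sample: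
  assumes \<kappa>: "\<kappa> \<in> borel \<rightarrow>\<^sub>M subprob_algebra borel" and B: "B \<in> sets borel"
  shows "emeasure (\<mu> \<bind> \<kappa>) B = (\<integral>\<^sup>+\<omega>. emeasure (\<kappa> (X i \<omega>)) B \<partial>P)"
proof -
  have "\<kappa> \<in> \<mu> \<rightarrow>\<^sub>M subprob_algebra borel" using \<kappa> by (simp add: measurable_cong_sets[OF sets_\<mu> refl])
  then have "emeasure (\<mu> \<bind> \<kappa>) B = (\<integral>\<^sup>+x. emeasure (\<kappa> x) B \<partial>\<mu>)"
    using B by (intro emeasure_bind) auto
  also have "\<dots> = (\<integral>\<^sup>+x. emeasure (\<kappa> x) B \<partial>distr P borel (X i))" by (simp add: distr_X)
  also have "\<dots> = (\<integral>\<^sup>+\<omega>. emeasure (\<kappa> (X i \<omega>)) B \<partial>P)"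
    using measurable_emeasure_kernel[OF \<kappa> B] by (intro nn_integral_distr) auto
  finally show ?thesis .
qed

context
  fixes \<gamma> :: "'w \<Rightarrow> ('x \<times> 'y::polish_space) measure" and N \<nu>
  assumes \<gamma>: "\<gamma> \<in> random_measures P" and N: "0 < N" and rep: "represents P X N \<nu> \<gamma>"
begin

lemma represents_kernel: "i < N \<Longrightarrow> \<nu> i \<in> borel \<rightarrow>\<^sub>M prob_algebra borel"
  using rep by (auto simp: represents_def measurable_family_iff)

lemma represents_kernel_space: "i < N \<Longrightarrow> prob_space (\<nu> i x)" "i < N \<Longrightarrow> sets (\<nu> i x) = sets borel"
  using measurable_space[OF represents_kernel, of i x] by (auto simp: space_prob_algebra)

lemma represents_kernel_\<mu>: "i < N \<Longrightarrow> \<nu> i \<in> \<mu> \<rightarrow>\<^sub>M subprob_algebra borel"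
  using measurable_prob_algebraD[OF represents_kernel] by (simp add: measurable_cong_sets[OF sets_\<mu> refl])

lemma nn_integral_represents:
  assumes \<omega>: "\<omega> \<in> space P" and h: "h \<in> borel_measurable borel"
  shows "(\<integral>\<^sup>+p. h p \<partial>\<gamma> \<omega>) = (\<Sum>i<N. \<integral>\<^sup>+y. h (X i \<omega>, y) \<partial>\<nu> i (X i \<omega>)) / of_nat N"
proof -
  have s\<gamma>: "sets (\<gamma> \<omega>) = sets borel"
    by (rule random_measure_space(2)[OF \<gamma> \<omega>])
  have sK: "sets (return borel (X i \<omega>) \<Otimes>\<^sub>M \<nu> i (X i \<omega>)) = sets (borel :: ('x \<times> 'y) measure)" if "i < N" for i
    unfolding borel_prod[symmetric] by (intro sets_pair_measure_cong) (simp_all add: represents_kernel_space that)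
  have "(\<integral>\<^sup>+p. h p \<partial>\<gamma> \<omega>) = (\<Sum>i<N. \<integral>\<^sup>+p. h p \<partial>(return borel (X i \<omega>) \<Otimes>\<^sub>M \<nu> i (X i \<omega>))) / of_nat N"
    using rep \<omega> h s\<gamma> sK
    by (intro nn_integral_average) (auto simp: represents_def measurable_cong_sets[OF s\<gamma> refl])
  also have "(\<Sum>i<N. \<integral>\<^sup>+p. h p \<partial>(return borel (X i \<omega>) \<Otimes>\<^sub>M \<nu> i (X i \<omega>)))
      = (\<Sum>i<N. \<integral>\<^sup>+y. h (X i \<omega>, y) \<partial>\<nu> i (X i \<omega>))"
    by (intro sum.cong refl nn_integral_return_pair represents_kernel_space h) auto
  finally show ?thesis .
qed

lemma represents_integral_measurable:
  assumes "i < N" and h: "h \<in> borel_measurable borel"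
  shows "(\<lambda>x. \<integral>\<^sup>+y. h (x, y) \<partial>\<nu> i x) \<in> borel_measurable borel"
proof -
  have "(\<lambda>(x, y). h (x, y)) \<in> borel_measurable (borel \<Otimes>\<^sub>M borel)"
    unfolding borel_prod using h by (simp add: split_beta')
  then show ?thesis
    by (rule nn_integral_measurable_subprob_algebra2)
      (rule measurable_prob_algebraD[OF represents_kernel[OF assms(1)]])
qed

lemma nn_integral_mean_represents:
  assumes h: "h \<in> borel_measurable borel"
  shows "(\<integral>\<^sup>+p. h p \<partial>(P \<bind> \<gamma>)) = (\<Sum>i<N. \<integral>\<^sup>+x. \<integral>\<^sup>+y. h (x, y) \<partial>\<nu> i x \<partial>\<mu>) / of_nat N"
proof -
  note m = represents_integral_measurable[OF _ h]
  have mX: "(\<lambda>\<omega>. \<integral>\<^sup>+y. h (X i \<omega>, y) \<partial>\<nu> i (X i \<omega>)) \<in> borel_measurable P" if "i \<in> {..<N}" for i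
    using that by (intro measurable_compose[OF X_measurable m]) simp
  have "(\<integral>\<^sup>+p. h p \<partial>(P \<bind> \<gamma>)) = (\<integral>\<^sup>+\<omega>. \<integral>\<^sup>+p. h p \<partial>\<gamma> \<omega> \<partial>P)"
    by (rule nn_integral_bind[OF h random_measure_kernel[OF \<gamma>]])
  also have "\<dots> = (\<integral>\<^sup>+\<omega>. (\<Sum>i<N. \<integral>\<^sup>+y. h (X i \<omega>, y) \<partial>\<nu> i (X i \<omega>)) / of_nat N \<partial>P)"
    by (intro nn_integral_cong nn_integral_represents h)
  also have "\<dots> = (\<integral>\<^sup>+\<omega>. (\<Sum>i<N. \<integral>\<^sup>+y. h (X i \<omega>, y) \<partial>\<nu> i (X i \<omega>)) \<partial>P) / of_nat N"
    by (rule nn_integral_divide) (rule borel_measurable_sum[OF mX])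
  also have "(\<integral>\<^sup>+\<omega>. (\<Sum>i<N. \<integral>\<^sup>+y. h (X i \<omega>, y) \<partial>\<nu> i (X i \<omega>)) \<partial>P)
      = (\<Sum>i<N. \<integral>\<^sup>+\<omega>. (\<integral>\<^sup>+y. h (X i \<omega>, y) \<partial>\<nu> i (X i \<omega>)) \<partial>P)"
    by (rule nn_integral_sum[OF mX])
  also have "\<dots> = (\<Sum>i<N. \<integral>\<^sup>+x. \<integral>\<^sup>+y. h (x, y) \<partial>\<nu> i x \<partial>\<mu>)"
  proof (intro sum.cong refl)
    fix i assume "i \<in> {..<N}"
    then have "(\<integral>\<^sup>+x. \<integral>\<^sup>+y. h (x, y) \<partial>\<nu> i x \<partial>distr P borel (X i)) = (\<integral>\<^sup>+\<omega>. (\<integral>\<^sup>+y. h (X i \<omega>, y) \<partial>\<nu> i (X i \<omega>)) \<partial>P)"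
      using m by (intro nn_integral_distr) auto
    then show "(\<integral>\<^sup>+\<omega>. (\<integral>\<^sup>+y. h (X i \<omega>, y) \<partial>\<nu> i (X i \<omega>)) \<partial>P) = (\<integral>\<^sup>+x. \<integral>\<^sup>+y. h (x, y) \<partial>\<nu> i x \<partial>\<mu>)"
      by (simp add: distr_X)
  qed
  finally show ?thesis .
qed

lemma emeasure_mean_represents:
  assumes A: "A \<in> sets borel"
  shows "emeasure (P \<bind> \<gamma>) A = (\<Sum>i<N. \<integral>\<^sup>+x. \<integral>\<^sup>+y. indicator A (x, y) \<partial>\<nu> i x \<partial>\<mu>) / of_nat N"
  unfolding nn_integral_mean_represents[OF borel_measurable_indicator[OF A], symmetric]
  using A mean_measure(2)[OF \<gamma>] by (metis nn_integral_indicator)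

lemma emeasure_mean_fst_marginal:
  assumes B: "B \<in> sets borel"
  shows "emeasure (P \<bind> \<gamma>) (B \<times> UNIV) = emeasure \<mu> B"
proof -
  have BU: "B \<times> UNIV \<in> sets borel" using B by (intro borel_Times) auto
  have "(\<integral>\<^sup>+x. \<integral>\<^sup>+y. indicator (B \<times> UNIV) (x, y) \<partial>\<nu> i x \<partial>\<mu>) = emeasure \<mu> B" if i: "i \<in> {..<N}" for i
  proof -
    have "(\<integral>\<^sup>+y. indicator (B \<times> UNIV) (x, y) \<partial>\<nu> i x) = indicator B x" for x
      using prob_space.emeasure_space_1[OF represents_kernel_space(1)] i by (simp add: indicator_times)
    then show ?thesis using B by simp
  qed
  then show ?thesis using N by (simp add: emeasure_mean_represents[OF BU] average_const_ennreal del: sum_constant)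
qed

lemma emeasure_mean_snd_marginal:
  assumes B: "B \<in> sets borel"
  shows "emeasure (P \<bind> \<gamma>) (UNIV \<times> B) = (\<Sum>i<N. emeasure (\<mu> \<bind> \<nu> i) B) / of_nat N"
proof -
  have UB: "UNIV \<times> B \<in> sets borel" using B by (intro borel_Times) auto
  have "(\<integral>\<^sup>+x. \<integral>\<^sup>+y. indicator (UNIV \<times> B) (x, y) \<partial>\<nu> i x \<partial>\<mu>) = emeasure (\<mu> \<bind> \<nu> i) B" if "i \<in> {..<N}" for i
    using that B emeasure_bind[OF _ represents_kernel_\<mu> B, of i]
    by (simp add: indicator_times represents_kernel_space)
  then show ?thesis by (simp add: emeasure_mean_represents[OF UB])
qed

text \<open>For \<open>i \<noteq> j\<close> the samples \<open>X i\<close> and \<open>X j\<close> are independent, so the expected interaction of the particles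
\<open>i\<close> and \<open>j\<close> is that of the averaged kernels \<open>\<mu> \<bind> \<nu> i\<close> and \<open>\<mu> \<bind> \<nu> j\<close>. All randomness has then left the
expression. For \<open>i = j\<close> this would fail.\<close>

lemma nn_integral_open_loop_energy:
  assumes c: "c \<in> borel_measurable borel" and L: "L \<in> borel_measurable borel" and H: "H \<in> borel_measurable borel"
  shows "(\<integral>\<^sup>+\<omega>. (\<integral>\<^sup>+p. c p \<partial>\<gamma> \<omega>)
           + (\<Sum>i<N. L_energy L (\<nu> i (X i \<omega>))) / of_nat N
           + (\<Sum>i<N. \<Sum>j\<in>{..<N} - {i}. H_energy H (\<nu> i (X i \<omega>)) (\<nu> j (X j \<omega>))) / (of_nat N)\<^sup>2
         \<partial>P) =
    (\<integral>\<^sup>+p. c p \<partial>(P \<bind> \<gamma>)) + (\<integral>\<^sup>+p. L (snd p) \<partial>(P \<bind> \<gamma>))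
    + (\<Sum>i<N. \<Sum>j\<in>{..<N} - {i}. H_energy H (\<mu> \<bind> \<nu> i) (\<mu> \<bind> \<nu> j)) / (of_nat N)\<^sup>2"
proof -
  have \<gamma>s: "\<gamma> \<in> P \<rightarrow>\<^sub>M subprob_algebra borel"
    by (rule random_measure_kernel[OF \<gamma>])
  have snd_m: "snd \<in> (borel :: ('x \<times> 'y) measure) \<rightarrow>\<^sub>M borel"
    unfolding borel_prod[symmetric] by simp
  have Ls: "(\<lambda>p. L (snd p)) \<in> borel_measurable (borel :: ('x \<times> 'y) measure)"
    by (rule measurable_compose[OF snd_m L])
  have Lm: "(\<Sum>i<N. L_energy L (\<nu> i (X i \<omega>))) / of_nat N = (\<integral>\<^sup>+p. L (snd p) \<partial>\<gamma> \<omega>)" if "\<omega> \<in> space P" for \<omega>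
    using nn_integral_represents[OF that Ls] by (simp add: L_energy_def)
  have Hm: "(\<lambda>\<omega>. H_energy H (\<nu> i (X i \<omega>)) (\<nu> j (X j \<omega>))) \<in> borel_measurable P"
    and He: "(\<integral>\<^sup>+\<omega>. H_energy H (\<nu> i (X i \<omega>)) (\<nu> j (X j \<omega>)) \<partial>P) = H_energy H (\<mu> \<bind> \<nu> i) (\<mu> \<bind> \<nu> j)"
    if ij: "i < N" "j < N" "i \<noteq> j" for i j
  proof -
    have k: "\<nu> i \<in> \<mu> \<rightarrow>\<^sub>M prob_algebra borel" "\<nu> j \<in> \<mu> \<rightarrow>\<^sub>M prob_algebra borel"
      using represents_kernel ij by (simp_all add: measurable_cong_sets[OF sets_\<mu> refl])
    note e = H_energy_bind[OF prob_space_\<mu> k H]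
    have m: "(\<lambda>p. H_energy H (\<nu> i (fst p)) (\<nu> j (snd p))) \<in> borel_measurable (borel \<Otimes>\<^sub>M borel)"
      using e(2) by (simp add: measurable_cong_sets[OF sets_pair_measure_cong[OF sets_\<mu> sets_\<mu>] refl])
    have p: "(\<lambda>\<omega>. (X i \<omega>, X j \<omega>)) \<in> P \<rightarrow>\<^sub>M borel \<Otimes>\<^sub>M borel" by measurable
    show "(\<lambda>\<omega>. H_energy H (\<nu> i (X i \<omega>)) (\<nu> j (X j \<omega>))) \<in> borel_measurable P"
      using measurable_compose[OF p m] by simp
    show "(\<integral>\<^sup>+\<omega>. H_energy H (\<nu> i (X i \<omega>)) (\<nu> j (X j \<omega>)) \<partial>P) = H_energy H (\<mu> \<bind> \<nu> i) (\<mu> \<bind> \<nu> j)"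
      unfolding e(1)[symmetric] distr_X_pair[OF ij(3), symmetric] using m by (subst nn_integral_distr[OF p]) auto
  qed
  have mm: "(\<lambda>\<omega>. \<integral>\<^sup>+p. h p \<partial>\<gamma> \<omega>) \<in> borel_measurable P" if "h \<in> borel_measurable borel" for h
    by (rule measurable_compose[OF \<gamma>s nn_integral_measurable_subprob_algebra[OF that]])
  define G where "G \<omega> = (\<Sum>i<N. \<Sum>j\<in>{..<N} - {i}. H_energy H (\<nu> i (X i \<omega>)) (\<nu> j (X j \<omega>)))" for \<omega>
  have S: "(\<lambda>\<omega>. \<Sum>j\<in>{..<N} - {i}. H_energy H (\<nu> i (X i \<omega>)) (\<nu> j (X j \<omega>))) \<in> borel_measurable P"
    if "i \<in> {..<N}" for i using that Hm by (intro borel_measurable_sum) auto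
  have Gm: "G \<in> borel_measurable P"
    unfolding G_def[abs_def] by (intro borel_measurable_sum S)
  have G: "(\<integral>\<^sup>+\<omega>. G \<omega> / (of_nat N)\<^sup>2 \<partial>P)
    = (\<Sum>i<N. \<Sum>j\<in>{..<N} - {i}. \<integral>\<^sup>+\<omega>. H_energy H (\<nu> i (X i \<omega>)) (\<nu> j (X j \<omega>)) \<partial>P) / (of_nat N)\<^sup>2"
  proof -
    have "(\<integral>\<^sup>+\<omega>. G \<omega> / (of_nat N)\<^sup>2 \<partial>P)
      = (\<Sum>i<N. \<integral>\<^sup>+\<omega>. (\<Sum>j\<in>{..<N} - {i}. H_energy H (\<nu> i (X i \<omega>)) (\<nu> j (X j \<omega>))) \<partial>P) / (of_nat N)\<^sup>2"
      unfolding nn_integral_divide[OF Gm] unfolding G_def by (subst nn_integral_sum[OF S]) auto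
    also have "\<dots> = (\<Sum>i<N. \<Sum>j\<in>{..<N} - {i}. \<integral>\<^sup>+\<omega>. H_energy H (\<nu> i (X i \<omega>)) (\<nu> j (X j \<omega>)) \<partial>P) / (of_nat N)\<^sup>2"
      using Hm by (intro arg_cong[where f="\<lambda>x. x / (of_nat N)\<^sup>2"] sum.cong refl nn_integral_sum) auto
    finally show ?thesis .
  qed
  have "(\<integral>\<^sup>+\<omega>. (\<integral>\<^sup>+p. c p \<partial>\<gamma> \<omega>)
           + (\<Sum>i<N. L_energy L (\<nu> i (X i \<omega>))) / of_nat N + G \<omega> / (of_nat N)\<^sup>2 \<partial>P)
    = (\<integral>\<^sup>+\<omega>. (\<integral>\<^sup>+p. c p \<partial>\<gamma> \<omega>) + (\<integral>\<^sup>+p. L (snd p) \<partial>\<gamma> \<omega>) + G \<omega> / (of_nat N)\<^sup>2 \<partial>P)"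
    by (intro nn_integral_cong) (simp add: Lm)
  also have "\<dots> = (\<integral>\<^sup>+\<omega>. \<integral>\<^sup>+p. c p \<partial>\<gamma> \<omega> \<partial>P) + (\<integral>\<^sup>+\<omega>. \<integral>\<^sup>+p. L (snd p) \<partial>\<gamma> \<omega> \<partial>P)
           + (\<integral>\<^sup>+\<omega>. G \<omega> / (of_nat N)\<^sup>2 \<partial>P)"
  proof -
    have "(\<integral>\<^sup>+\<omega>. f \<omega> + g \<omega> + h \<omega> \<partial>P) = (\<integral>\<^sup>+\<omega>. f \<omega> \<partial>P) + (\<integral>\<^sup>+\<omega>. g \<omega> \<partial>P) + (\<integral>\<^sup>+\<omega>. h \<omega> \<partial>P)"
      if "f \<in> borel_measurable P" "g \<in> borel_measurable P" "h \<in> borel_measurable P" for f g h :: "'w \<Rightarrow> ennreal"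
      using that by (simp add: nn_integral_add)
    then show ?thesis
      using mm[OF c] mm[OF Ls] borel_measurable_divide_ennreal[OF Gm borel_measurable_const] by blast
  qed
  also note G
  also have "(\<integral>\<^sup>+\<omega>. \<integral>\<^sup>+p. c p \<partial>\<gamma> \<omega> \<partial>P) = (\<integral>\<^sup>+p. c p \<partial>(P \<bind> \<gamma>))"
    by (rule nn_integral_bind[symmetric, OF c \<gamma>s])
  also have "(\<integral>\<^sup>+\<omega>. \<integral>\<^sup>+p. L (snd p) \<partial>\<gamma> \<omega> \<partial>P) = (\<integral>\<^sup>+p. L (snd p) \<partial>(P \<bind> \<gamma>))"
    by (rule nn_integral_bind[symmetric, OF Ls \<gamma>s])
  also have "(\<Sum>i<N. \<Sum>j\<in>{..<N} - {i}. \<integral>\<^sup>+\<omega>. H_energy H (\<nu> i (X i \<omega>)) (\<nu> j (X j \<omega>)) \<partial>P)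
      = (\<Sum>i<N. \<Sum>j\<in>{..<N} - {i}. H_energy H (\<mu> \<bind> \<nu> i) (\<mu> \<bind> \<nu> j))"
    by (intro sum.cong refl He) auto
  finally show ?thesis by (simp only: G_def)
qed

text \<open>When the samples are distinct, only the \<open>i\<close>-th summand of \<open>\<gamma> \<omega>\<close> charges the fibre over \<open>X i \<omega>\<close>.\<close>

lemma represents_unique:
  assumes \<omega>: "\<omega> \<in> space P" and dist: "\<And>i j. i \<noteq> j \<Longrightarrow> X i \<omega> \<noteq> X j \<omega>"
    and rep': "represents P X N \<nu>' \<gamma>" and i: "i < N"
  shows "\<nu>' i (X i \<omega>) = \<nu> i (X i \<omega>)"
proof -
  have main: "emeasure (\<kappa> i (X i \<omega>)) B = emeasure (\<gamma> \<omega>) ({X i \<omega>} \<times> B) * of_nat N"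
    if r: "represents P X N \<kappa> \<gamma>" and B: "B \<in> sets borel" for \<kappa> B
  proof -
    have k: "prob_space (\<kappa> j x)" "sets (\<kappa> j x) = sets borel" if "j < N" for j x
      using r that by (auto simp: represents_def measurable_family_def borel_probs_def)
    have XB: "{X i \<omega>} \<times> B \<in> sets borel" using B by (intro borel_Times) auto
    have "emeasure (\<gamma> \<omega>) ({X i \<omega>} \<times> B)
        = (\<Sum>j<N. emeasure (return borel (X j \<omega>) \<Otimes>\<^sub>M \<kappa> j (X j \<omega>)) ({X i \<omega>} \<times> B)) / of_nat N"
      using r \<omega> XB by (simp add: represents_def)
    also have "(\<Sum>j<N. emeasure (return borel (X j \<omega>) \<Otimes>\<^sub>M \<kappa> j (X j \<omega>)) ({X i \<omega>} \<times> B))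
        = (\<Sum>j<N. if j = i then emeasure (\<kappa> i (X i \<omega>)) B else 0)"
    proof (intro sum.cong refl)
      fix j assume j: "j \<in> {..<N}"
      interpret K: prob_space "\<kappa> j (X j \<omega>)" using k j by auto
      have "emeasure (return borel (X j \<omega>) \<Otimes>\<^sub>M \<kappa> j (X j \<omega>)) ({X i \<omega>} \<times> B)
          = indicator {X i \<omega>} (X j \<omega>) * emeasure (\<kappa> j (X j \<omega>)) B"
        using B k j by (subst K.emeasure_pair_measure_Times) auto
      also have "\<dots> = (if j = i then emeasure (\<kappa> i (X i \<omega>)) B else 0)"
        using dist[of j i] by auto
      finally show "emeasure (return borel (X j \<omega>) \<Otimes>\<^sub>M \<kappa> j (X j \<omega>)) ({X i \<omega>} \<times> B)
        = (if j = i then emeasure (\<kappa> i (X i \<omega>)) B else 0)" .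
    qed
    also have "\<dots> = emeasure (\<kappa> i (X i \<omega>)) B" using i by simp
    finally show ?thesis
      using N by (simp add: ennreal_divide_times of_nat_less_top)
  qed
  show ?thesis
  proof (rule measure_eqI)
    show s: "sets (\<nu>' i (X i \<omega>)) = sets (\<nu> i (X i \<omega>))"
      using rep rep' i by (simp add: represents_def measurable_family_def borel_probs_def)
    fix B assume "B \<in> sets (\<nu>' i (X i \<omega>))"
    then have "B \<in> sets borel" using s represents_kernel_space(2)[OF i] by simp
    then show "emeasure (\<nu>' i (X i \<omega>)) B = emeasure (\<nu> i (X i \<omega>)) B"
      using main[OF rep] main[OF rep'] by simp
  qed
qed

end

lemma J_Omega_eq:
  assumes "\<gamma>\<^sub>0 \<in> couplings_from \<mu>" "AE \<omega> in P. z \<omega> = \<gamma>\<^sub>0"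
  shows "J_Omega P \<mu> c L H z = J_fun c L H \<gamma>\<^sub>0"
proof -
  have "(THE \<gamma>\<^sub>0. \<gamma>\<^sub>0 \<in> couplings_from \<mu> \<and> (AE \<omega> in P. z \<omega> = \<gamma>\<^sub>0)) = \<gamma>\<^sub>0"
  proof (rule the_equality)
    fix \<gamma>\<^sub>1 assume "\<gamma>\<^sub>1 \<in> couplings_from \<mu> \<and> (AE \<omega> in P. z \<omega> = \<gamma>\<^sub>1)"
    then have "AE \<omega> in P. z \<omega> = \<gamma>\<^sub>1" by simp
    with assms(2) have "AE \<omega> in P. \<gamma>\<^sub>1 = \<gamma>\<^sub>0" by eventually_elim simp
    then show "\<gamma>\<^sub>1 = \<gamma>\<^sub>0" by simp
  qed (use assms in simp)
  then show ?thesis using assms by (auto simp: J_Omega_def)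
qed

text \<open>The kernels \<open>\<nu>\<close> obtained here are those that the choice operator in the definition of the functional
selects.\<close>

lemma J_Omega_N_eq:
  fixes \<gamma> :: "'w \<Rightarrow> ('x \<times> 'y::polish_space) measure"
  assumes \<gamma>: "\<gamma> \<in> open_loop_measures P X N" and N: "0 < N"
    and c: "c \<in> borel_measurable borel" and L: "L \<in> borel_measurable borel" and H: "H \<in> borel_measurable borel"
  obtains \<nu> where "represents P X N \<nu> \<gamma>" "J_Omega_N P X c L H N \<gamma> =
    (\<integral>\<^sup>+p. c p \<partial>(P \<bind> \<gamma>)) + (\<integral>\<^sup>+p. L (snd p) \<partial>(P \<bind> \<gamma>))
    + (\<Sum>i<N. \<Sum>j\<in>{..<N} - {i}. H_energy H (\<mu> \<bind> \<nu> i) (\<mu> \<bind> \<nu> j)) / (of_nat N)\<^sup>2"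
proof -
  define \<nu> where "\<nu> = (SOME \<nu>. represents P X N \<nu> \<gamma>)"
  obtain \<nu>' where "represents P X N \<nu>' \<gamma>"
    using \<gamma> by (auto simp: open_loop_measures_def)
  then have rep: "represents P X N \<nu> \<gamma>"
    unfolding \<nu>_def by (rule someI[of "\<lambda>\<nu>. represents P X N \<nu> \<gamma>"])
  have \<gamma>r: "\<gamma> \<in> random_measures P" using \<gamma> by (simp add: open_loop_measures_def)
  show ?thesis
    using that[OF rep] \<gamma> nn_integral_open_loop_energy[OF \<gamma>r N rep c L H]
    by (simp add: J_Omega_N_def Let_def \<nu>_def[symmetric])
qed

end

section \<open>The lower bound\<close>

lemma liminf_add_le_ennreal:
  fixes f g :: "nat \<Rightarrow> ennreal"
  shows "liminf f + liminf g \<le> liminf (\<lambda>n. f n + g n)"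
proof -
  have inc: "incseq (\<lambda>n. INF m\<in>{n..}. u m)" for u :: "nat \<Rightarrow> ennreal"
    by (intro monoI INF_superset_mono) auto
  have "liminf f + liminf g = (SUP n. (INF m\<in>{n..}. f m) + (INF m\<in>{n..}. g m))"
    unfolding liminf_SUP_INF by (intro ennreal_SUP_add[symmetric] inc)
  also have "\<dots> \<le> (SUP n. INF m\<in>{n..}. f m + g m)"
    by (intro SUP_mono' INF_greatest add_mono INF_lower) auto
  finally show ?thesis by (simp add: liminf_SUP_INF)
qed

lemma sup_truncation_ennreal: "(SUP K::nat. min x (of_nat K)) = (x :: ennreal)"
proof -
  have "(SUP K::nat. inf x (of_nat K)) = inf x (SUP K::nat. of_nat K)"
    by (rule inf_SUP[symmetric])
  then show ?thesis by (simp add: inf_min ennreal_SUP_of_nat_eq_top)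
qed

lemma nn_integral_truncation_SUP:
  assumes [measurable]: "H \<in> borel_measurable M"
  shows "(\<integral>\<^sup>+p. H p \<partial>M) = (SUP K::nat. \<integral>\<^sup>+p. min (H p) (of_nat K) \<partial>M)"
proof -
  have "(\<integral>\<^sup>+p. H p \<partial>M) = (\<integral>\<^sup>+p. (SUP K::nat. min (H p) (of_nat K)) \<partial>M)"
    by (simp add: sup_truncation_ennreal)
  also have "\<dots> = (SUP K::nat. \<integral>\<^sup>+p. min (H p) (of_nat K) \<partial>M)"
    by (intro nn_integral_monotone_convergence_SUP)
      (auto simp: incseq_def le_fun_def simp del: min.bounded_iff intro!: min.mono)
  finally show ?thesis .
qed

lemma lower_semicontinuous_truncation:
  assumes "lower_semicontinuous H"
  shows "lower_semicontinuous (\<lambda>p. min (H p) k)"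
  unfolding lower_semicontinuous_def
proof
  fix a
  have "{p. a < min (H p) k} = (if a < k then {p. a < H p} else {})" by auto
  then show "open {p. a < min (H p) k}"
    using assms by (simp add: lower_semicontinuous_def)
qed

lemma lower_semicontinuous_snd:
  assumes "lower_semicontinuous L"
  shows "lower_semicontinuous (\<lambda>p. L (snd p))"
  unfolding lower_semicontinuous_def
proof
  fix a
  have "open (snd -` {y. a < L y})"
    using assms by (intro open_vimage continuous_intros) (simp add: lower_semicontinuous_def)
  then show "open {p. a < L (snd p)}" by (simp add: vimage_def)
qed

context iid_sampling
begin

text \<open>The integral of \<open>g\<close> against an open-loop measure with \<open>N\<close> particles is an average of \<open>N\<close> independent
variables with values in \<open>[0,1]\<close>. The measures are given only for the numbers \<open>r n\<close> of particles; the
triangular array is completed by \<open>0\<close> in the other rows.\<close>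

lemma open_loop_concentration:
  fixes zn :: "nat \<Rightarrow> 'w \<Rightarrow> ('x \<times> 'y::polish_space) measure"
  assumes zn: "\<And>n. zn n \<in> random_measures P" and r: "strict_mono r" "\<And>n. 0 < r n"
    and rep: "\<And>n. represents P X (r n) (\<nu> n) (zn n)"
    and g: "g \<in> borel_measurable borel" "\<And>p. 0 \<le> g p" "\<And>p. g p \<le> (1::real)"
  shows "AE \<omega> in P. (\<lambda>n. (\<integral>p. g p \<partial>zn n \<omega>) - expectation (\<lambda>\<omega>. \<integral>p. g p \<partial>zn n \<omega>)) \<longlonglongrightarrow> 0"
proof -
  have gm: "(\<lambda>p. ennreal (g p)) \<in> borel_measurable borel" using g(1) by measurable
  then have gm': "(\<lambda>(x, y). ennreal (g (x, y))) \<in> borel_measurable (borel \<Otimes>\<^sub>M borel)"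
    unfolding borel_prod by (simp add: split_beta')
  define q where "q n i x = enn2real (\<integral>\<^sup>+y. ennreal (g (x, y)) \<partial>\<nu> n i x)" for n i x
  have qm: "q n i \<in> borel_measurable borel" if "i < r n" for n i
    unfolding q_def using measurable_prob_algebraD[OF represents_kernel[OF zn r(2) rep that]]
    by (intro borel_measurable_enn2real nn_integral_measurable_subprob_algebra2[OF gm'])
  have qe: "(\<integral>\<^sup>+y. ennreal (g (x, y)) \<partial>\<nu> n i x) = ennreal (q n i x)" and q1: "q n i x \<le> 1"
    if "i < r n" for n i x
  proof -
    interpret K: prob_space "\<nu> n i x" by (rule represents_kernel_space[OF zn r(2) rep that])
    have "(\<integral>\<^sup>+y. ennreal (g (x, y)) \<partial>\<nu> n i x) \<le> (\<integral>\<^sup>+y. 1 \<partial>\<nu> n i x)"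
      using g(3) by (intro nn_integral_mono) simp
    then have le: "(\<integral>\<^sup>+y. ennreal (g (x, y)) \<partial>\<nu> n i x) \<le> 1" by (simp add: K.emeasure_space_1)
    then show e: "(\<integral>\<^sup>+y. ennreal (g (x, y)) \<partial>\<nu> n i x) = ennreal (q n i x)"
      unfolding q_def by (subst ennreal_enn2real) (auto simp: less_top[symmetric] top_unique)
    show "q n i x \<le> 1" using le unfolding e by simp
  qed
  have q0: "0 \<le> q n i x" for n i x by (simp add: q_def)
  define h where "h k i x = (if k \<in> range r \<and> i < k then q (inv r k) i x else 0)" for k i x
  have inj: "inj r" using r(1) by (rule strict_mono_imp_inj_on)
  have hr: "h (r n) i = q n i" if "i < r n" for n i
    using that by (auto simp: h_def inv_f_f[OF inj] fun_eq_iff)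
  have h: "h k i \<in> borel_measurable borel" "\<bar>h k i x\<bar> \<le> 1" for k i x
  proof -
    consider n where "k = r n" "i < r n" | "\<not> (k \<in> range r \<and> i < k)" by auto
    then have "h k i \<in> borel_measurable borel \<and> \<bar>h k i x\<bar> \<le> 1"
    proof cases
      case 1
      then show ?thesis using qm q0 q1 by (simp add: hr)
    next
      case 2
      then have "h k i = (\<lambda>_. 0)" by (auto simp: h_def fun_eq_iff)
      then show ?thesis by simp
    qed
    then show "h k i \<in> borel_measurable borel" "\<bar>h k i x\<bar> \<le> 1" by auto
  qed
  have G: "(\<integral>p. g p \<partial>zn n \<omega>) = (\<Sum>i<r n. h (r n) i (X i \<omega>)) / real (r n)" if \<omega>: "\<omega> \<in> space P" for n \<omega>
  proof -
    have sz: "sets (zn n \<omega>) = sets borel"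
      by (rule random_measure_space(2)[OF zn \<omega>])
    have "(\<integral>\<^sup>+p. ennreal (g p) \<partial>zn n \<omega>) = (\<Sum>i<r n. ennreal (h (r n) i (X i \<omega>))) / of_nat (r n)"
      unfolding nn_integral_represents[OF zn r(2) rep \<omega> gm]
      by (intro arg_cong[where f="\<lambda>x. x / of_nat (r n)"] sum.cong refl) (simp add: qe hr)
    also have "\<dots> = ennreal ((\<Sum>i<r n. h (r n) i (X i \<omega>)) / real (r n))"
      using r(2)[of n] q0 hr
      by (subst sum_ennreal) (auto simp: ennreal_of_nat_eq_real_of_nat divide_ennreal sum_nonneg)
    finally have "(\<integral>\<^sup>+p. ennreal (g p) \<partial>zn n \<omega>) = ennreal ((\<Sum>i<r n. h (r n) i (X i \<omega>)) / real (r n))" .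
    moreover have "0 \<le> (\<Sum>i<r n. h (r n) i (X i \<omega>)) / real (r n)"
      using q0 hr by (auto intro!: divide_nonneg_nonneg sum_nonneg)
    ultimately show ?thesis
      using g by (subst integral_eq_nn_integral) (auto simp: measurable_cong_sets[OF sz refl])
  qed
  have E: "expectation (\<lambda>\<omega>. \<integral>p. g p \<partial>zn n \<omega>) = (\<Sum>i<r n. expectation (\<lambda>\<omega>. h (r n) i (X i \<omega>))) / real (r n)" for n
  proof -
    have "expectation (\<lambda>\<omega>. \<integral>p. g p \<partial>zn n \<omega>) = expectation (\<lambda>\<omega>. (\<Sum>i<r n. h (r n) i (X i \<omega>)) / real (r n))"
      by (intro Bochner_Integration.integral_cong refl G)
    moreover have "integrable P (\<lambda>\<omega>. h (r n) i (X i \<omega>))" for i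
      using h measurable_compose[OF X_measurable h(1)] by (intro integrable_const_bound[of _ 1]) auto
    ultimately show ?thesis by simp
  qed
  have "AE \<omega> in P. (\<lambda>n. (\<Sum>i<n. h n i (X i \<omega>)) / real n - (\<Sum>i<n. expectation (\<lambda>\<omega>. h n i (X i \<omega>))) / real n) \<longlonglongrightarrow> 0"
    by (rule triangular_strong_law[OF indep_X h])
  moreover have "AE \<omega> in P. \<omega> \<in> space P" by simp
  ultimately show ?thesis
  proof eventually_elim
    case (elim \<omega>)
    show ?case using LIMSEQ_subseq_LIMSEQ[OF elim(1) r(1)] by (simp add: comp_def G[OF elim(2)] E)
  qed
qed

text \<open>By concentration, the tests \<open>1\<^sub>A(\<omega>) g(p)\<close> yield \<open>E[1\<^sub>A \<integral>g dz] = P(A) E[\<integral>g dz]\<close> for every event \<open>A\<close>, so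
\<open>\<integral>g dz\<close> is almost surely constant. Countably many such \<open>g\<close> determine the masses of a countable family
of open sets, and these determine a measure; so \<open>z\<close> almost surely equals its value \<open>\<gamma>\<^sub>0\<close> at any typical
point. Taking \<open>A\<close> to be the whole space shows that the mean measures converge to \<open>\<gamma>\<^sub>0\<close>. Their first
marginal is \<open>\<mu>\<close>, and an inequality between probability measures on all open sets is an equality.\<close>

lemma open_loop_limit_deterministic:
  fixes z :: "'w \<Rightarrow> ('x \<times> 'y::polish_space) measure"
  assumes z: "z \<in> random_measures P" and zn: "\<And>n. zn n \<in> random_measures P"
    and r: "strict_mono r" "\<And>n. 0 < r n" and rep: "\<And>n. represents P X (r n) (\<nu> n) (zn n)"
    and lim: "\<And>A (g :: 'x \<times> 'y \<Rightarrow> real). A \<in> sets P \<Longrightarrow> continuous_on UNIV g \<Longrightarrow> bounded (range g) \<Longrightarrow>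
      (\<lambda>n. \<integral>\<omega>. indicator A \<omega> * (\<integral>p. g p \<partial>zn n \<omega>) \<partial>P) \<longlonglongrightarrow> (\<integral>\<omega>. indicator A \<omega> * (\<integral>p. g p \<partial>z \<omega>) \<partial>P)"
  obtains \<gamma>\<^sub>0 where "\<gamma>\<^sub>0 \<in> couplings_from \<mu>" "AE \<omega> in P. z \<omega> = \<gamma>\<^sub>0" "liminf_on_opens (\<lambda>n. P \<bind> zn n) \<gamma>\<^sub>0"
proof -
  have I: "integrable P (\<lambda>\<omega>. \<integral>p. g p \<partial>y \<omega>)" and I01: "\<And>\<omega>. \<omega> \<in> space P \<Longrightarrow> \<bar>\<integral>p. g p \<partial>y \<omega>\<bar> \<le> 1"
    if y: "y \<in> random_measures P" and g: "continuous_on UNIV g" "\<And>p. 0 \<le> g p" "\<And>p. g p \<le> 1"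
    for y :: "'w \<Rightarrow> ('x \<times> 'y) measure" and g :: "'x \<times> 'y \<Rightarrow> real"
  proof -
    show b: "\<bar>\<integral>p. g p \<partial>y \<omega>\<bar> \<le> 1" if \<omega>: "\<omega> \<in> space P" for \<omega>
    proof -
      interpret Y: prob_space "y \<omega>" by (rule random_measure_space[OF y \<omega>])
      have i: "integrable (y \<omega>) g"
        using g by (intro integrable_bounded_continuous[OF random_measure_space[OF y \<omega>], of g 1]) auto
      have "(\<integral>p. g p \<partial>y \<omega>) \<le> (\<integral>p. 1 \<partial>y \<omega>)" using g i by (intro integral_mono) auto
      moreover have "0 \<le> (\<integral>p. g p \<partial>y \<omega>)" using g by (intro Bochner_Integration.integral_nonneg) auto
      ultimately show ?thesis by (simp add: Y.prob_space)
    qed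
    show "integrable P (\<lambda>\<omega>. \<integral>p. g p \<partial>y \<omega>)"
      using integral_random_measure_measurable[OF y borel_measurable_continuous_onI[OF g(1)]] b
      by (intro integrable_const_bound[of _ 1]) auto
  qed
  have bdd: "bounded (range g)" if "\<And>p. 0 \<le> g p" "\<And>p. g p \<le> 1" for g :: "'x \<times> 'y \<Rightarrow> real"
    using that by (auto intro!: boundedI[of _ 1])
  have mean: "(\<lambda>n. expectation (\<lambda>\<omega>. \<integral>p. g p \<partial>zn n \<omega>)) \<longlonglongrightarrow> expectation (\<lambda>\<omega>. \<integral>p. g p \<partial>z \<omega>)"
    if g: "continuous_on UNIV g" "\<And>p. 0 \<le> g p" "\<And>p. g p \<le> 1" for g :: "'x \<times> 'y \<Rightarrow> real"
  proof -
    have "(\<integral>\<omega>. indicator (space P) \<omega> * (\<integral>p. g p \<partial>y \<omega>) \<partial>P) = expectation (\<lambda>\<omega>. \<integral>p. g p \<partial>y \<omega>)" for y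
      by (intro Bochner_Integration.integral_cong) auto
    then show ?thesis using lim[of "space P", OF sets.top g(1) bdd[of g, OF g(2,3)]] by simp
  qed
  have const: "AE \<omega> in P. (\<integral>p. g p \<partial>z \<omega>) = expectation (\<lambda>\<omega>. \<integral>p. g p \<partial>z \<omega>)"
    if g: "continuous_on UNIV g" "\<And>p. 0 \<le> g p" "\<And>p. g p \<le> 1" for g :: "'x \<times> 'y \<Rightarrow> real"
  proof (rule density_unique_real)
    show "integrable P (\<lambda>\<omega>. \<integral>p. g p \<partial>z \<omega>)" by (rule I[OF z g])
    define G where "G n \<omega> = (\<integral>p. g p \<partial>zn n \<omega>)" for n \<omega>
    define e where "e n = expectation (G n)" for n
    have Gi: "integrable P (G n)" for n unfolding G_def by (rule I[OF zn g])
    have G1: "\<bar>G n \<omega>\<bar> \<le> 1" if "\<omega> \<in> space P" for n \<omega> unfolding G_def by (rule I01[OF zn g that])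
    have e1: "\<bar>e n\<bar> \<le> 1" for n
    proof -
      have "\<bar>e n\<bar> \<le> expectation (\<lambda>\<omega>. \<bar>G n \<omega>\<bar>)" unfolding e_def by (rule integral_abs_bound)
      also have "\<dots> \<le> expectation (\<lambda>_. 1)"
        using Gi G1 by (intro integral_mono_AE) auto
      finally show ?thesis by (simp add: prob_space)
    qed
    fix A assume A: "A \<in> sets P"
    have iA: "integrable P (\<lambda>\<omega>. indicator A \<omega> * f \<omega>)" if "integrable P f" for f :: "'w \<Rightarrow> real"
      using integrable_mult_indicator[OF A that] by simp
    have "(\<lambda>n. \<integral>\<omega>. indicator A \<omega> * (G n \<omega> - e n) \<partial>P) \<longlonglongrightarrow> (\<integral>\<omega>. 0 \<partial>P)"
    proof (rule integral_dominated_convergence[where w="\<lambda>_. 2"])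
      show "(\<lambda>\<omega>. indicator A \<omega> * (G n \<omega> - e n)) \<in> borel_measurable P" for n
        using A Gi by measurable
      have "AE \<omega> in P. (\<lambda>n. G n \<omega> - e n) \<longlonglongrightarrow> 0"
        unfolding G_def e_def
        by (rule open_loop_concentration[OF zn r rep borel_measurable_continuous_onI[OF g(1)] g(2,3)])
      then show "AE \<omega> in P. (\<lambda>n. indicator A \<omega> * (G n \<omega> - e n)) \<longlonglongrightarrow> 0"
        by eventually_elim (rule tendsto_mult_right_zero)
      show "AE \<omega> in P. norm (indicator A \<omega> * (G n \<omega> - e n)) \<le> 2" for n
      proof (rule AE_I2)
        fix \<omega> assume "\<omega> \<in> space P"
        then have "\<bar>G n \<omega> - e n\<bar> \<le> 2" using G1[of \<omega> n] e1[of n] by linarith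
        then show "norm (indicator A \<omega> * (G n \<omega> - e n)) \<le> 2"
          by (cases "\<omega> \<in> A") auto
      qed
    qed auto
    moreover have "(\<integral>\<omega>. indicator A \<omega> * (G n \<omega> - e n) \<partial>P) = (\<integral>\<omega>. indicator A \<omega> * G n \<omega> \<partial>P) - prob A * e n" for n
    proof -
      have "(\<integral>\<omega>. indicator A \<omega> * (G n \<omega> - e n) \<partial>P) = (\<integral>\<omega>. indicator A \<omega> * G n \<omega> - indicator A \<omega> * e n \<partial>P)"
        by (simp add: right_diff_distrib)
      also have "\<dots> = (\<integral>\<omega>. indicator A \<omega> * G n \<omega> \<partial>P) - (\<integral>\<omega>. indicator A \<omega> * e n \<partial>P)"
        by (intro Bochner_Integration.integral_diff iA Gi) simp
      finally show ?thesis using A by simp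
    qed
    moreover have "(\<lambda>n. (\<integral>\<omega>. indicator A \<omega> * G n \<omega> \<partial>P) - prob A * e n)
        \<longlonglongrightarrow> (\<integral>\<omega>. indicator A \<omega> * (\<integral>p. g p \<partial>z \<omega>) \<partial>P) - prob A * expectation (\<lambda>\<omega>. \<integral>p. g p \<partial>z \<omega>)"
      using lim[OF A g(1) bdd[of g, OF g(2,3)]] mean[OF g] unfolding G_def e_def by (intro tendsto_intros)
    ultimately have "(\<integral>\<omega>. indicator A \<omega> * (\<integral>p. g p \<partial>z \<omega>) \<partial>P) - prob A * expectation (\<lambda>\<omega>. \<integral>p. g p \<partial>z \<omega>) = 0"
      using LIMSEQ_unique by fastforce
    then show "(\<integral>\<omega>\<in>A. (\<integral>p. g p \<partial>z \<omega>) \<partial>P) = (\<integral>\<omega>\<in>A. expectation (\<lambda>\<omega>. \<integral>p. g p \<partial>z \<omega>) \<partial>P)"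
      using A by (simp add: set_lebesgue_integral_def)
  qed simp
  obtain B :: "('x \<times> 'y) set set" where B: "countable B" "topological_basis B"
    using ex_countable_basis by blast
  define \<V> where "\<V> = Union ` {F. finite F \<and> F \<subseteq> B}"
  have \<V>: "countable \<V>" unfolding \<V>_def by (intro countable_image countable_Collect_finite_subset B)
  \<comment> \<open>The constant masses come from the suprema over \<open>k\<close> of the constant integrals of \<open>g k\<close>.\<close>
  have "\<exists>C. AE \<omega> in P. emeasure (z \<omega>) V = C" if "V \<in> \<V>" for V
  proof -
    have V: "open V"
      using that topological_basis_open[OF B(2)] by (auto simp: \<V>_def intro!: open_Union)
    obtain g :: "nat \<Rightarrow> 'x \<times> 'y \<Rightarrow> real" where g: "\<And>k. continuous_on UNIV (g k)" "\<And>k x. 0 \<le> g k x" "\<And>k x. g k x \<le> 1"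
      "\<And>x. incseq (\<lambda>k. g k x)" "\<And>x. (\<lambda>k. g k x) \<longlonglongrightarrow> indicator V x"
      using open_indicator_sup_continuous[OF V] by blast
    have "AE \<omega> in P. \<forall>k. (\<integral>p. g k p \<partial>z \<omega>) = expectation (\<lambda>\<omega>. \<integral>p. g k p \<partial>z \<omega>)"
      using const[OF g(1-3)] by (simp add: AE_all_countable)
    moreover have "AE \<omega> in P. \<omega> \<in> space P" by simp
    ultimately have "AE \<omega> in P. emeasure (z \<omega>) V = (SUP k. ennreal (expectation (\<lambda>\<omega>. \<integral>p. g k p \<partial>z \<omega>)))"
      by eventually_elim (simp add: emeasure_open_eq_SUP_integral[OF random_measure_space[OF z] V g])
    then show ?thesis by blast
  qed
  then obtain C where C: "\<And>V. V \<in> \<V> \<Longrightarrow> AE \<omega> in P. emeasure (z \<omega>) V = C V" by metis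
  have good: "AE \<omega> in P. \<omega> \<in> space P \<and> (\<forall>V\<in>\<V>. emeasure (z \<omega>) V = C V)"
    using C AE_ball_countable'[of \<V> "\<lambda>V \<omega>. emeasure (z \<omega>) V = C V"] \<V> by simp
  obtain \<omega>\<^sub>0 where \<omega>\<^sub>0: "\<omega>\<^sub>0 \<in> space P" "\<And>V. V \<in> \<V> \<Longrightarrow> emeasure (z \<omega>\<^sub>0) V = C V"
  proof (atomize_elim, rule ccontr)
    assume no: "\<not> (\<exists>\<omega>\<^sub>0. \<omega>\<^sub>0 \<in> space P \<and> (\<forall>V. V \<in> \<V> \<longrightarrow> emeasure (z \<omega>\<^sub>0) V = C V))"
    have "AE \<omega> in P. False" using good
    proof eventually_elim
      case (elim \<omega>)
      then show ?case using no by blast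
    qed
    then show False by simp
  qed
  define \<gamma>\<^sub>0 where "\<gamma>\<^sub>0 = z \<omega>\<^sub>0"
  have \<gamma>\<^sub>0: "prob_space \<gamma>\<^sub>0" "sets \<gamma>\<^sub>0 = sets borel" using random_measure_space[OF z \<omega>\<^sub>0(1)] by (auto simp: \<gamma>\<^sub>0_def)
  have det: "AE \<omega> in P. z \<omega> = \<gamma>\<^sub>0"
    using good
  proof eventually_elim
    case (elim \<omega>)
    note p = random_measure_space[OF z, of \<omega>]
    have "liminf_on_opens (\<lambda>_. \<gamma>\<^sub>0) (z \<omega>)"
    proof (rule liminf_on_opens_from_basis[OF B(2,1)])
      fix F assume "finite F" "F \<subseteq> B"
      then have "\<Union>F \<in> \<V>" by (auto simp: \<V>_def)
      then show "emeasure (z \<omega>) (\<Union>F) \<le> liminf (\<lambda>n. emeasure \<gamma>\<^sub>0 (\<Union>F))"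
        using elim \<omega>\<^sub>0 by (simp add: Liminf_const \<gamma>\<^sub>0_def)
    qed (use elim p \<gamma>\<^sub>0 in auto)
    then show ?case
      using elim p \<gamma>\<^sub>0 by (intro prob_measure_eqI_open_le) (auto simp: liminf_on_opens_def Liminf_const)
  qed
  have conv: "liminf_on_opens (\<lambda>n. P \<bind> zn n) \<gamma>\<^sub>0"
  proof (rule liminf_on_opens_from_continuous[OF \<gamma>\<^sub>0 mean_measure[OF zn]])
    fix g :: "'x \<times> 'y \<Rightarrow> real" assume g: "continuous_on UNIV g" "\<And>p. 0 \<le> g p" "\<And>p. g p \<le> 1"
    have "(\<integral>p. g p \<partial>(P \<bind> zn n)) = expectation (\<lambda>\<omega>. \<integral>p. g p \<partial>zn n \<omega>)" for n
    proof (rule integral_bind[where K=borel and B=1 and B'=1])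
      show "zn n \<in> P \<rightarrow>\<^sub>M subprob_algebra borel"
        by (rule random_measure_kernel[OF zn])
      show "AE \<omega> in P. emeasure (zn n \<omega>) (space (zn n \<omega>)) \<le> ennreal 1"
        using random_measure_space[OF zn] by (intro AE_I2) (simp add: prob_space.emeasure_space_1)
    qed (use g in \<open>auto intro: borel_measurable_continuous_onI finite_measure_axioms\<close>)
    moreover have "expectation (\<lambda>\<omega>. \<integral>p. g p \<partial>z \<omega>) = (\<integral>p. g p \<partial>\<gamma>\<^sub>0)"
    proof -
      have "expectation (\<lambda>\<omega>. \<integral>p. g p \<partial>z \<omega>) = expectation (\<lambda>\<omega>. \<integral>p. g p \<partial>\<gamma>\<^sub>0)"
        using det I[OF z g] by (intro integral_cong_AE) auto
      then show ?thesis by (simp add: prob_space)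
    qed
    ultimately show "(\<lambda>n. \<integral>p. g p \<partial>(P \<bind> zn n)) \<longlonglongrightarrow> (\<integral>p. g p \<partial>\<gamma>\<^sub>0)"
      using mean[OF g] by simp
  qed
  interpret \<gamma>\<^sub>0: prob_space \<gamma>\<^sub>0 by (rule \<gamma>\<^sub>0)
  have fst_m: "fst \<in> \<gamma>\<^sub>0 \<rightarrow>\<^sub>M borel"
    unfolding measurable_cong_sets[OF \<gamma>\<^sub>0(2) refl] borel_prod[symmetric] by simp
  have "distr \<gamma>\<^sub>0 borel fst = \<mu>"
  proof (rule prob_measure_eqI_open_le)
    show "prob_space (distr \<gamma>\<^sub>0 borel fst)" by (rule \<gamma>\<^sub>0.prob_space_distr[OF fst_m])
    fix U :: "'x set" assume U: "open U"
    have sp: "space \<gamma>\<^sub>0 = UNIV" using sets_eq_imp_space_eq[OF \<gamma>\<^sub>0(2)] by simp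
    have "emeasure (distr \<gamma>\<^sub>0 borel fst) U = emeasure \<gamma>\<^sub>0 (U \<times> UNIV)"
      using U by (subst emeasure_distr[OF fst_m]) (auto intro!: arg_cong[where f="emeasure \<gamma>\<^sub>0"] simp: sp)
    also have "\<dots> \<le> liminf (\<lambda>n. emeasure (P \<bind> zn n) (U \<times> UNIV))"
      using conv U by (simp add: liminf_on_opens_def open_Times)
    also have "\<dots> = emeasure \<mu> U"
      using U by (simp add: emeasure_mean_fst_marginal[OF zn r(2) rep] Liminf_const)
    finally show "emeasure (distr \<gamma>\<^sub>0 borel fst) U \<le> emeasure \<mu> U" .
  qed (simp_all add: prob_space_\<mu>)
  then have "\<gamma>\<^sub>0 \<in> couplings_from \<mu>" using \<gamma>\<^sub>0 by (simp add: couplings_from_def borel_probs_def)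
  then show ?thesis using that det conv by blast
qed

text \<open>The terms with \<open>c\<close> and \<open>L\<close> are integrals against the mean measures and lower semicontinuous as such.
Let \<open>Q n\<close> be the second marginal of the mean measure. The truncated energy \<open>\<integral>min H K d(Q n \<otimes> Q n)\<close> exceeds
the off-diagonal interaction by at most \<open>K / r n\<close>, which vanishes as \<open>n\<close> grows; only then \<open>K\<close> tends to
infinity.\<close>

lemma J_fun_le_liminf:
  fixes zn :: "nat \<Rightarrow> 'w \<Rightarrow> ('x \<times> 'y::polish_space) measure"
  assumes zn: "\<And>n. zn n \<in> random_measures P" and r: "strict_mono r" "\<And>n. 0 < r n"
    and rep: "\<And>n. represents P X (r n) (\<nu> n) (zn n)"
    and \<gamma>\<^sub>0: "\<gamma>\<^sub>0 \<in> couplings_from \<mu>" and conv: "liminf_on_opens (\<lambda>n. P \<bind> zn n) \<gamma>\<^sub>0"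
    and c: "lower_semicontinuous c" and L: "lower_semicontinuous L" and H: "lower_semicontinuous H"
    and lim: "(\<lambda>n. (\<integral>\<^sup>+p. c p \<partial>(P \<bind> zn n)) + (\<integral>\<^sup>+p. L (snd p) \<partial>(P \<bind> zn n))
      + (\<Sum>i<r n. \<Sum>j\<in>{..<r n} - {i}. H_energy H (\<mu> \<bind> \<nu> n i) (\<mu> \<bind> \<nu> n j)) / (of_nat (r n))\<^sup>2) \<longlonglongrightarrow> l"
  shows "J_fun c L H \<gamma>\<^sub>0 \<le> l"
proof -
  note Hm = lower_semicontinuous_borel_measurable[OF H]
  have \<gamma>p: "prob_space \<gamma>\<^sub>0" "sets \<gamma>\<^sub>0 = sets borel"
    using \<gamma>\<^sub>0 by (auto simp: couplings_from_def borel_probs_def)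
  note bp = mean_measure[OF zn]
  have sndm: "snd \<in> M \<rightarrow>\<^sub>M borel" if "sets M = sets (borel :: ('x \<times> 'y) measure)" for M
    unfolding measurable_cong_sets[OF that refl] borel_prod[symmetric] by simp
  define Q where "Q n = distr (P \<bind> zn n) borel snd" for n
  define Q\<^sub>0 where "Q\<^sub>0 = distr \<gamma>\<^sub>0 borel snd"
  have Qp: "prob_space (Q n)" "sets (Q n) = sets borel" for n
    unfolding Q_def by (auto intro!: prob_space.prob_space_distr bp sndm)
  have Q\<^sub>0p: "prob_space Q\<^sub>0" "sets Q\<^sub>0 = sets borel"
    unfolding Q\<^sub>0_def by (auto intro!: prob_space.prob_space_distr \<gamma>p sndm)
  have em_snd: "emeasure (distr M borel snd) B = emeasure M (UNIV \<times> B)"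
    if "sets M = sets (borel :: ('x \<times> 'y) measure)" "B \<in> sets borel" for M B
    using sets_eq_imp_space_eq[OF that(1)]
    by (subst emeasure_distr[OF sndm[OF that(1)] that(2)]) (auto intro!: arg_cong[where f="emeasure M"])
  have convQ: "liminf_on_opens Q Q\<^sub>0"
    using conv unfolding liminf_on_opens_def Q_def Q\<^sub>0_def
    by (auto simp: em_snd bp \<gamma>p open_Times)
  have emQ: "emeasure (Q n) B = (\<Sum>i<r n. emeasure (\<mu> \<bind> \<nu> n i) B) / of_nat (r n)" if "B \<in> sets borel" for n B
    unfolding Q_def em_snd[OF bp(2) that] by (rule emeasure_mean_snd_marginal[OF zn r(2) rep that])
  have kp: "prob_space (\<mu> \<bind> \<nu> n i)" "sets (\<mu> \<bind> \<nu> n i) = sets borel" if "i < r n" for n i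
  proof -
    interpret \<mu>: prob_space \<mu> by (rule prob_space_\<mu>)
    note ks = represents_kernel_space[OF zn r(2) rep that]
    show "prob_space (\<mu> \<bind> \<nu> n i)"
      using ks by (intro \<mu>.prob_space_bind[OF _ represents_kernel_\<mu>[OF zn r(2) rep that]]) auto
    show "sets (\<mu> \<bind> \<nu> n i) = sets borel" using ks by (intro sets_bind) auto
  qed
  define h where "h n = (\<Sum>i<r n. \<Sum>j\<in>{..<r n} - {i}. H_energy H (\<mu> \<bind> \<nu> n i) (\<mu> \<bind> \<nu> n j)) / (of_nat (r n))\<^sup>2" for n
  define a where "a n = (\<integral>\<^sup>+p. c p \<partial>(P \<bind> zn n))" for n
  define b where "b n = (\<integral>\<^sup>+p. L (snd p) \<partial>(P \<bind> zn n))" for n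
  have lim': "(\<lambda>n. a n + b n + h n) \<longlonglongrightarrow> l" using lim by (simp add: a_def b_def h_def)
  have a: "(\<integral>\<^sup>+p. c p \<partial>\<gamma>\<^sub>0) \<le> liminf a"
    unfolding a_def by (rule nn_integral_le_liminf_lsc[OF \<gamma>p bp conv c])
  have "(\<integral>\<^sup>+p. L (snd p) \<partial>\<gamma>\<^sub>0) \<le> liminf b"
    unfolding b_def by (rule nn_integral_le_liminf_lsc[OF \<gamma>p bp conv lower_semicontinuous_snd[OF L]])
  moreover have "(\<integral>\<^sup>+p. L (snd p) \<partial>\<gamma>\<^sub>0) = L_energy L Q\<^sub>0"
    unfolding L_energy_def Q\<^sub>0_def using lower_semicontinuous_borel_measurable[OF L]
    by (subst nn_integral_distr[OF sndm[OF \<gamma>p(2)]]) auto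
  ultimately have b: "L_energy L Q\<^sub>0 \<le> liminf b" by simp
  have sQ: "sets (N \<Otimes>\<^sub>M N) = sets (borel :: ('y \<times> 'y) measure)" if "sets N = sets (borel :: 'y measure)" for N
    using sets_pair_measure_cong[OF that that] unfolding borel_prod .
  have step: "(\<integral>\<^sup>+p. c p \<partial>\<gamma>\<^sub>0) + L_energy L Q\<^sub>0 + (\<integral>\<^sup>+p. min (H p) (of_nat K) \<partial>(Q\<^sub>0 \<Otimes>\<^sub>M Q\<^sub>0)) \<le> l" for K
  proof -
    define t where "t n = h n + of_nat K / of_nat (r n)" for n
    have "(\<integral>\<^sup>+p. min (H p) (of_nat K) \<partial>(Q\<^sub>0 \<Otimes>\<^sub>M Q\<^sub>0)) \<le> liminf (\<lambda>n. \<integral>\<^sup>+p. min (H p) (of_nat K) \<partial>(Q n \<Otimes>\<^sub>M Q n))"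
      by (rule nn_integral_le_liminf_lsc[OF _ _ _ _ liminf_on_opens_pair[OF Q\<^sub>0p Qp convQ] lower_semicontinuous_truncation[OF H]])
        (auto intro!: prob_space_pair sQ Q\<^sub>0p Qp)
    also have "\<dots> \<le> liminf t"
    proof (intro Liminf_mono always_eventually allI)
      fix n
      show "(\<integral>\<^sup>+p. min (H p) (of_nat K) \<partial>(Q n \<Otimes>\<^sub>M Q n)) \<le> t n"
        unfolding t_def h_def
        by (rule nn_integral_pair_average_truncated_le[OF kp Qp emQ Hm r(2)])
    qed
    finally have t: "(\<integral>\<^sup>+p. min (H p) (of_nat K) \<partial>(Q\<^sub>0 \<Otimes>\<^sub>M Q\<^sub>0)) \<le> liminf t" .
    have "(\<lambda>n. of_nat K / of_nat (r n) :: ennreal) \<longlonglongrightarrow> 0"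
    proof -
      have "(\<lambda>n. real K / real (r n)) \<longlonglongrightarrow> 0"
        by (rule real_tendsto_divide_at_top[OF tendsto_const])
          (rule filterlim_compose[OF filterlim_real_sequentially filterlim_subseq[OF r(1)]])
      then have "(\<lambda>n. ennreal (real K / real (r n))) \<longlonglongrightarrow> ennreal 0" by (rule tendsto_ennrealI)
      moreover have "ennreal (real K / real (r n)) = of_nat K / of_nat (r n)" for n
        using r(2)[of n] by (simp add: divide_ennreal[symmetric] ennreal_of_nat_eq_real_of_nat)
      ultimately show ?thesis by simp
    qed
    then have "(\<lambda>n. (a n + b n + h n) + of_nat K / of_nat (r n)) \<longlonglongrightarrow> l + 0"
      by (intro tendsto_add lim')
    then have "liminf (\<lambda>n. a n + b n + t n) = l"
      by (intro lim_imp_Liminf) (simp_all add: t_def add.assoc)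
    moreover have "(\<integral>\<^sup>+p. c p \<partial>\<gamma>\<^sub>0) + L_energy L Q\<^sub>0 + (\<integral>\<^sup>+p. min (H p) (of_nat K) \<partial>(Q\<^sub>0 \<Otimes>\<^sub>M Q\<^sub>0))
        \<le> liminf a + liminf b + liminf t"
      by (intro add_mono a b t)
    moreover have "liminf a + liminf b + liminf t \<le> liminf (\<lambda>n. a n + b n + t n)"
      using liminf_add_le_ennreal[of a b] liminf_add_le_ennreal[of "\<lambda>n. a n + b n" t]
      by (meson add_right_mono order_trans)
    ultimately show ?thesis by simp
  qed
  have HQ: "H \<in> borel_measurable (Q\<^sub>0 \<Otimes>\<^sub>M Q\<^sub>0)" using Hm by (simp add: measurable_cong_sets[OF sQ[OF Q\<^sub>0p(2)] refl])
  have "J_fun c L H \<gamma>\<^sub>0 = (\<integral>\<^sup>+p. c p \<partial>\<gamma>\<^sub>0) + L_energy L Q\<^sub>0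
      + (SUP K::nat. \<integral>\<^sup>+p. min (H p) (of_nat K) \<partial>(Q\<^sub>0 \<Otimes>\<^sub>M Q\<^sub>0))"
    by (simp add: J_fun_def Let_def H_energy_def Q\<^sub>0_def[symmetric] nn_integral_truncation_SUP[OF HQ])
  also have "\<dots> \<le> l"
    using step by (subst ennreal_SUP_add_right) (auto intro: SUP_least)
  finally show ?thesis .
qed

text \<open>A subsequence attains the lower limit. If that is finite, all but finitely many members of the
subsequence have finite energy and are therefore open-loop measures.\<close>

lemma Gamma_liminf:
  fixes z :: "'w \<Rightarrow> ('x \<times> 'y::polish_space) measure"
  assumes zn: "\<And>n. zn n \<in> random_measures P" and z: "z \<in> random_measures P"
    and lim: "limitin (random_narrow_topology P) zn z sequentially"
    and c: "lower_semicontinuous c" and L: "lower_semicontinuous L" and H: "lower_semicontinuous H"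
  shows "J_Omega P \<mu> c L H z \<le> liminf (\<lambda>N. J_Omega_N P X c L H N (zn N))"
proof (cases "liminf (\<lambda>N. J_Omega_N P X c L H N (zn N)) = top")
  case True
  then show ?thesis by simp
next
  case False
  define J where "J N = J_Omega_N P X c L H N (zn N)" for N
  obtain r\<^sub>0 :: "nat \<Rightarrow> nat" where r\<^sub>0: "strict_mono r\<^sub>0" "(J \<circ> r\<^sub>0) \<longlonglongrightarrow> liminf J"
    using liminf_subseq_lim[of J] by auto
  have "liminf J < top" using False by (simp add: J_def[abs_def] less_top)
  then have "\<forall>\<^sub>F n in sequentially. (J \<circ> r\<^sub>0) n < top" by (rule order_tendstoD(2)[OF r\<^sub>0(2)])
  then obtain k where k: "\<And>n. k \<le> n \<Longrightarrow> J (r\<^sub>0 n) < top" by (auto simp: eventually_sequentially)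
  \<comment> \<open>The shift by \<open>Suc k\<close> removes infinite values and the sample size \<open>0\<close>.\<close>
  define r where "r n = r\<^sub>0 (n + Suc k)" for n
  have r: "strict_mono r" using r\<^sub>0(1) by (auto simp: r_def strict_mono_def)
  have r0: "0 < r n" for n
    using seq_suble[OF r\<^sub>0(1), of "n + Suc k"] by (simp add: r_def)
  have Jr: "(\<lambda>n. J (r n)) \<longlonglongrightarrow> liminf J"
    using LIMSEQ_ignore_initial_segment[OF r\<^sub>0(2), of "Suc k"] by (simp add: r_def comp_def)
  have fin: "J (r n) < top" for n using k by (simp add: r_def)
  have ol: "zn (r n) \<in> open_loop_measures P X (r n)" for n
    using fin[of n] by (auto simp: J_def J_Omega_N_def split: if_splits)
  note m = lower_semicontinuous_borel_measurable
  have ex: "\<forall>n. \<exists>\<nu>. represents P X (r n) \<nu> (zn (r n)) \<and> J (r n) =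
    (\<integral>\<^sup>+p. c p \<partial>(P \<bind> zn (r n))) + (\<integral>\<^sup>+p. L (snd p) \<partial>(P \<bind> zn (r n)))
    + (\<Sum>i<r n. \<Sum>j\<in>{..<r n} - {i}. H_energy H (\<mu> \<bind> \<nu> i) (\<mu> \<bind> \<nu> j)) / (of_nat (r n))\<^sup>2"
    unfolding J_def
    by (intro allI, rule J_Omega_N_eq[OF ol r0 m[OF c] m[OF L] m[OF H]]) blast
  from choice[OF ex]
  obtain \<nu> where rep: "\<And>n. represents P X (r n) (\<nu> n) (zn (r n))" and Jeq: "\<And>n. J (r n) =
    (\<integral>\<^sup>+p. c p \<partial>(P \<bind> zn (r n))) + (\<integral>\<^sup>+p. L (snd p) \<partial>(P \<bind> zn (r n)))
    + (\<Sum>i<r n. \<Sum>j\<in>{..<r n} - {i}. H_energy H (\<mu> \<bind> \<nu> n i) (\<mu> \<bind> \<nu> n j)) / (of_nat (r n))\<^sup>2"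
    by blast
  have tests: "(\<lambda>n. \<integral>\<omega>. indicator A \<omega> * (\<integral>p. g p \<partial>zn (r n) \<omega>) \<partial>P) \<longlonglongrightarrow> (\<integral>\<omega>. indicator A \<omega> * (\<integral>p. g p \<partial>z \<omega>) \<partial>P)"
    if "A \<in> sets P" "continuous_on UNIV g" "bounded (range g)" for A and g :: "'x \<times> 'y \<Rightarrow> real"
    using LIMSEQ_subseq_LIMSEQ[OF random_narrow_limit_tests[OF zn lim that] r] by (simp add: comp_def)
  obtain \<gamma>\<^sub>0 where \<gamma>\<^sub>0: "\<gamma>\<^sub>0 \<in> couplings_from \<mu>" "AE \<omega> in P. z \<omega> = \<gamma>\<^sub>0"
    "liminf_on_opens (\<lambda>n. P \<bind> zn (r n)) \<gamma>\<^sub>0"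
    using open_loop_limit_deterministic[OF z zn r r0 rep tests] by blast
  have "J_fun c L H \<gamma>\<^sub>0 \<le> liminf J"
    using J_fun_le_liminf[OF zn r r0 rep \<gamma>\<^sub>0(1,3) c L H] Jr by (simp add: Jeq)
  then show ?thesis using J_Omega_eq[OF \<gamma>\<^sub>0(1,2)] by (simp add: J_def[abs_def])
qed

end

section \<open>The recovery sequence\<close>

context iid_sampling
begin

context
  fixes \<nu> :: "'x \<Rightarrow> 'y::polish_space measure" and \<gamma>\<^sub>0 :: "('x \<times> 'y) measure"
  assumes \<nu>: "measurable_family \<nu>" and \<gamma>\<^sub>0: "\<gamma>\<^sub>0 = \<mu> \<bind> (\<lambda>x. return borel x \<Otimes>\<^sub>M \<nu> x)"
begin

text \<open>This is the measure \<open>1/N \<Sum>\<^sub>i \<delta>\<^bsub>X\<^sub>i(\<omega>)\<^esub> \<otimes> \<nu>\<^bsup>X\<^sub>i(\<omega>)\<^esup>\<close>, written as the law of a particle that is chosen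
uniformly.\<close>

definition empirical_coupling :: "nat \<Rightarrow> 'w \<Rightarrow> ('x \<times> 'y) measure" where
  "empirical_coupling N \<omega> =
    measure_pmf (pmf_of_set {..<N}) \<bind> (\<lambda>i. return borel (X i \<omega>) \<Otimes>\<^sub>M \<nu> (X i \<omega>))"

lemma pair_kernel: "(\<lambda>x. return borel x \<Otimes>\<^sub>M \<nu> x) \<in> borel \<rightarrow>\<^sub>M prob_algebra borel"
proof -
  have "(\<lambda>x. return borel x \<Otimes>\<^sub>M \<nu> x) \<in> borel \<rightarrow>\<^sub>M prob_algebra (borel \<Otimes>\<^sub>M borel)"
    using \<nu> unfolding measurable_family_iff by (intro measurable_pair_prob measurable_return_prob_space)
  then show ?thesis unfolding borel_prod .
qed

lemma pair_kernel_space: "return borel x \<Otimes>\<^sub>M \<nu> x \<in> space (prob_algebra borel)"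
  using measurable_space[OF pair_kernel, of x] by simp

lemma emeasure_pair_kernel_measurable:
  "A \<in> sets borel \<Longrightarrow> (\<lambda>x. emeasure (return borel x \<Otimes>\<^sub>M \<nu> x) A) \<in> borel_measurable borel"
  by (rule measurable_emeasure_kernel[OF measurable_prob_algebraD[OF pair_kernel]])

lemma pair_kernel_\<mu>: "(\<lambda>x. return borel x \<Otimes>\<^sub>M \<nu> x) \<in> \<mu> \<rightarrow>\<^sub>M subprob_algebra borel"
  using measurable_prob_algebraD[OF pair_kernel] by (simp add: measurable_cong_sets[OF sets_\<mu> refl])

lemma prob_space_\<gamma>\<^sub>0: "prob_space \<gamma>\<^sub>0" and sets_\<gamma>\<^sub>0: "sets \<gamma>\<^sub>0 = sets borel"
proof -
  interpret \<mu>: prob_space \<mu> by (rule prob_space_\<mu>)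
  show "prob_space \<gamma>\<^sub>0" unfolding \<gamma>\<^sub>0 using pair_kernel_space
    by (intro \<mu>.prob_space_bind[OF _ pair_kernel_\<mu>]) (simp add: space_prob_algebra)
  show "sets \<gamma>\<^sub>0 = sets borel" unfolding \<gamma>\<^sub>0 using pair_kernel_space
    by (intro sets_bind) (simp_all add: space_prob_algebra)
qed

lemma emeasure_empirical_coupling:
  assumes N: "0 < N" and A: "A \<in> sets borel"
  shows "emeasure (empirical_coupling N \<omega>) A =
    (\<Sum>i<N. emeasure (return borel (X i \<omega>) \<Otimes>\<^sub>M \<nu> (X i \<omega>)) A) / of_nat N"
proof -
  have "(\<lambda>i. return borel (X i \<omega>) \<Otimes>\<^sub>M \<nu> (X i \<omega>)) \<in> measure_pmf (pmf_of_set {..<N}) \<rightarrow>\<^sub>M subprob_algebra borel"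
    using pair_kernel_space by (auto simp: space_prob_algebra space_subprob_algebra intro: prob_space_imp_subprob_space)
  then show ?thesis
    unfolding empirical_coupling_def using N A
    by (subst emeasure_bind) (auto simp: nn_integral_pmf_of_set lessThan_empty_iff)
qed

lemma empirical_coupling_random_measure:
  assumes N: "0 < N"
  shows "empirical_coupling N \<in> random_measures P"
  unfolding random_measures_eq
proof (rule measurable_prob_algebraI)
  have k: "(\<lambda>i. return borel (X i \<omega>) \<Otimes>\<^sub>M \<nu> (X i \<omega>)) \<in> measure_pmf (pmf_of_set {..<N}) \<rightarrow>\<^sub>M subprob_algebra borel" for \<omega>
    using pair_kernel_space by (auto simp: space_prob_algebra space_subprob_algebra intro: prob_space_imp_subprob_space)
  show ps: "prob_space (empirical_coupling N \<omega>)" for \<omega>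
    unfolding empirical_coupling_def using pair_kernel_space
    by (intro measure_pmf.prob_space_bind[OF _ k]) (auto simp: space_prob_algebra)
  show "empirical_coupling N \<in> P \<rightarrow>\<^sub>M subprob_algebra borel"
  proof (rule measurable_subprob_algebra)
    show "subprob_space (empirical_coupling N \<omega>)" for \<omega> using ps by (rule prob_space_imp_subprob_space)
    show "sets (empirical_coupling N \<omega>) = sets borel" for \<omega>
      unfolding empirical_coupling_def using pair_kernel_space by (intro sets_bind) (auto simp: space_prob_algebra)
    fix A :: "('x \<times> 'y) set" assume A: "A \<in> sets borel"
    have "(\<lambda>\<omega>. emeasure (return borel (X i \<omega>) \<Otimes>\<^sub>M \<nu> (X i \<omega>)) A) \<in> borel_measurable P" for i
      by (rule measurable_compose[OF X_measurable emeasure_pair_kernel_measurable[OF A]])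
    then show "(\<lambda>\<omega>. emeasure (empirical_coupling N \<omega>) A) \<in> borel_measurable P"
      unfolding emeasure_empirical_coupling[OF N A]
      by (intro borel_measurable_divide_ennreal borel_measurable_sum) auto
  qed
qed

lemma represents_empirical_coupling:
  assumes "0 < N"
  shows "represents P X N (\<lambda>_. \<nu>) (empirical_coupling N)"
  using \<nu> emeasure_empirical_coupling[OF assms] by (simp add: represents_def)

lemma mean_empirical_coupling:
  assumes N: "0 < N"
  shows "P \<bind> empirical_coupling N = \<gamma>\<^sub>0"
proof (rule measure_eqI)
  note er = empirical_coupling_random_measure[OF N] and rep = represents_empirical_coupling[OF N]
  show "sets (P \<bind> empirical_coupling N) = sets \<gamma>\<^sub>0" by (simp add: mean_measure[OF er] sets_\<gamma>\<^sub>0)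
  fix A assume "A \<in> sets (P \<bind> empirical_coupling N)"
  then have A: "A \<in> sets borel" by (simp add: mean_measure[OF er])
  have "emeasure \<gamma>\<^sub>0 A = (\<integral>\<^sup>+x. emeasure (return borel x \<Otimes>\<^sub>M \<nu> x) A \<partial>\<mu>)"
    unfolding \<gamma>\<^sub>0 by (rule emeasure_bind[OF _ pair_kernel_\<mu> A]) simp
  also have "\<dots> = (\<integral>\<^sup>+x. \<integral>\<^sup>+y. indicator A (x, y) \<partial>\<nu> x \<partial>\<mu>)"
  proof (intro nn_integral_cong)
    fix x
    have "sets (return borel x \<Otimes>\<^sub>M \<nu> x) = sets borel"
      using pair_kernel_space[of x] by (simp add: space_prob_algebra)
    then have "emeasure (return borel x \<Otimes>\<^sub>M \<nu> x) A = (\<integral>\<^sup>+p. indicator A p \<partial>(return borel x \<Otimes>\<^sub>M \<nu> x))"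
      using A by (metis nn_integral_indicator)
    also have "\<dots> = (\<integral>\<^sup>+y. indicator A (x, y) \<partial>\<nu> x)"
      using \<nu> A by (intro nn_integral_return_pair) (auto simp: measurable_family_def borel_probs_def)
    finally show "emeasure (return borel x \<Otimes>\<^sub>M \<nu> x) A = (\<integral>\<^sup>+y. indicator A (x, y) \<partial>\<nu> x)" .
  qed
  finally show "emeasure (P \<bind> empirical_coupling N) A = emeasure \<gamma>\<^sub>0 A"
    using N by (simp add: emeasure_mean_represents[OF er N rep A] average_const_ennreal del: sum_constant)
qed

text \<open>This is the strong law for the masses that the measures \<open>\<delta>\<^sub>x \<otimes> \<nu>\<^sup>x\<close> give to \<open>V\<close>, evaluated at the samples.
Their expectation is \<open>\<gamma>\<^sub>0 V\<close>.\<close>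

lemma AE_empirical_coupling_tendsto:
  assumes V: "V \<in> sets borel"
  shows "AE \<omega> in P. (\<lambda>N. emeasure (empirical_coupling N \<omega>) V) \<longlonglongrightarrow> emeasure \<gamma>\<^sub>0 V"
proof -
  define h where "h x = measure (return borel x \<Otimes>\<^sub>M \<nu> x) V" for x
  have hm: "h \<in> borel_measurable borel"
    unfolding h_def measure_def using emeasure_pair_kernel_measurable[OF V] by measurable
  have kp: "prob_space (return borel x \<Otimes>\<^sub>M \<nu> x)" for x
    using pair_kernel_space by (simp add: space_prob_algebra)
  have h01: "0 \<le> h x" "h x \<le> 1" for x
    unfolding h_def using kp by (auto simp: prob_space.prob_le_1)
  have he: "emeasure (return borel x \<Otimes>\<^sub>M \<nu> x) V = ennreal (h x)" for x
  proof -
    interpret K: prob_space "return borel x \<Otimes>\<^sub>M \<nu> x" by (rule kp)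
    show ?thesis by (simp add: h_def K.emeasure_eq_measure)
  qed
  interpret \<gamma>\<^sub>0: prob_space \<gamma>\<^sub>0 by (rule prob_space_\<gamma>\<^sub>0)
  have Eh: "expectation (\<lambda>\<omega>. h (X i \<omega>)) = measure \<gamma>\<^sub>0 V" for i
  proof -
    interpret \<mu>: prob_space \<mu> by (rule prob_space_\<mu>)
    have "expectation (\<lambda>\<omega>. h (X i \<omega>)) = (\<integral>x. h x \<partial>distr P borel (X i))"
      using hm by (subst integral_distr) auto
    also have "\<dots> = measure \<gamma>\<^sub>0 V"
      unfolding distr_X \<gamma>\<^sub>0 h_def by (rule \<mu>.measure_bind[OF pair_kernel_\<mu> V, symmetric])
    finally show ?thesis .
  qed
  have "AE \<omega> in P. (\<lambda>N. (\<Sum>i<N. h (X i \<omega>)) / real N - (\<Sum>i<N. expectation (\<lambda>\<omega>. h (X i \<omega>))) / real N) \<longlonglongrightarrow> 0"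
    using hm h01 by (intro triangular_strong_law[OF indep_X, of "\<lambda>_ _. h" 1]) (auto simp: abs_le_iff intro: order_trans[of _ 0])
  then show ?thesis
  proof eventually_elim
    case (elim \<omega>)
    have "(\<lambda>N. ((\<Sum>i<N. h (X i \<omega>)) / real N - (\<Sum>i<N. expectation (\<lambda>\<omega>. h (X i \<omega>))) / real N) + measure \<gamma>\<^sub>0 V)
        \<longlonglongrightarrow> 0 + measure \<gamma>\<^sub>0 V"
      by (intro tendsto_add elim tendsto_const)
    then have "(\<lambda>N. ennreal (((\<Sum>i<N. h (X i \<omega>)) / real N - (\<Sum>i<N. expectation (\<lambda>\<omega>. h (X i \<omega>))) / real N) + measure \<gamma>\<^sub>0 V))
        \<longlonglongrightarrow> emeasure \<gamma>\<^sub>0 V"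
      unfolding \<gamma>\<^sub>0.emeasure_eq_measure by (intro tendsto_ennrealI) simp
    moreover have "\<forall>\<^sub>F N in sequentially. ennreal (((\<Sum>i<N. h (X i \<omega>)) / real N - (\<Sum>i<N. expectation (\<lambda>\<omega>. h (X i \<omega>))) / real N) + measure \<gamma>\<^sub>0 V)
        = emeasure (empirical_coupling N \<omega>) V"
      using eventually_gt_at_top[of 0]
    proof eventually_elim
      case (elim N)
      then show ?case
        using h01 by (simp add: Eh emeasure_empirical_coupling V he sum_nonneg ennreal_of_nat_eq_real_of_nat divide_ennreal)
    qed
    ultimately show ?case by (rule Lim_transform_eventually)
  qed
qed

text \<open>The exceptional null sets are united over a countable family of open sets. At \<open>N = 0\<close>, where
there is no empirical measure, \<open>\<gamma>\<^sub>0\<close> is a placeholder.\<close>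

lemma AE_empirical_coupling_liminf_on_opens:
  "AE \<omega> in P. liminf_on_opens (\<lambda>N. if N = 0 then \<gamma>\<^sub>0 else empirical_coupling N \<omega>) \<gamma>\<^sub>0"
proof -
  obtain B :: "('x \<times> 'y) set set" where B: "countable B" "topological_basis B"
    using ex_countable_basis by blast
  define \<V> where "\<V> = Union ` {F. finite F \<and> F \<subseteq> B}"
  have \<V>: "countable \<V>" unfolding \<V>_def by (intro countable_image countable_Collect_finite_subset B)
  have "V \<in> sets borel" if "V \<in> \<V>" for V
    using that topological_basis_open[OF B(2)] by (auto simp: \<V>_def intro!: borel_open open_Union)
  then have "AE \<omega> in P. \<forall>V\<in>\<V>. (\<lambda>N. emeasure (empirical_coupling N \<omega>) V) \<longlonglongrightarrow> emeasure \<gamma>\<^sub>0 V"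
    by (intro AE_ball_countable' \<V> AE_empirical_coupling_tendsto)
  moreover have "AE \<omega> in P. \<omega> \<in> space P" by simp
  ultimately show ?thesis
  proof eventually_elim
    case (elim \<omega>)
    show ?case
    proof (rule liminf_on_opens_from_basis[OF B(2,1) sets_\<gamma>\<^sub>0])
      show "sets (if N = 0 then \<gamma>\<^sub>0 else empirical_coupling N \<omega>) = sets borel" for N
        using random_measure_space(2)[OF empirical_coupling_random_measure elim(2)]
        by (simp add: sets_\<gamma>\<^sub>0)
      fix F assume "finite F" "F \<subseteq> B"
      then have "\<Union>F \<in> \<V>" by (auto simp: \<V>_def)
      with elim have "(\<lambda>N. emeasure (empirical_coupling N \<omega>) (\<Union>F)) \<longlonglongrightarrow> emeasure \<gamma>\<^sub>0 (\<Union>F)" by blast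
      moreover have "\<forall>\<^sub>F N in sequentially. emeasure (empirical_coupling N \<omega>) (\<Union>F)
          = emeasure (if N = 0 then \<gamma>\<^sub>0 else empirical_coupling N \<omega>) (\<Union>F)"
        using eventually_gt_at_top[of 0] by eventually_elim simp
      ultimately have "(\<lambda>N. emeasure (if N = 0 then \<gamma>\<^sub>0 else empirical_coupling N \<omega>) (\<Union>F)) \<longlonglongrightarrow> emeasure \<gamma>\<^sub>0 (\<Union>F)"
        by (rule Lim_transform_eventually)
      then show "emeasure \<gamma>\<^sub>0 (\<Union>F) \<le> liminf (\<lambda>N. emeasure (if N = 0 then \<gamma>\<^sub>0 else empirical_coupling N \<omega>) (\<Union>F))"
        by (simp add: lim_imp_Liminf)
    qed
  qed
qed

text \<open>The representation in the definition of the functional may differ from \<open>\<nu>\<close>, but the samples are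
almost surely distinct, so its averaged kernels are those of \<open>\<nu>\<close>, that is, the second marginal \<open>n\<close> of
\<open>\<gamma>\<^sub>0\<close>. The \<open>N (N - 1) \<le> N\<^sup>2\<close> interaction terms are all equal to the energy of \<open>n\<close>.\<close>

lemma J_Omega_N_empirical_coupling_le:
  assumes atomless: "atomless \<mu>" and N: "0 < N"
    and c: "c \<in> borel_measurable borel" and L: "L \<in> borel_measurable borel" and H: "H \<in> borel_measurable borel"
  shows "J_Omega_N P X c L H N (empirical_coupling N) \<le> J_fun c L H \<gamma>\<^sub>0"
proof -
  note er = empirical_coupling_random_measure[OF N] and rep = represents_empirical_coupling[OF N]
  have ol: "empirical_coupling N \<in> open_loop_measures P X N"
    using er rep by (auto simp: open_loop_measures_def)
  obtain \<nu>' where rep': "represents P X N \<nu>' (empirical_coupling N)" and J: "J_Omega_N P X c L H N (empirical_coupling N) =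
    (\<integral>\<^sup>+p. c p \<partial>(P \<bind> empirical_coupling N)) + (\<integral>\<^sup>+p. L (snd p) \<partial>(P \<bind> empirical_coupling N))
    + (\<Sum>i<N. \<Sum>j\<in>{..<N} - {i}. H_energy H (\<mu> \<bind> \<nu>' i) (\<mu> \<bind> \<nu>' j)) / (of_nat N)\<^sup>2"
    by (rule J_Omega_N_eq[OF ol N c L H])
  define n where "n = distr \<gamma>\<^sub>0 borel snd"
  have sndm: "snd \<in> \<gamma>\<^sub>0 \<rightarrow>\<^sub>M borel"
    unfolding measurable_cong_sets[OF sets_\<gamma>\<^sub>0 refl] borel_prod[symmetric] by simp
  have n\<nu>: "\<mu> \<bind> \<nu> = n"
  proof (rule measure_eqI)
    have sb: "sets (\<mu> \<bind> \<nu>) = sets borel"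
      using \<nu> by (intro sets_bind) (auto simp: measurable_family_def borel_probs_def)
    then show "sets (\<mu> \<bind> \<nu>) = sets n" by (simp add: n_def)
    fix B assume "B \<in> sets (\<mu> \<bind> \<nu>)"
    then have B: "B \<in> sets borel" by (simp add: sb)
    have "space \<gamma>\<^sub>0 = UNIV" using sets_eq_imp_space_eq[OF sets_\<gamma>\<^sub>0] by simp
    then have "emeasure n B = emeasure \<gamma>\<^sub>0 (UNIV \<times> B)"
      unfolding n_def by (subst emeasure_distr[OF sndm B]) (auto intro!: arg_cong[where f="emeasure \<gamma>\<^sub>0"])
    also have "\<dots> = (\<Sum>i<N. emeasure (\<mu> \<bind> \<nu>) B) / of_nat N"
      using emeasure_mean_snd_marginal[OF er N rep B] by (simp add: mean_empirical_coupling[OF N])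
    also have "\<dots> = emeasure (\<mu> \<bind> \<nu>) B"
      using N by (rule average_const_ennreal)
    finally show "emeasure (\<mu> \<bind> \<nu>) B = emeasure n B" by simp
  qed
  have n\<nu>': "\<mu> \<bind> \<nu>' i = n" if i: "i < N" for i
    unfolding n\<nu>[symmetric]
  proof (rule measure_eqI)
    have sb: "sets (\<mu> \<bind> \<nu>' i) = sets borel" "sets (\<mu> \<bind> \<nu>) = sets borel"
      using represents_kernel_space[OF er N rep' i] represents_kernel_space[OF er N rep i]
      by (auto intro!: sets_bind)
    then show "sets (\<mu> \<bind> \<nu>' i) = sets (\<mu> \<bind> \<nu>)" by simp
    fix B assume "B \<in> sets (\<mu> \<bind> \<nu>' i)"
    then have B: "B \<in> sets borel" by (simp add: sb)
    have AE: "AE \<omega> in P. \<nu>' i (X i \<omega>) = \<nu> (X i \<omega>)"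
      using AE_samples_distinct[OF atomless] AE_space
    proof eventually_elim
      case (elim \<omega>)
      then show ?case using represents_unique[OF er N rep elim(2) _ rep' i] by blast
    qed
    have "emeasure (\<mu> \<bind> \<nu>' i) B = (\<integral>\<^sup>+\<omega>. emeasure (\<nu>' i (X i \<omega>)) B \<partial>P)"
      by (rule emeasure_bind_sample[OF measurable_prob_algebraD[OF represents_kernel[OF er N rep' i]] B])
    also have "\<dots> = (\<integral>\<^sup>+\<omega>. emeasure (\<nu> (X i \<omega>)) B \<partial>P)"
    proof (rule nn_integral_cong_AE)
      show "AE \<omega> in P. emeasure (\<nu>' i (X i \<omega>)) B = emeasure (\<nu> (X i \<omega>)) B"
        using AE by eventually_elim simp
    qed
    also have "\<dots> = emeasure (\<mu> \<bind> \<nu>) B"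
      by (rule emeasure_bind_sample[OF measurable_prob_algebraD[OF represents_kernel[OF er N rep i]] B, symmetric])
    finally show "emeasure (\<mu> \<bind> \<nu>' i) B = emeasure (\<mu> \<bind> \<nu>) B" .
  qed
  have "(\<Sum>i<N. \<Sum>j\<in>{..<N} - {i}. H_energy H (\<mu> \<bind> \<nu>' i) (\<mu> \<bind> \<nu>' j)) = (\<Sum>i<N. \<Sum>j\<in>{..<N} - {i}. H_energy H n n)"
    by (intro sum.cong refl) (auto simp: n\<nu>')
  also have "\<dots> \<le> (\<Sum>i<N. \<Sum>j<N. H_energy H n n)"
    by (intro sum_mono sum_mono2) auto
  also have "\<dots> = H_energy H n n * (of_nat N)\<^sup>2"
    by (simp add: power2_eq_square ac_simps)
  finally have "(\<Sum>i<N. \<Sum>j\<in>{..<N} - {i}. H_energy H (\<mu> \<bind> \<nu>' i) (\<mu> \<bind> \<nu>' j)) / (of_nat N)\<^sup>2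
      \<le> H_energy H n n * (of_nat N)\<^sup>2 / (of_nat N)\<^sup>2"
    by (rule divide_right_mono_ennreal)
  also have "\<dots> = H_energy H n n"
    using N by (intro mult_divide_eq_ennreal) (auto simp: power_eq_top_ennreal of_nat_less_top)
  finally have "J_Omega_N P X c L H N (empirical_coupling N)
      \<le> (\<integral>\<^sup>+p. c p \<partial>\<gamma>\<^sub>0) + (\<integral>\<^sup>+p. L (snd p) \<partial>\<gamma>\<^sub>0) + H_energy H n n"
    unfolding J mean_empirical_coupling[OF N] by (rule add_left_mono)
  also have "(\<integral>\<^sup>+p. L (snd p) \<partial>\<gamma>\<^sub>0) = L_energy L n"
    unfolding L_energy_def n_def using L by (subst nn_integral_distr[OF sndm]) auto
  finally show ?thesis by (simp add: J_fun_def Let_def n_def)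
qed

end

text \<open>Where the limit functional is infinite, a constant sequence will do.\<close>

lemma Gamma_limsup:
  fixes z :: "'w \<Rightarrow> ('x \<times> 'y::polish_space) measure"
  assumes z: "z \<in> random_measures P" and atomless: "atomless \<mu>"
    and c: "c \<in> borel_measurable borel" and L: "L \<in> borel_measurable borel" and H: "H \<in> borel_measurable borel"
  obtains zn where "\<And>n. zn n \<in> random_measures P" "limitin (random_narrow_topology P) zn z sequentially"
    "limsup (\<lambda>N. J_Omega_N P X c L H N (zn N)) \<le> J_Omega P \<mu> c L H z"
proof (cases "\<exists>\<gamma>\<^sub>0\<in>couplings_from \<mu>. AE \<omega> in P. z \<omega> = \<gamma>\<^sub>0")
  case False
  show ?thesis
  proof (rule that[of "\<lambda>_. z"])
    show "limitin (random_narrow_topology P) (\<lambda>_. z) z sequentially"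
      using z by (auto simp: random_narrow_topology_def limitin_initial_topology)
  qed (use z False in \<open>simp_all add: J_Omega_def\<close>)
next
  case True
  then obtain \<gamma>\<^sub>0 where \<gamma>\<^sub>0: "\<gamma>\<^sub>0 \<in> couplings_from \<mu>" "AE \<omega> in P. z \<omega> = \<gamma>\<^sub>0" by blast
  then have "\<gamma>\<^sub>0 \<in> borel_probs" "distr \<gamma>\<^sub>0 borel fst = \<mu>" by (auto simp: couplings_from_def)
  then obtain \<nu> where \<nu>: "measurable_family \<nu>" "\<gamma>\<^sub>0 = \<mu> \<bind> (\<lambda>x. return borel x \<Otimes>\<^sub>M \<nu> x)"
    using disintegration[of \<gamma>\<^sub>0] by metis
  define zn where "zn N = (if N = 0 then z else empirical_coupling \<nu> N)" for N
  have zn: "zn N \<in> random_measures P" for N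
    using z empirical_coupling_random_measure[OF \<nu>] by (simp add: zn_def)
  show ?thesis
  proof (rule that[OF zn])
    show "limitin (random_narrow_topology P) zn z sequentially"
    proof (rule limitin_random_narrow_topologyI[OF zn z])
      show "AE \<omega> in P. liminf_on_opens (\<lambda>n. zn n \<omega>) (z \<omega>)"
        using AE_empirical_coupling_liminf_on_opens[OF \<nu>] \<gamma>\<^sub>0(2)
      proof eventually_elim
        case (elim \<omega>)
        have "(\<lambda>n. zn n \<omega>) = (\<lambda>N. if N = 0 then \<gamma>\<^sub>0 else empirical_coupling \<nu> N \<omega>)"
          using elim(2) by (auto simp: zn_def)
        then show ?case using elim by simp
      qed
    qed
    have "\<forall>\<^sub>F N in sequentially. J_Omega_N P X c L H N (zn N) \<le> J_fun c L H \<gamma>\<^sub>0"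
      using eventually_gt_at_top[of 0]
      by eventually_elim (simp add: zn_def J_Omega_N_empirical_coupling_le[OF \<nu> atomless _ c L H])
    then show "limsup (\<lambda>N. J_Omega_N P X c L H N (zn N)) \<le> J_Omega P \<mu> c L H z"
      unfolding J_Omega_eq[OF \<gamma>\<^sub>0] by (rule Limsup_bounded)
  qed
qed

end

theorem theorem4p6:
  fixes P :: "'w measure"
    and \<mu> :: "'x::polish_space measure"
    and X :: "nat \<Rightarrow> 'w \<Rightarrow> 'x"
    and c :: "'x \<times> 'y::polish_space \<Rightarrow> ennreal"
    and L :: "'y \<Rightarrow> ennreal"
    and H :: "'y \<times> 'y \<Rightarrow> ennreal"
  assumes "prob_space P"
    and "\<mu> \<in> borel_probs"
    and "atomless \<mu>"
    and "iid_sample P \<mu> X"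
    and "lower_semicontinuous c"
    and "lower_semicontinuous L"
    and "lower_semicontinuous H"
    and "\<And>y y'. H (y, y') = H (y', y)"
    and "\<And>\<kappa>::real. \<kappa> > 0 \<Longrightarrow> compact {y. L y \<le> ennreal \<kappa>}"
  shows "Gamma_converges (random_narrow_topology P)
           (\<lambda>N. J_Omega_N P X c L H N) (J_Omega P \<mu> c L H)"
proof -
  interpret iid_sampling P \<mu> X
    using assms(1,4) by (simp add: iid_sampling_def iid_sampling_axioms_def)
  note m = lower_semicontinuous_borel_measurable
  have top: "topspace (random_narrow_topology P) = random_measures P"
    by (simp add: random_narrow_topology_def)
  show ?thesis
    unfolding Gamma_converges_def top
  proof (intro conjI ballI allI impI)
    fix z :: "'w \<Rightarrow> ('x \<times> 'y) measure" and z\<^sub>N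
    assume "z \<in> random_measures P"
      and "range z\<^sub>N \<subseteq> random_measures P \<and> limitin (random_narrow_topology P) z\<^sub>N z sequentially"
    then show "J_Omega P \<mu> c L H z \<le> liminf (\<lambda>N. J_Omega_N P X c L H N (z\<^sub>N N))"
      by (intro Gamma_liminf assms(5-7)) auto
  next
    fix z :: "'w \<Rightarrow> ('x \<times> 'y) measure" assume "z \<in> random_measures P"
    from Gamma_limsup[OF this assms(3) m[OF assms(5)] m[OF assms(6)] m[OF assms(7)]]
    show "\<exists>z\<^sub>N. range z\<^sub>N \<subseteq> random_measures P \<and> limitin (random_narrow_topology P) z\<^sub>N z sequentially \<and>
        limsup (\<lambda>N. J_Omega_N P X c L H N (z\<^sub>N N)) \<le> J_Omega P \<mu> c L H z"
      by (metis image_subsetI)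
  qed
qed

end
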